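(* Let $1<\alpha<2$, let $s\geq s_0>-\frac{3}{4}(\alpha-1)$ and let $\omega=\frac{1}{\alpha}-\frac{1}{2}$. Then there exist $b'>-\frac{1}{2}$ and $b\in(\frac{1}{2},b'+1)$ and a constant $c>0$ such that $$\|\partial_x(u_1u_2)\|_{X_{s,\omega,b'}}\leq c\left(\|u_1\|_{X_{s,\omega,b}}\|u_2\|_{X_{s_0,\omega,b}}+\|u_1\|_{X_{s_0,\omega,b}}\|u_2\|_{X_{s,\omega,b}}\right)$$ for all $u_1,u_2\in\mathcal{S}(\mathbb{R}^2)$ (Schwartz functions of $(t,x)$).
   Context: The Fourier transform on $\mathbb{R}^n$ is $\mathcal{F}f(\xi)=(2\pi)^{-n/2}\int e^{-ix\cdot\xi}f(x)\,dx$; for functions of $(t,x)\in\mathbb{R}^2$ the dual variables are $(\tau,\xi)$. Write $\langle a\rangle=(1+|a|^2)^{1/2}$. For $0\leq\omega<\frac12$ and $s,b\in\mathbb{R}$, the space $X_{s,\omega,b}$ is the completion of $\mathcal{S}(\mathbb{R}^2)$ with respect to the norm $$\|u\|^2_{X_{s,\omega,b}}=\int_{\mathbb{R}^2}|\xi|^{-2\omega}\langle\xi\rangle^{2s-2\alpha\omega}\langle|\tau|+|\xi|^{1+\alpha}\rangle^{2\omega}\langle\tau-\xi|\xi|^{\alpha}\rangle^{2b}|\mathcal{F}u(\tau,\xi)|^2\,d\tau\,d\xi.$$ *)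

theory Defs
  imports "HOL-Analysis.Analysis"
begin

text \<open>Functions of (t,x) in R^2 are modelled as real \<times> real \<Rightarrow> complex; the first
  component is time t, the second space x. Dual variables (tau, xi) likewise.\<close>

definition pd :: "bool \<Rightarrow> (real \<times> real \<Rightarrow> complex) \<Rightarrow> (real \<times> real \<Rightarrow> complex)" where
  "pd d g = (\<lambda>(t, x). if d then vector_derivative (\<lambda>s. g (s, x)) (at t)
                           else vector_derivative (\<lambda>y. g (t, y)) (at x))"

definition dx :: "(real \<times> real \<Rightarrow> complex) \<Rightarrow> (real \<times> real \<Rightarrow> complex)" where
  "dx g = pd False g"

fun iterpd :: "bool list \<Rightarrow> (real \<times> real \<Rightarrow> complex) \<Rightarrow> (real \<times> real \<Rightarrow> complex)" where
  "iterpd [] f = f"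
| "iterpd (d # ds) f = pd d (iterpd ds f)"

definition schwartz :: "(real \<times> real \<Rightarrow> complex) \<Rightarrow> bool" where
  "schwartz f \<longleftrightarrow> (\<forall>ds.
      (\<forall>t x. (\<lambda>s. iterpd ds f (s, x)) differentiable (at t)
           \<and> (\<lambda>y. iterpd ds f (t, y)) differentiable (at x))
    \<and> continuous_on UNIV (iterpd ds f)
    \<and> (\<forall>a b :: nat. bounded (range (\<lambda>(t, x). complex_of_real (t ^ a * x ^ b) * iterpd ds f (t, x)))))"

text \<open>Fourier transform on R^2 with normalisation (2 pi)^(-n/2), n = 2.\<close>
definition fourier2 :: "(real \<times> real \<Rightarrow> complex) \<Rightarrow> (real \<times> real \<Rightarrow> complex)" where
  "fourier2 f = (\<lambda>(\<tau>, \<xi>). complex_of_real (1 / (2 * pi)) *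
      (LINT p|lborel. cis (- (fst p * \<tau> + snd p * \<xi>)) * f p))"

definition jb :: "real \<Rightarrow> real" where
  "jb a = sqrt (1 + a\<^sup>2)"

definition Xweight :: "real \<Rightarrow> real \<Rightarrow> real \<Rightarrow> real \<Rightarrow> real \<times> real \<Rightarrow> real" where
  "Xweight \<alpha> s \<omega> b = (\<lambda>(\<tau>, \<xi>).
      \<bar>\<xi>\<bar> powr (-2 * \<omega>) * jb \<xi> powr (2 * s - 2 * \<alpha> * \<omega>)
      * jb (\<bar>\<tau>\<bar> + \<bar>\<xi>\<bar> powr (1 + \<alpha>)) powr (2 * \<omega>)
      * jb (\<tau> - \<xi> * \<bar>\<xi>\<bar> powr \<alpha>) powr (2 * b))"

definition Xnorm :: "real \<Rightarrow> real \<Rightarrow> real \<Rightarrow> real \<Rightarrow> (real \<times> real \<Rightarrow> complex) \<Rightarrow> ennreal" where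
  "Xnorm \<alpha> s \<omega> b u =
    (let I = (\<integral>\<^sup>+ p. ennreal (Xweight \<alpha> s \<omega> b p * (cmod (fourier2 u p))\<^sup>2) \<partial>lborel)
     in if I = \<infinity> then \<infinity> else ennreal (sqrt (enn2real I)))"

end

theory Submission
  imports Defs "HOL-Probability.Probability"
begin

text \<open>
  On the Fourier side the claim is an \<open>L\<^sup>2\<close> bound for a bilinear operator whose kernel is a quotient
  of weights. The excess regularity above \<open>- \<rho>\<close>, where \<open>\<rho> < 3/4 (\<alpha> - 1)\<close>, is
  distributed over the two factors, so that only one negative regularity has to be treated.
  For three frequencies with sum zero, largest modulus \<open>N\<close> and smallest modulus \<open>L\<close>, one of the
  three modulations is at least of size \<open>L N\<^sup>\<alpha>\<close>; freezing the point that carries it and applying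
  Cauchy-Schwarz leaves an integral of \<open>h(y) \<langle>t - G(y)\<rangle>\<^sup>-\<^sup>2\<^sup>b\<close> along the phase
  \<open>G(y) = \<phi>(y) + \<phi>(x - y)\<close>, \<open>\<phi>(y) = y \<bar>y\<bar>\<^sup>\<alpha>\<close>, which is bounded as soon as \<open>h \<lesssim> \<bar>G'\<bar>\<close>. The phase is
  degenerate only at \<open>y = x/2\<close>, where a window of width \<open>N powr (- (\<alpha> - 1)/2)\<close> is estimated by its
  measure; for three comparable frequencies this uses \<open>\<rho> < 3/4 (\<alpha> - 1)\<close> up to the endpoint.
  The value \<open>\<omega> = 1/\<alpha> - 1/2\<close> makes the interaction with a frequency of size \<open>N powr (- \<alpha>)\<close> scale
  invariant.
\<close>

section \<open>Japanese brackets\<close>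

lemma jb_ge_1 [simp]: "1 \<le> jb a"
  by (simp add: jb_def)

lemma jb_pos [simp]: "0 < jb a"
  by (rule less_le_trans[OF zero_less_one jb_ge_1])

lemma jb_nonneg [simp]: "0 \<le> jb a"
  by (rule less_imp_le[OF jb_pos])

lemma jb_neq_0 [simp]: "jb a \<noteq> 0"
  using jb_pos[of a] by linarith

lemma jb_minus: "jb (- a) = jb a"
  by (simp add: jb_def)

lemma jb_abs [simp]: "jb \<bar>a\<bar> = jb a"
  by (simp add: jb_def)

lemma jb_ge_abs: "\<bar>a\<bar> \<le> jb a"
  by (simp add: jb_def real_le_rsqrt)

lemma jb_le_iff: "jb a \<le> jb c \<longleftrightarrow> \<bar>a\<bar> \<le> \<bar>c\<bar>"
  by (simp add: jb_def abs_le_square_iff)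

lemma jb_le_one_plus_abs: "jb a \<le> 1 + \<bar>a\<bar>"
  unfolding jb_def by (rule real_le_lsqrt) (auto simp: power2_eq_square algebra_simps)

lemma jb_le_mult:
  assumes "1 \<le> k" "\<bar>a\<bar> \<le> k * \<bar>c\<bar>"
  shows "jb a \<le> k * jb c"
  unfolding jb_def
proof (rule real_le_lsqrt)
  have "a\<^sup>2 \<le> (k * c)\<^sup>2"
    using assms by (simp add: abs_le_square_iff[symmetric] abs_mult)
  moreover have "1 \<le> k\<^sup>2"
    using assms(1) by (rule one_le_power)
  ultimately show "1 + a\<^sup>2 \<le> (k * sqrt (1 + c\<^sup>2))\<^sup>2"
    by (simp add: power_mult_distrib distrib_left)
qed (use assms(1) in simp)

lemma jb_add_le: "jb (a + c) \<le> jb a + jb c"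
proof -
  have "jb (a + c) = norm (Complex 1 (a + c))"
    by (simp add: jb_def cmod_def)
  also have "\<dots> \<le> norm (Complex 1 a) + norm (Complex 0 c)"
    using norm_triangle_ineq[of "Complex 1 a" "Complex 0 c"] by (simp add: plus_complex.ctr)
  also have "norm (Complex 0 c) \<le> jb c"
    using jb_ge_abs by (simp add: cmod_def)
  also have "norm (Complex 1 a) = jb a"
    by (simp add: jb_def cmod_def)
  finally show ?thesis by simp
qed

lemma jb_measurable [measurable]: "jb \<in> borel_measurable borel"
  unfolding jb_def by measurable

lemma jb_powr_nonpos_le_1: "q \<le> 0 \<Longrightarrow> jb a powr q \<le> 1"
  using powr_mono[of q 0 "jb a"] by simp

lemma two_powr_le_8: "q \<le> 3 \<Longrightarrow> 2 powr q \<le> (8 :: real)"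
  using powr_mono[of q 3 "2 :: real"] by simp

lemma jb_powr_le_max:
  assumes "0 \<le> q" "q \<le> 3"
  shows "jb a powr q \<le> 8 * max 1 \<bar>a\<bar> powr q"
proof -
  have "jb a \<le> 2 * max 1 \<bar>a\<bar>"
    using jb_le_one_plus_abs[of a] by simp
  then have "jb a powr q \<le> 2 powr q * max 1 \<bar>a\<bar> powr q"
    unfolding powr_mult[symmetric] by (intro powr_mono2 assms) auto
  also have "\<dots> \<le> 8 * max 1 \<bar>a\<bar> powr q"
    using two_powr_le_8[OF assms(2)] by (rule mult_right_mono) simp
  finally show ?thesis .
qed

lemma jb_powr_add_le:
  assumes "0 \<le> q"
  shows "jb (a + c) powr q \<le> 2 powr q * (jb a powr q + jb c powr q)"
proof -
  have "jb (a + c) \<le> 2 * max (jb a) (jb c)"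
    using jb_add_le[of a c] by (simp add: max_def)
  then have "jb (a + c) powr q \<le> 2 powr q * max (jb a) (jb c) powr q"
    unfolding powr_mult[symmetric] by (intro powr_mono2 assms) auto
  also have "\<dots> \<le> 2 powr q * (jb a powr q + jb c powr q)"
    by (intro mult_left_mono) (auto simp: max_def)
  finally show ?thesis .
qed

lemma jb_powr_neg_mult_le:
  assumes "0 \<le> p"
  shows "jb u powr - p * jb v powr - p \<le> 2 powr p * jb (u + v) powr - p * (jb u powr - p + jb v powr - p)"
proof -
  have ordered: "jb u powr - p * jb v powr - p \<le> 2 powr p * jb (u + v) powr - p * (jb u powr - p + jb v powr - p)"
    if "jb u \<le> jb v" for u v
  proof -
    have "jb (u + v) / 2 \<le> jb v"
      using jb_add_le[of u v] that by simp
    then have "jb v powr - p \<le> (jb (u + v) / 2) powr - p"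
      using assms by (intro powr_mono2') auto
    also have "\<dots> = 2 powr p * jb (u + v) powr - p"
      unfolding powr_divide by (simp add: powr_minus divide_inverse)
    finally have "jb v powr - p \<le> 2 powr p * jb (u + v) powr - p" .
    then have "jb v powr - p * jb u powr - p \<le> 2 powr p * jb (u + v) powr - p * (jb u powr - p + jb v powr - p)"
      by (intro mult_mono) auto
    then show ?thesis by (simp add: mult.commute)
  qed
  show ?thesis
    using ordered[of u v] ordered[of v u] by (cases "jb u \<le> jb v") (simp_all add: ac_simps)
qed

section \<open>Integrals of negative powers of brackets\<close>

lemma nn_integral_lborel_minus_const:
  fixes f :: "'a::euclidean_space \<Rightarrow> ennreal"
  assumes [measurable]: "f \<in> borel_measurable borel"
  shows "(\<integral>\<^sup>+z. f (z - w) \<partial>lborel) = (\<integral>\<^sup>+z. f z \<partial>lborel)"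
proof -
  have "(\<integral>\<^sup>+z. f z \<partial>lborel) = (\<integral>\<^sup>+z. f z \<partial>distr lborel borel ((+) (- w)))"
    by (simp only: lborel_distr_plus)
  also have "\<dots> = (\<integral>\<^sup>+z. f (z - w) \<partial>lborel)"
    by (simp add: nn_integral_distr)
  finally show ?thesis by simp
qed

lemma nn_integral_lborel_const_minus:
  fixes f :: "'a::euclidean_space \<Rightarrow> ennreal"
  assumes [measurable]: "f \<in> borel_measurable borel"
  shows "(\<integral>\<^sup>+w. f (z - w) \<partial>lborel) = (\<integral>\<^sup>+w. f w \<partial>lborel)"
proof -
  have "distr lborel borel ((-) z) = lborel"
    using lborel_affine[of "-1" z] by (simp add: density_1)
  then have "(\<integral>\<^sup>+w. f w \<partial>lborel) = (\<integral>\<^sup>+w. f w \<partial>distr lborel borel ((-) z))"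
    by simp
  also have "\<dots> = (\<integral>\<^sup>+w. f (z - w) \<partial>lborel)"
    by (simp add: nn_integral_distr)
  finally show ?thesis by simp
qed

lemma nn_integral_lborel_uminus:
  fixes f :: "'a::euclidean_space \<Rightarrow> ennreal"
  assumes "f \<in> borel_measurable borel"
  shows "(\<integral>\<^sup>+w. f (- w) \<partial>lborel) = (\<integral>\<^sup>+w. f w \<partial>lborel)"
  using nn_integral_lborel_const_minus[OF assms, of 0] by simp

lemma nn_integral_one_plus_powr_neg:
  assumes "1 < (p :: real)"
  shows "(\<integral>\<^sup>+v. ennreal ((1 + v) powr - p) * indicator {0..} v \<partial>lborel) = ennreal (1 / (p - 1))"
proof -
  define d where "d = p - 1"
  have d_props: "0 < d" "- p = - d - 1"
    using assms by (auto simp: d_def)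
  let ?F = "\<lambda>v::real. - ((1 + v) powr - d / d)"
  have "(\<integral>\<^sup>+v. ennreal ((1 + v) powr - p) * indicator {0..} v \<partial>lborel) = ennreal (0 - ?F 0)"
  proof (rule nn_integral_FTC_atLeast)
    show "(?F has_real_derivative (1 + v) powr - p) (at v)" if "0 \<le> v" for v :: real
      using that d_props by (auto intro!: derivative_eq_intros)
    have "((\<lambda>v::real. (1 + v) powr - d) \<longlongrightarrow> 0) at_top"
      using d_props by (intro tendsto_neg_powr filterlim_tendsto_add_at_top[OF tendsto_const] filterlim_ident) auto
    from tendsto_minus[OF tendsto_divide[OF this tendsto_const[of d]]] d_props
    show "(?F \<longlongrightarrow> 0) at_top" by simp
  qed auto
  then show ?thesis by (simp add: d_def)
qed

lemma nn_integral_jb_powr_neg_finite: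
  assumes "1 < p"
  shows "(\<integral>\<^sup>+v. ennreal (jb v powr - p) \<partial>lborel) < \<infinity>"
proof -
  let ?g = "\<lambda>v. ennreal ((1 + v) powr - p) * indicator {0..} v"
  have "ennreal (jb v powr - p) \<le> ennreal (2 powr p) * (?g v + ?g (- v))" for v
  proof -
    have "(1 + \<bar>v\<bar>) / 2 \<le> jb v"
      using add_mono[OF jb_ge_1[of v] jb_ge_abs[of v]] by simp
    then have "jb v powr - p \<le> ((1 + \<bar>v\<bar>) / 2) powr - p"
      using assms by (intro powr_mono2') auto
    also have "\<dots> = 2 powr p * (1 + \<bar>v\<bar>) powr - p"
      unfolding powr_divide by (simp add: powr_minus divide_inverse)
    finally have "ennreal (jb v powr - p) \<le> ennreal (2 powr p) * ennreal ((1 + \<bar>v\<bar>) powr - p)"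
      by (simp add: ennreal_mult[symmetric] ennreal_leI)
    also have "ennreal ((1 + \<bar>v\<bar>) powr - p) \<le> ?g v + ?g (- v)"
      by (cases "0 \<le> v") auto
    finally show ?thesis by (simp add: mult_left_mono)
  qed
  then have "(\<integral>\<^sup>+v. ennreal (jb v powr - p) \<partial>lborel) \<le> (\<integral>\<^sup>+v. ennreal (2 powr p) * (?g v + ?g (- v)) \<partial>lborel)"
    by (intro nn_integral_mono)
  also have "\<dots> = ennreal (2 powr p) * ((\<integral>\<^sup>+v. ?g v \<partial>lborel) + (\<integral>\<^sup>+v. ?g (- v) \<partial>lborel))"
    by (subst nn_integral_cmult, measurable, subst nn_integral_add, measurable)
  also have "(\<integral>\<^sup>+v. ?g (- v) \<partial>lborel) = (\<integral>\<^sup>+v. ?g v \<partial>lborel)"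
    by (rule nn_integral_lborel_uminus) measurable
  also have "ennreal (2 powr p) * ((\<integral>\<^sup>+v. ?g v \<partial>lborel) + (\<integral>\<^sup>+v. ?g v \<partial>lborel)) < \<infinity>"
    unfolding nn_integral_one_plus_powr_neg[OF assms] by (simp add: ennreal_mult_less_top)
  finally show ?thesis .
qed

lemma nn_integral_jb_convolution_le:
  assumes "0 \<le> p"
  shows "(\<integral>\<^sup>+r. ennreal (jb (r - a) powr - p * jb (c - r) powr - p) \<partial>lborel)
    \<le> ennreal (2 powr p) * (2 * (\<integral>\<^sup>+v. ennreal (jb v powr - p) \<partial>lborel)) * ennreal (jb (c - a) powr - p)"
proof -
  let ?I = "\<integral>\<^sup>+v. ennreal (jb v powr - p) \<partial>lborel"
  have "(\<integral>\<^sup>+r. ennreal (jb (r - a) powr - p * jb (c - r) powr - p) \<partial>lborel)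
    \<le> (\<integral>\<^sup>+r. ennreal (2 powr p * jb (c - a) powr - p) *
        (ennreal (jb (r - a) powr - p) + ennreal (jb (c - r) powr - p)) \<partial>lborel)"
  proof (rule nn_integral_mono)
    fix r
    show "ennreal (jb (r - a) powr - p * jb (c - r) powr - p)
      \<le> ennreal (2 powr p * jb (c - a) powr - p) * (ennreal (jb (r - a) powr - p) + ennreal (jb (c - r) powr - p))"
      using jb_powr_neg_mult_le[OF assms, of "r - a" "c - r"]
      by (simp add: ennreal_mult[symmetric] ennreal_plus[symmetric] ennreal_leI del: ennreal_plus)
  qed
  also have "\<dots> = ennreal (2 powr p * jb (c - a) powr - p) *
      ((\<integral>\<^sup>+r. ennreal (jb (r - a) powr - p) \<partial>lborel) + (\<integral>\<^sup>+r. ennreal (jb (c - r) powr - p) \<partial>lborel))"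
    by (subst nn_integral_cmult, measurable, subst nn_integral_add, measurable)
  also have "(\<integral>\<^sup>+r. ennreal (jb (r - a) powr - p) \<partial>lborel) = ?I"
    by (rule nn_integral_lborel_minus_const) measurable
  also have "(\<integral>\<^sup>+r. ennreal (jb (c - r) powr - p) \<partial>lborel) = ?I"
    by (rule nn_integral_lborel_const_minus) measurable
  finally show ?thesis by (simp add: ennreal_mult mult_2 ac_simps)
qed

section \<open>Substitution along a function with one critical point\<close>

lemma nn_integral_atLeast_le:
  fixes f :: "real \<Rightarrow> ennreal"
  assumes [measurable]: "f \<in> borel_measurable borel"
    and bound: "\<And>n::nat. (\<integral>\<^sup>+y. f y * indicator {a..a + real n} y \<partial>lborel) \<le> C"
  shows "(\<integral>\<^sup>+y. f y * indicator {a..} y \<partial>lborel) \<le> C"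
proof -
  have sup: "(SUP n::nat. f y * indicator {a..a + real n} y) = f y * indicator {a..} y" for y
  proof (cases "a \<le> y")
    case True
    obtain n where "y - a \<le> real n"
      using real_arch_simple by blast
    then have value_at_n: "f y * indicator {a..a + real n} y = f y"
      using True by simp
    show ?thesis
    proof (rule antisym)
      show "(SUP n::nat. f y * indicator {a..a + real n} y) \<le> f y * indicator {a..} y"
        by (intro SUP_least) (auto simp: indicator_def)
      show "f y * indicator {a..} y \<le> (SUP n::nat. f y * indicator {a..a + real n} y)"
        using True value_at_n by (intro SUP_upper2[of n]) auto
    qed
  qed auto
  have "(\<integral>\<^sup>+y. f y * indicator {a..} y \<partial>lborel) = (SUP n::nat. \<integral>\<^sup>+y. f y * indicator {a..a + real n} y \<partial>lborel)"
    unfolding sup[symmetric]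
    by (intro nn_integral_monotone_convergence_SUP)
      (auto simp: incseq_def le_fun_def intro!: mult_left_mono split: split_indicator)
  also have "\<dots> \<le> C"
    by (intro SUP_least bound)
  finally show ?thesis .
qed

lemma nn_integral_substitution_atLeast_le:
  fixes f g g' :: "real \<Rightarrow> real"
  assumes [measurable]: "f \<in> borel_measurable borel" and f_nonneg: "\<And>v. 0 \<le> f v"
    and g: "\<And>y. (g has_real_derivative g' y) (at y)"
    and g': "continuous_on UNIV g'" "\<And>y. a \<le> y \<Longrightarrow> 0 \<le> g' y"
  shows "(\<integral>\<^sup>+y. ennreal (f (g y) * g' y) * indicator {a..} y \<partial>lborel) \<le> (\<integral>\<^sup>+v. ennreal (f v) \<partial>lborel)"
proof (rule nn_integral_atLeast_le)
  have "continuous_on UNIV g"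
    using DERIV_isCont[OF g] by (intro continuous_at_imp_continuous_on) auto
  then have [measurable]: "g \<in> borel_measurable borel" "g' \<in> borel_measurable borel"
    using g'(1) by (simp_all only: borel_measurable_continuous_onI)
  show "(\<lambda>y. ennreal (f (g y) * g' y)) \<in> borel_measurable borel"
    by measurable
  fix n :: nat
  have "(\<integral>\<^sup>+y. ennreal (f (g y) * g' y) * indicator {a..a + real n} y \<partial>lborel)
    = (\<integral>\<^sup>+y. ennreal (f (g y) * g' y * indicator {a..a + real n} y) \<partial>lborel)"
    by (intro nn_integral_cong) (auto simp: indicator_def)
  also have "\<dots> = (\<integral>\<^sup>+v. ennreal (f v * indicator {g a..g (a + real n)} v) \<partial>lborel)"
    by (rule nn_integral_substitution[symmetric])
      (use g g'(2) in \<open>auto intro: continuous_on_subset[OF g'(1)] simp: set_borel_measurable_def\<close>)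
  also have "\<dots> \<le> (\<integral>\<^sup>+v. ennreal (f v) \<partial>lborel)"
    using f_nonneg by (intro nn_integral_mono) (auto simp: indicator_def)
  finally show "(\<integral>\<^sup>+y. ennreal (f (g y) * g' y) * indicator {a..a + real n} y \<partial>lborel)
    \<le> (\<integral>\<^sup>+v. ennreal (f v) \<partial>lborel)" .
qed

lemma nn_integral_substitution_valley_le:
  fixes f g g' :: "real \<Rightarrow> real"
  assumes [measurable]: "f \<in> borel_measurable borel" and f_nonneg: "\<And>v. 0 \<le> f v"
    and g: "\<And>y. (g has_real_derivative g' y) (at y)"
    and g': "continuous_on UNIV g'" "\<And>y. a \<le> y \<Longrightarrow> 0 \<le> g' y" "\<And>y. y \<le> a \<Longrightarrow> g' y \<le> 0"
  shows "(\<integral>\<^sup>+y. ennreal (f (g y) * \<bar>g' y\<bar>) \<partial>lborel) \<le> 2 * (\<integral>\<^sup>+v. ennreal (f v) \<partial>lborel)"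
proof -
  have "continuous_on UNIV g"
    using DERIV_isCont[OF g] by (intro continuous_at_imp_continuous_on) auto
  then have [measurable]: "g \<in> borel_measurable borel" "g' \<in> borel_measurable borel"
    using g'(1) by (simp_all only: borel_measurable_continuous_onI)
  let ?I = "\<integral>\<^sup>+v. ennreal (f v) \<partial>lborel"
  let ?right = "\<lambda>y. ennreal (f (g y) * g' y) * indicator {a..} y"
  let ?left = "\<lambda>y. ennreal (f (g (- y)) * - g' (- y)) * indicator {- a..} y"
  have right: "(\<integral>\<^sup>+y. ?right y \<partial>lborel) \<le> ?I"
    by (rule nn_integral_substitution_atLeast_le) (use assms in auto)
  have left: "(\<integral>\<^sup>+y. ?left y \<partial>lborel) \<le> ?I"
  proof (rule nn_integral_substitution_atLeast_le)
    show "((\<lambda>y. g (- y)) has_real_derivative - g' (- y)) (at y)" for y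
      using DERIV_chain2[OF g DERIV_minus[OF DERIV_ident], of y] by simp
    show "continuous_on UNIV (\<lambda>y. - g' (- y))"
      by (intro continuous_intros continuous_on_compose2[OF g'(1)]) auto
  qed (use f_nonneg g'(3) in auto)
  have "(\<integral>\<^sup>+y. ennreal (f (g y) * \<bar>g' y\<bar>) \<partial>lborel) \<le> (\<integral>\<^sup>+y. ?right y + ?left (- y) \<partial>lborel)"
  proof (rule nn_integral_mono)
    fix y
    show "ennreal (f (g y) * \<bar>g' y\<bar>) \<le> ?right y + ?left (- y)"
      using g'(2)[of y] g'(3)[of y] by (cases "a \<le> y"; cases "y \<le> a") auto
  qed
  also have "\<dots> = (\<integral>\<^sup>+y. ?right y \<partial>lborel) + (\<integral>\<^sup>+y. ?left (- y) \<partial>lborel)"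
    by (rule nn_integral_add) measurable
  also have "(\<integral>\<^sup>+y. ?left (- y) \<partial>lborel) = (\<integral>\<^sup>+y. ?left y \<partial>lborel)"
    by (rule nn_integral_lborel_uminus) measurable
  finally show ?thesis
    using add_mono[OF right left] by (simp add: mult_2)
qed

section \<open>The phase and its resonance function\<close>

definition phase :: "real \<Rightarrow> real \<Rightarrow> real" where
  "phase \<alpha> x = x * \<bar>x\<bar> powr \<alpha>"

lemma phase_minus [simp]: "phase \<alpha> (- x) = - phase \<alpha> x"
  by (simp add: phase_def)

lemma abs_phase: "\<bar>phase \<alpha> x\<bar> = \<bar>x\<bar> powr (1 + \<alpha>)"
  by (simp add: phase_def abs_mult powr_add)

lemma phase_measurable [measurable]: "phase \<alpha> \<in> borel_measurable borel"
  unfolding phase_def[abs_def] by measurable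

lemma phase_has_derivative:
  assumes "0 < \<alpha>"
  shows "(phase \<alpha> has_real_derivative (1 + \<alpha>) * \<bar>y\<bar> powr \<alpha>) (at y)"
proof (cases y "0 :: real" rule: linorder_cases)
  case equal
  have "((\<lambda>h. (phase \<alpha> (0 + h) - phase \<alpha> 0) / h) \<longlongrightarrow> 0) (at 0)"
  proof (rule Lim_transform_eventually)
    have "((\<lambda>h. \<bar>h\<bar> powr \<alpha>) \<longlongrightarrow> \<bar>0\<bar> powr \<alpha>) (at 0)"
      using assms by (intro tendsto_powr' tendsto_intros) auto
    then show "((\<lambda>h. \<bar>h\<bar> powr \<alpha>) \<longlongrightarrow> 0) (at 0)" by simp
    show "\<forall>\<^sub>F h in at 0. \<bar>h\<bar> powr \<alpha> = (phase \<alpha> (0 + h) - phase \<alpha> 0) / h"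
      by (auto simp: eventually_at_filter phase_def)
  qed
  then show ?thesis using equal by (simp add: DERIV_def)
next
  case greater
  have "((\<lambda>y. y * y powr \<alpha>) has_real_derivative (1 + \<alpha>) * \<bar>y\<bar> powr \<alpha>) (at y)"
    using greater by (auto intro!: derivative_eq_intros simp: powr_diff algebra_simps)
  then show ?thesis
    by (rule has_field_derivative_transform_within_open[of _ _ _ "{0<..}"]) (use greater in \<open>auto simp: phase_def\<close>)
next
  case less
  have "((\<lambda>y. y * (- y) powr \<alpha>) has_real_derivative (1 + \<alpha>) * \<bar>y\<bar> powr \<alpha>) (at y)"
    using less by (auto intro!: derivative_eq_intros simp: powr_diff algebra_simps)
  then show ?thesis
    by (rule has_field_derivative_transform_within_open[of _ _ _ "{..<0}"]) (use less in \<open>auto simp: phase_def\<close>)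
qed

lemma phase_add_ge:
  assumes "1 \<le> \<alpha>" "0 \<le> l" "l \<le> m"
  shows "l * (m + l) powr \<alpha> / 2 \<le> phase \<alpha> (m + l) - phase \<alpha> m - phase \<alpha> l"
proof -
  have "l powr \<alpha> \<le> ((1/2) * (m + l)) powr \<alpha>"
    using assms by (intro powr_mono2) auto
  also have "\<dots> \<le> (1/2) * (m + l) powr \<alpha>"
    unfolding powr_mult using powr_mono'[of 1 \<alpha> "1/2"] assms by (intro mult_right_mono) auto
  finally have "l * l powr \<alpha> \<le> l * ((m + l) powr \<alpha> / 2)"
    using assms by (intro mult_left_mono) auto
  moreover have "m * m powr \<alpha> \<le> m * (m + l) powr \<alpha>"
    using assms by (intro mult_left_mono powr_mono2) auto
  moreover have "phase \<alpha> (m + l) - phase \<alpha> m - phase \<alpha> l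
    = m * (m + l) powr \<alpha> - m * m powr \<alpha> + (l * (m + l) powr \<alpha> - l * l powr \<alpha>)"
    using assms by (simp add: phase_def algebra_simps)
  ultimately show ?thesis by linarith
qed

lemma resonance_same_sign:
  assumes \<alpha>: "1 \<le> \<alpha>" and sign: "0 \<le> y * z"
  shows "min \<bar>y\<bar> \<bar>z\<bar> * \<bar>y + z\<bar> powr \<alpha> / 2 \<le> \<bar>phase \<alpha> (y + z) - phase \<alpha> y - phase \<alpha> z\<bar>"
proof -
  have nonneg: "min y z * (y + z) powr \<alpha> / 2 \<le> \<bar>phase \<alpha> (y + z) - phase \<alpha> y - phase \<alpha> z\<bar>"
    if "0 \<le> y" "0 \<le> z" for y z
    using phase_add_ge[OF \<alpha>, of y z] phase_add_ge[OF \<alpha>, of z y] that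
      abs_ge_self[of "phase \<alpha> (y + z) - phase \<alpha> y - phase \<alpha> z"]
    by (cases "y \<le> z") (simp_all add: min_def add.commute)
  consider "0 \<le> y" "0 \<le> z" | "y \<le> 0" "z \<le> 0"
    using sign by (auto simp: zero_le_mult_iff)
  then show ?thesis
  proof cases
    assume "0 \<le> y" "0 \<le> z"
    then show ?thesis using nonneg[of y z] by simp
  next
    assume neg: "y \<le> 0" "z \<le> 0"
    have "phase \<alpha> (- y + - z) = - phase \<alpha> (y + z)"
      unfolding phase_minus[symmetric] by simp
    then have "phase \<alpha> (- y + - z) - phase \<alpha> (- y) - phase \<alpha> (- z) = - (phase \<alpha> (y + z) - phase \<alpha> y - phase \<alpha> z)"
      by simp
    moreover have "\<bar>y\<bar> = - y" "\<bar>z\<bar> = - z" "\<bar>y + z\<bar> = - y + - z"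
      using neg by auto
    ultimately show ?thesis
      using nonneg[of "- y" "- z"] neg by (simp only: abs_minus_cancel neg_0_le_iff_le)
  qed
qed

lemma resonance:
  assumes \<alpha>: "1 \<le> \<alpha>" and ordered: "\<bar>\<xi>\<^sub>2\<bar> \<le> \<bar>\<xi>\<^sub>1\<bar>" and \<xi>: "\<xi> = \<xi>\<^sub>1 + \<xi>\<^sub>2"
    and N: "N = max \<bar>\<xi>\<bar> \<bar>\<xi>\<^sub>1\<bar>" and L: "L = min \<bar>\<xi>\<bar> \<bar>\<xi>\<^sub>2\<bar>"
  shows "L * N powr \<alpha> / 2 \<le> \<bar>phase \<alpha> \<xi> - phase \<alpha> \<xi>\<^sub>1 - phase \<alpha> \<xi>\<^sub>2\<bar>"
proof (cases "0 \<le> \<xi>\<^sub>1 * \<xi>\<^sub>2")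
  case True
  then have "\<bar>\<xi>\<bar> = \<bar>\<xi>\<^sub>1\<bar> + \<bar>\<xi>\<^sub>2\<bar>"
    unfolding \<xi> by (auto simp: zero_le_mult_iff)
  then have "N = \<bar>\<xi>\<bar>" "L = min \<bar>\<xi>\<^sub>1\<bar> \<bar>\<xi>\<^sub>2\<bar>"
    using ordered by (simp_all add: N L max_absorb1 min_absorb2)
  then show ?thesis
    using resonance_same_sign[OF \<alpha> True] by (simp only: \<xi>)
next
  case False
  then have sign: "0 \<le> \<xi> * - \<xi>\<^sub>2" and "\<bar>\<xi>\<^sub>1\<bar> = \<bar>\<xi>\<bar> + \<bar>\<xi>\<^sub>2\<bar>"
    using ordered unfolding \<xi> not_le mult_less_0_iff zero_le_mult_iff by linarith+
  then have "N = \<bar>\<xi>\<^sub>1\<bar>"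
    unfolding N by linarith
  moreover have "\<xi> + - \<xi>\<^sub>2 = \<xi>\<^sub>1"
    by (simp add: \<xi>)
  moreover have "\<bar>phase \<alpha> \<xi>\<^sub>1 - phase \<alpha> \<xi> - - phase \<alpha> \<xi>\<^sub>2\<bar> = \<bar>phase \<alpha> \<xi> - phase \<alpha> \<xi>\<^sub>1 - phase \<alpha> \<xi>\<^sub>2\<bar>"
    by linarith
  ultimately show ?thesis
    using resonance_same_sign[OF \<alpha> sign] by (simp only: L phase_minus abs_minus_cancel)
qed

section \<open>Integration along the phase\<close>

text \<open>The modulus of the derivative of \<open>\<lambda>y. phase \<alpha> y + phase \<alpha> (x - y)\<close>. It vanishes at \<open>x / 2\<close>, where
  \<open>padded_slope\<close> adds a window whose height and width have product \<open>1\<close>.\<close>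

definition phase_slope :: "real \<Rightarrow> real \<Rightarrow> real \<Rightarrow> real" where
  "phase_slope \<alpha> x y = (1 + \<alpha>) * \<bar>\<bar>y\<bar> powr \<alpha> - \<bar>x - y\<bar> powr \<alpha>\<bar>"

definition window_height :: "real \<Rightarrow> real \<Rightarrow> real" where
  "window_height \<alpha> x = max 1 \<bar>x\<bar> powr ((\<alpha> - 1) / 2)"

definition padded_slope :: "real \<Rightarrow> real \<Rightarrow> real \<Rightarrow> real" where
  "padded_slope \<alpha> x y = phase_slope \<alpha> x y + window_height \<alpha> x * of_bool (\<bar>2 * y - x\<bar> \<le> 1 / window_height \<alpha> x)"

lemma window_height_ge_1: "1 \<le> \<alpha> \<Longrightarrow> 1 \<le> window_height \<alpha> x"
  unfolding window_height_def by (intro ge_one_powr_ge_zero) auto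

lemma phase_slope_nonneg: "0 \<le> \<alpha> \<Longrightarrow> 0 \<le> phase_slope \<alpha> x y"
  by (simp add: phase_slope_def)

lemma phase_slope_le_padded_slope: "phase_slope \<alpha> x y \<le> padded_slope \<alpha> x y"
  by (simp add: padded_slope_def window_height_def)

lemma padded_slope_nonneg: "0 \<le> \<alpha> \<Longrightarrow> 0 \<le> padded_slope \<alpha> x y"
  by (rule order_trans[OF phase_slope_nonneg phase_slope_le_padded_slope])

lemma padded_slope_swap: "padded_slope \<alpha> x (x - y) = padded_slope \<alpha> x y"
  by (simp add: padded_slope_def phase_slope_def abs_minus_commute algebra_simps)

lemma phase_slope_measurable [measurable (raw)]:
  assumes [measurable]: "f \<in> borel_measurable M" "g \<in> borel_measurable M"
  shows "(\<lambda>p. phase_slope \<alpha> (f p) (g p)) \<in> borel_measurable M"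
  unfolding phase_slope_def by measurable

lemma window_height_measurable [measurable]: "window_height \<alpha> \<in> borel_measurable borel"
  unfolding window_height_def by measurable

lemma padded_slope_measurable [measurable (raw)]:
  assumes [measurable]: "f \<in> borel_measurable M" "g \<in> borel_measurable M"
  shows "(\<lambda>p. padded_slope \<alpha> (f p) (g p)) \<in> borel_measurable M"
  unfolding padded_slope_def by measurable

lemma nn_integral_phase_slope_le_of_nonneg:
  assumes "0 < \<alpha>" "0 \<le> x" and f: "f \<in> borel_measurable borel" "\<And>v. 0 \<le> f v"
  shows "(\<integral>\<^sup>+y. ennreal (f (phase \<alpha> y + phase \<alpha> (x - y)) * phase_slope \<alpha> x y) \<partial>lborel)
    \<le> 2 * (\<integral>\<^sup>+v. ennreal (f v) \<partial>lborel)"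
proof -
  define g' where "g' y = (1 + \<alpha>) * \<bar>y\<bar> powr \<alpha> - (1 + \<alpha>) * \<bar>x - y\<bar> powr \<alpha>" for y
  have "(\<integral>\<^sup>+y. ennreal (f (phase \<alpha> y + phase \<alpha> (x - y)) * \<bar>g' y\<bar>) \<partial>lborel) \<le> 2 * (\<integral>\<^sup>+v. ennreal (f v) \<partial>lborel)"
  proof (rule nn_integral_substitution_valley_le[OF f])
    show "((\<lambda>y. phase \<alpha> y + phase \<alpha> (x - y)) has_real_derivative g' y) (at y)" for y
      unfolding g'_def using assms(1)
      by (auto intro!: derivative_eq_intros phase_has_derivative DERIV_chain2[OF phase_has_derivative])
    show "continuous_on UNIV g'"
      unfolding g'_def using assms(1) by (intro continuous_intros continuous_on_powr') auto
    show "0 \<le> g' y" if "x / 2 \<le> y" for y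
      using that assms by (auto simp: g'_def intro!: powr_mono2)
    show "g' y \<le> 0" if "y \<le> x / 2" for y
      using that assms by (auto simp: g'_def intro!: powr_mono2)
  qed
  moreover have "phase_slope \<alpha> x y = \<bar>g' y\<bar>" for y
    using assms(1) by (simp add: phase_slope_def g'_def abs_mult right_diff_distrib[symmetric])
  ultimately show ?thesis by simp
qed

lemma nn_integral_phase_slope_le:
  assumes \<alpha>: "0 < \<alpha>" and [measurable]: "f \<in> borel_measurable borel" and f_nonneg: "\<And>v. 0 \<le> f v"
  shows "(\<integral>\<^sup>+y. ennreal (f (phase \<alpha> y + phase \<alpha> (x - y)) * phase_slope \<alpha> x y) \<partial>lborel)
    \<le> 2 * (\<integral>\<^sup>+v. ennreal (f v) \<partial>lborel)"
proof (cases "0 \<le> x")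
  case True
  then show ?thesis
    using assms by (intro nn_integral_phase_slope_le_of_nonneg)
next
  case False
  let ?h = "\<lambda>y. ennreal (f (phase \<alpha> y + phase \<alpha> (x - y)) * phase_slope \<alpha> x y)"
  have reflect: "phase_slope \<alpha> x (- y) = phase_slope \<alpha> (- x) y" "phase \<alpha> (x + y) = - phase \<alpha> (- x - y)" for y
    using phase_minus[of \<alpha> "x + y"] by (simp_all add: phase_slope_def abs_minus_commute[of "- x"] add.commute)
  have "(\<integral>\<^sup>+y. ?h y \<partial>lborel) = (\<integral>\<^sup>+y. ?h (- y) \<partial>lborel)"
    by (rule nn_integral_lborel_uminus[symmetric]) measurable
  also have "\<dots> = (\<integral>\<^sup>+y. ennreal (f (- (phase \<alpha> y + phase \<alpha> (- x - y))) * phase_slope \<alpha> (- x) y) \<partial>lborel)"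
    by (simp add: reflect)
  also have "\<dots> \<le> 2 * (\<integral>\<^sup>+v. ennreal (f (- v)) \<partial>lborel)"
    using False \<alpha> f_nonneg by (intro nn_integral_phase_slope_le_of_nonneg) auto
  also have "(\<integral>\<^sup>+v. ennreal (f (- v)) \<partial>lborel) = (\<integral>\<^sup>+v. ennreal (f v) \<partial>lborel)"
    by (rule nn_integral_lborel_uminus) measurable
  finally show ?thesis .
qed

lemma nn_integral_padded_slope_le:
  assumes \<alpha>: "1 \<le> \<alpha>" and [measurable]: "f \<in> borel_measurable borel" and f_range: "\<And>v. 0 \<le> f v" "\<And>v. f v \<le> 1"
  shows "(\<integral>\<^sup>+y. ennreal (f (phase \<alpha> y + phase \<alpha> (x - y)) * padded_slope \<alpha> x y) \<partial>lborel)
    \<le> 2 * (\<integral>\<^sup>+v. ennreal (f v) \<partial>lborel) + 1"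
proof -
  let ?G = "\<lambda>y. phase \<alpha> y + phase \<alpha> (x - y)" and ?H = "window_height \<alpha> x"
  let ?window = "{x / 2 - 1 / ?H / 2..x / 2 + 1 / ?H / 2}"
  note height = window_height_ge_1[OF \<alpha>, of x]
  have "ennreal (f (?G y) * padded_slope \<alpha> x y)
    \<le> ennreal (f (?G y) * phase_slope \<alpha> x y) + ennreal ?H * indicator ?window y" for y
  proof (cases "\<bar>2 * y - x\<bar> \<le> 1 / ?H")
    case True
    have "f (?G y) * padded_slope \<alpha> x y \<le> f (?G y) * phase_slope \<alpha> x y + ?H"
      using True f_range[of "?G y"] height by (simp add: padded_slope_def distrib_left mult_left_le_one_le)
    moreover have "y \<in> ?window"
      using True by auto
    ultimately show ?thesis
      using \<alpha> f_range(1) height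
      by (simp add: ennreal_plus[symmetric] phase_slope_nonneg ennreal_leI del: ennreal_plus)
  next
    case False
    then show ?thesis by (simp add: padded_slope_def)
  qed
  then have "(\<integral>\<^sup>+y. ennreal (f (?G y) * padded_slope \<alpha> x y) \<partial>lborel)
    \<le> (\<integral>\<^sup>+y. ennreal (f (?G y) * phase_slope \<alpha> x y) + ennreal ?H * indicator ?window y \<partial>lborel)"
    by (rule nn_integral_mono)
  also have "\<dots> = (\<integral>\<^sup>+y. ennreal (f (?G y) * phase_slope \<alpha> x y) \<partial>lborel) +
      (\<integral>\<^sup>+y. ennreal ?H * indicator ?window y \<partial>lborel)"
    by (rule nn_integral_add) measurable
  also have "(\<integral>\<^sup>+y. ennreal ?H * indicator ?window y \<partial>lborel) = 1"
    using height by (simp add: nn_integral_cmult_indicator ennreal_mult[symmetric])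
  also have "(\<integral>\<^sup>+y. ennreal (f (?G y) * phase_slope \<alpha> x y) \<partial>lborel) \<le> 2 * (\<integral>\<^sup>+v. ennreal (f v) \<partial>lborel)"
    using \<alpha> f_range(1) by (intro nn_integral_phase_slope_le) auto
  finally show ?thesis by (simp add: add_right_mono)
qed

section \<open>Lower bounds for the padded slope\<close>

lemma powr_diff_ge:
  fixes a c :: real
  assumes "1 \<le> \<alpha>" "0 \<le> c" "c \<le> a"
  shows "a powr (\<alpha> - 1) * (a - c) \<le> a powr \<alpha> - c powr \<alpha>"
proof -
  have split: "u powr \<alpha> = u powr (\<alpha> - 1) * u" if "0 \<le> u" for u :: real
    using that powr_add[of u "\<alpha> - 1" 1] by simp
  have "c powr (\<alpha> - 1) * c \<le> a powr (\<alpha> - 1) * c"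
    using assms by (intro mult_right_mono powr_mono2) auto
  then show ?thesis
    using assms split by (simp add: algebra_simps)
qed

lemma phase_slope_ge:
  assumes "1 \<le> \<alpha>"
  shows "max \<bar>y\<bar> \<bar>x - y\<bar> powr (\<alpha> - 1) * \<bar>\<bar>y\<bar> - \<bar>x - y\<bar>\<bar> \<le> phase_slope \<alpha> x y"
proof -
  have "max \<bar>y\<bar> \<bar>x - y\<bar> powr (\<alpha> - 1) * \<bar>\<bar>y\<bar> - \<bar>x - y\<bar>\<bar> \<le> \<bar>\<bar>y\<bar> powr \<alpha> - \<bar>x - y\<bar> powr \<alpha>\<bar>"
    using powr_diff_ge[OF assms, of "\<bar>x - y\<bar>" "\<bar>y\<bar>"] powr_diff_ge[OF assms, of "\<bar>y\<bar>" "\<bar>x - y\<bar>"]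
    by (cases "\<bar>y\<bar> \<le> \<bar>x - y\<bar>") (auto simp: max_def abs_if)
  also have "\<dots> \<le> phase_slope \<alpha> x y"
    using mult_right_mono[of 1 "1 + \<alpha>" "\<bar>\<bar>y\<bar> powr \<alpha> - \<bar>x - y\<bar> powr \<alpha>\<bar>"] assms by (simp add: phase_slope_def)
  finally show ?thesis .
qed

lemma padded_slope_ge_of_smallest:
  assumes "1 \<le> \<alpha>" "\<bar>x\<bar> \<le> \<bar>y\<bar>" "\<bar>x\<bar> \<le> \<bar>x - y\<bar>"
  shows "max \<bar>y\<bar> \<bar>x - y\<bar> powr (\<alpha> - 1) * \<bar>x\<bar> \<le> padded_slope \<alpha> x y"
proof -
  have "\<bar>\<bar>y\<bar> - \<bar>x - y\<bar>\<bar> = \<bar>x\<bar>"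
    using assms by linarith
  then show ?thesis
    using phase_slope_ge[OF assms(1), of y x] phase_slope_le_padded_slope[of \<alpha> x y] by simp
qed

context
  fixes \<alpha> x y N :: real
  assumes \<alpha>: "1 < \<alpha>" "\<alpha> < 2" and smallest: "\<bar>y\<bar> \<le> \<bar>x\<bar>" "\<bar>y\<bar> \<le> \<bar>x - y\<bar>" "y \<noteq> 0"
    and N: "N = max \<bar>x\<bar> \<bar>x - y\<bar>"
begin

lemma phase_slope_ge_gap:
  assumes "0 \<le> gap" "gap \<le> \<bar>x - y\<bar> - \<bar>y\<bar>"
  shows "N powr (\<alpha> - 1) / 2 * gap \<le> phase_slope \<alpha> x y"
proof -
  have "0 \<le> N" "N / 2 \<le> \<bar>x - y\<bar>"
    using smallest N by linarith+
  have "(1/2) * N powr (\<alpha> - 1) \<le> (1/2) powr (\<alpha> - 1) * N powr (\<alpha> - 1)"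
    using \<alpha> powr_mono'[of "\<alpha> - 1" 1 "1/2 :: real"] by (intro mult_right_mono) auto
  also have "\<dots> = (N / 2) powr (\<alpha> - 1)"
    by (simp add: powr_mult[symmetric])
  also have "\<dots> \<le> \<bar>x - y\<bar> powr (\<alpha> - 1)"
    using \<alpha> \<open>0 \<le> N\<close> \<open>N / 2 \<le> \<bar>x - y\<bar>\<close> by (intro powr_mono2) auto
  finally have "N powr (\<alpha> - 1) / 2 * gap \<le> \<bar>x - y\<bar> powr (\<alpha> - 1) * (\<bar>x - y\<bar> - \<bar>y\<bar>)"
    using assms by (intro mult_mono) auto
  also have "\<dots> \<le> phase_slope \<alpha> x y"
    using phase_slope_ge[of \<alpha> y x] \<alpha> smallest by (simp add: max_def)
  finally show ?thesis .
qed

lemma powr_le_padded_slope_of_separated: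
  assumes "N / 2 \<le> \<bar>x - y\<bar> - \<bar>y\<bar>"
  shows "N powr \<alpha> \<le> 4 * padded_slope \<alpha> x y"
proof -
  have "0 < N"
    using smallest N by linarith
  then have "N powr \<alpha> = 4 * (N powr (\<alpha> - 1) / 2 * (N / 2))"
    using powr_add[of N "\<alpha> - 1" 1] by simp
  also have "\<dots> \<le> 4 * phase_slope \<alpha> x y"
    using phase_slope_ge_gap[OF _ assms] \<open>0 < N\<close> by simp
  finally show ?thesis
    using phase_slope_le_padded_slope[of \<alpha> x y] by linarith
qed

lemma window_height_le_padded_slope:
  assumes "N = \<bar>x\<bar>" "\<bar>x - y\<bar> - \<bar>y\<bar> = \<bar>2 * y - x\<bar>"
  shows "window_height \<alpha> x \<le> 2 * padded_slope \<alpha> x y"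
proof (cases "\<bar>2 * y - x\<bar> \<le> 1 / window_height \<alpha> x")
  case True
  then show ?thesis
    using phase_slope_nonneg[of \<alpha> x y] window_height_ge_1[of \<alpha> x] \<alpha> by (simp add: padded_slope_def)
next
  case False
  note height = window_height_ge_1[of \<alpha> x]
  have "1 < N"
  proof (rule ccontr)
    assume "\<not> 1 < N"
    then show False
      using False assms smallest by (auto simp: window_height_def)
  qed
  then have square: "N powr (\<alpha> - 1) = window_height \<alpha> x * window_height \<alpha> x"
    using assms(1) by (simp add: window_height_def powr_add[symmetric])
  have "N powr (\<alpha> - 1) / 2 * (1 / window_height \<alpha> x) \<le> phase_slope \<alpha> x y"
    using False assms height \<alpha> by (intro phase_slope_ge_gap) auto
  then have "window_height \<alpha> x \<le> 2 * phase_slope \<alpha> x y"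
    using height \<alpha> by (simp add: square)
  then show ?thesis
    using phase_slope_le_padded_slope[of \<alpha> x y] by linarith
qed

lemma le_padded_slope_of_input_smallest:
  assumes "0 \<le> A" "h \<le> A * N powr \<alpha>"
    and comparable: "N \<le> 4 * \<bar>y\<bar> \<Longrightarrow> h \<le> A * max 1 N powr ((\<alpha> - 1) / 2)"
  shows "h \<le> 4 * A * padded_slope \<alpha> x y"
proof (cases "N / 2 \<le> \<bar>x - y\<bar> - \<bar>y\<bar>")
  case True
  then show ?thesis
    using mult_left_mono[OF powr_le_padded_slope_of_separated \<open>0 \<le> A\<close>] assms(2) by (simp add: mult.left_commute)
next
  case False
  then have N_eq: "N = \<bar>x\<bar>"
    using smallest N by linarith
  have gap: "\<bar>x - y\<bar> - \<bar>y\<bar> = \<bar>2 * y - x\<bar>" and "N \<le> 4 * \<bar>y\<bar>"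
    using False smallest unfolding N_eq by linarith+
  have "h \<le> A * window_height \<alpha> x"
    using comparable[OF \<open>N \<le> 4 * \<bar>y\<bar>\<close>] by (simp add: N_eq window_height_def)
  also have "\<dots> \<le> A * (2 * padded_slope \<alpha> x y)"
    using window_height_le_padded_slope[OF N_eq gap] \<open>0 \<le> A\<close> by (rule mult_left_mono)
  also have "\<dots> \<le> A * (4 * padded_slope \<alpha> x y)"
    using padded_slope_nonneg[of \<alpha> x y] \<alpha> \<open>0 \<le> A\<close> by (intro mult_left_mono) auto
  finally show ?thesis by simp
qed

end

section \<open>Anisotropic brackets\<close>

definition aniso_jb :: "real \<Rightarrow> real \<Rightarrow> real \<Rightarrow> real" where
  "aniso_jb \<alpha> \<tau> \<xi> = jb (\<bar>\<tau>\<bar> + \<bar>\<xi>\<bar> powr (1 + \<alpha>))"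

lemma aniso_jb_pos [simp]: "0 < aniso_jb \<alpha> \<tau> \<xi>"
  by (simp add: aniso_jb_def)

lemma aniso_jb_ge_modulation: "jb (\<tau> - phase \<alpha> \<xi>) \<le> aniso_jb \<alpha> \<tau> \<xi>"
  unfolding aniso_jb_def jb_le_iff using abs_phase[of \<alpha> \<xi>] abs_triangle_ineq4[of \<tau> "phase \<alpha> \<xi>"] by simp

lemma aniso_jb_ge_jb_powr: "jb (\<bar>\<xi>\<bar> powr (1 + \<alpha>)) \<le> aniso_jb \<alpha> \<tau> \<xi>"
  by (simp add: aniso_jb_def jb_le_iff)

lemma jb_powr_le_aniso_jb:
  assumes "0 \<le> \<alpha>" "\<alpha> \<le> 2"
  shows "jb \<xi> powr (1 + \<alpha>) \<le> 8 * aniso_jb \<alpha> \<tau> \<xi>"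
proof -
  have "jb \<xi> powr (1 + \<alpha>) \<le> 8 * max 1 \<bar>\<xi>\<bar> powr (1 + \<alpha>)"
    using assms by (intro jb_powr_le_max) auto
  also have "max 1 \<bar>\<xi>\<bar> powr (1 + \<alpha>) \<le> jb (\<bar>\<xi>\<bar> powr (1 + \<alpha>))"
    using jb_ge_abs[of "\<bar>\<xi>\<bar> powr (1 + \<alpha>)"] by (simp add: max_def)
  also have "\<dots> \<le> aniso_jb \<alpha> \<tau> \<xi>"
    by (rule aniso_jb_ge_jb_powr)
  finally show ?thesis by simp
qed

lemma aniso_jb_add_le:
  assumes "0 \<le> \<alpha>" "\<alpha> \<le> 2"
  shows "aniso_jb \<alpha> (\<tau>\<^sub>1 + \<tau>\<^sub>2) (\<xi>\<^sub>1 + \<xi>\<^sub>2) \<le> 8 * (aniso_jb \<alpha> \<tau>\<^sub>1 \<xi>\<^sub>1 + aniso_jb \<alpha> \<tau>\<^sub>2 \<xi>\<^sub>2)"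
proof -
  have "\<bar>\<xi>\<^sub>1 + \<xi>\<^sub>2\<bar> powr (1 + \<alpha>) \<le> (2 * max \<bar>\<xi>\<^sub>1\<bar> \<bar>\<xi>\<^sub>2\<bar>) powr (1 + \<alpha>)"
    using assms by (intro powr_mono2) auto
  also have "\<dots> \<le> 8 * max \<bar>\<xi>\<^sub>1\<bar> \<bar>\<xi>\<^sub>2\<bar> powr (1 + \<alpha>)"
    unfolding powr_mult using assms by (intro mult_right_mono two_powr_le_8) auto
  also have "\<dots> \<le> 8 * (\<bar>\<xi>\<^sub>1\<bar> powr (1 + \<alpha>) + \<bar>\<xi>\<^sub>2\<bar> powr (1 + \<alpha>))"
    by (auto simp: max_def)
  finally have "aniso_jb \<alpha> (\<tau>\<^sub>1 + \<tau>\<^sub>2) (\<xi>\<^sub>1 + \<xi>\<^sub>2)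
    \<le> 8 * jb ((\<bar>\<tau>\<^sub>1\<bar> + \<bar>\<xi>\<^sub>1\<bar> powr (1 + \<alpha>)) + (\<bar>\<tau>\<^sub>2\<bar> + \<bar>\<xi>\<^sub>2\<bar> powr (1 + \<alpha>)))"
    unfolding aniso_jb_def by (intro jb_le_mult) auto
  also have "\<dots> \<le> 8 * (aniso_jb \<alpha> \<tau>\<^sub>1 \<xi>\<^sub>1 + aniso_jb \<alpha> \<tau>\<^sub>2 \<xi>\<^sub>2)"
    unfolding aniso_jb_def by (intro mult_left_mono jb_add_le) auto
  finally show ?thesis .
qed

lemma aniso_jb_le: "aniso_jb \<alpha> \<tau> \<xi> \<le> jb (\<tau> - phase \<alpha> \<xi>) + 2 * jb (\<bar>\<xi>\<bar> powr (1 + \<alpha>))"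
proof -
  have "\<bar>\<tau>\<bar> + \<bar>\<xi>\<bar> powr (1 + \<alpha>) \<le> \<bar>\<tau> - phase \<alpha> \<xi>\<bar> + 2 * \<bar>\<xi>\<bar> powr (1 + \<alpha>)"
    using abs_phase[of \<alpha> \<xi>] abs_triangle_ineq[of "\<tau> - phase \<alpha> \<xi>" "phase \<alpha> \<xi>"] by simp
  then have "aniso_jb \<alpha> \<tau> \<xi> \<le> jb (\<bar>\<tau> - phase \<alpha> \<xi>\<bar> + 2 * \<bar>\<xi>\<bar> powr (1 + \<alpha>))"
    by (simp add: aniso_jb_def jb_le_iff)
  also have "\<dots> \<le> jb (\<tau> - phase \<alpha> \<xi>) + jb (2 * \<bar>\<xi>\<bar> powr (1 + \<alpha>))"
    using jb_add_le[of "\<bar>\<tau> - phase \<alpha> \<xi>\<bar>"] by simp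
  also have "jb (2 * \<bar>\<xi>\<bar> powr (1 + \<alpha>)) \<le> 2 * jb (\<bar>\<xi>\<bar> powr (1 + \<alpha>))"
    by (intro jb_le_mult) auto
  finally show ?thesis by simp
qed

section \<open>Frequency factors\<close>

text \<open>\<open>- \<rho>\<close> is the lowest regularity; \<open>\<epsilon>\<close> is the room left by \<open>s\<^sub>0 > - (3 / 4) * (\<alpha> - 1)\<close> for the losses in
  \<open>b\<close> and \<open>b'\<close>.\<close>

locale dispersion_params =
  fixes \<alpha> \<omega> \<rho> \<epsilon> b b' :: real
  assumes alpha: "1 < \<alpha>" "\<alpha> < 2"
    and omega: "\<omega> = 1 / \<alpha> - 1 / 2"
    and rho: "0 \<le> \<rho>"
    and eps: "0 < \<epsilon>" "4 * \<rho> + 12 * \<epsilon> \<le> 3 * (\<alpha> - 1)"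
    and b_def: "b = 1 / 2 + \<epsilon> / 2" and b'_def: "b' = - 1 / 2 + \<epsilon>"
begin

abbreviation \<kappa> :: real where "\<kappa> \<equiv> 2 * \<rho> + 2 * (\<alpha> * \<omega>)"
abbreviation \<beta> :: real where "\<beta> \<equiv> 1 - 2 * \<epsilon>"
abbreviation \<Lambda> :: "real \<Rightarrow> real \<Rightarrow> real" where "\<Lambda> N L \<equiv> jb (L * N powr \<alpha>)"

lemma omega_pos: "0 < \<omega>"
  using alpha by (simp add: omega)

lemma alpha_omega: "2 * (\<alpha> * \<omega>) = 2 - \<alpha>"
  using alpha by (simp add: omega field_simps)

lemma omega_le_alpha_omega: "\<omega> \<le> \<alpha> * \<omega>"
  using omega_pos alpha by simp

lemma exponent_bounds:
  "0 \<le> \<beta>" "\<beta> \<le> 1" "0 \<le> 2 * b" "- (2 * b) \<le> - \<beta>"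
  "0 \<le> 2 * \<omega>" "2 * \<omega> \<le> 1" "2 * \<omega> \<le> \<beta>" "- (2 * b) \<le> 2 * \<omega> - \<beta>"
  "0 \<le> \<kappa>" "\<kappa> \<le> 3" "4 * \<rho> \<le> 3"
  using omega_pos alpha_omega omega_le_alpha_omega alpha rho eps b_def by argo+

lemma alpha_eps_le: "\<alpha> * \<epsilon> \<le> 2 * \<epsilon>"
  using alpha eps by auto

lemma resonance_powr_neg_le:
  assumes "0 < L" "0 < N" "0 \<le> q"
  shows "\<Lambda> N L powr - q \<le> L powr - q * N powr - (\<alpha> * q)"
proof -
  have "\<Lambda> N L powr - q \<le> (L * N powr \<alpha>) powr - q"
    using assms jb_ge_abs[of "L * N powr \<alpha>"] by (intro powr_mono2') auto
  also have "\<dots> = L powr - q * N powr - (\<alpha> * q)"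
    by (simp add: powr_mult powr_powr)
  finally show ?thesis .
qed

lemma resonance_powr_neg_le_comparable:
  assumes "0 < L" "0 < N" "N \<le> 4 * L" "0 \<le> q" "q \<le> 1"
  shows "\<Lambda> N L powr - q \<le> 4 * N powr - ((1 + \<alpha>) * q)"
proof -
  have "\<Lambda> N L powr - q \<le> L powr - q * N powr - (\<alpha> * q)"
    using assms by (intro resonance_powr_neg_le) auto
  also have "L powr - q \<le> (N / 4) powr - q"
    using assms by (intro powr_mono2') auto
  also have "(N / 4) powr - q = 4 powr q * N powr - q"
    by (simp add: powr_divide powr_minus field_simps)
  also have "4 powr q \<le> (4 :: real)"
    using powr_mono[of q 1 "4 :: real"] assms by simp
  finally have "\<Lambda> N L powr - q \<le> 4 * (N powr - q * N powr - (\<alpha> * q))"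
    by (simp add: mult_right_mono)
  also have "N powr - q * N powr - (\<alpha> * q) = N powr - ((1 + \<alpha>) * q)"
    by (simp add: powr_add[symmetric] algebra_simps)
  finally show ?thesis .
qed

text \<open>The frequency part of the squared kernel when the smallest frequency \<open>L\<close> is an input, an input carrying
  the largest modulation, or the output.\<close>

definition factor_low_input :: "real \<Rightarrow> real \<Rightarrow> real" where
  "factor_low_input N L = N\<^sup>2 * L powr (2 * \<omega>) * jb L powr (2 * \<rho> - 2 * \<omega>) * \<Lambda> N L powr - \<beta>"

definition factor_low_modulated_input :: "real \<Rightarrow> real \<Rightarrow> real" where
  "factor_low_modulated_input N L = N\<^sup>2 * L powr (2 * \<omega>) * jb L powr \<kappa> * \<Lambda> N L powr - (\<beta> + 2 * \<omega>)"

definition factor_low_output :: "real \<Rightarrow> real \<Rightarrow> real" where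
  "factor_low_output N L = L powr (2 - 2 * \<omega>) * jb L powr - \<kappa> * jb N powr (4 * \<rho>) * \<Lambda> N L powr (2 * \<omega> - \<beta>)"

text \<open>The scale invariance for \<open>L\<close> of size \<open>N powr - \<alpha>\<close> fixes the value of \<open>\<omega>\<close>.\<close>

lemma scale_invariant_le:
  assumes "0 < L" "L \<le> 1" "0 < N" "0 \<le> q" "q \<le> 3"
  shows "N\<^sup>2 * L powr (2 * \<omega>) * jb L powr q * \<Lambda> N L powr - (2 * \<omega>) \<le> 8 * N powr \<alpha>"
proof -
  have "N\<^sup>2 * L powr (2 * \<omega>) * jb L powr q * \<Lambda> N L powr - (2 * \<omega>)
    \<le> N\<^sup>2 * L powr (2 * \<omega>) * 8 * (L powr - (2 * \<omega>) * N powr - (\<alpha> * (2 * \<omega>)))"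
    using assms jb_powr_le_max[of q L] exponent_bounds
    by (intro mult_mono resonance_powr_neg_le order_refl) (auto simp: max_absorb1)
  also have "\<dots> = 8 * N powr (2 + - (\<alpha> * (2 * \<omega>)))"
    using assms unfolding powr_add by (simp add: powr_minus)
  also have "2 + - (\<alpha> * (2 * \<omega>)) = \<alpha>"
    using alpha_omega by (simp add: mult.left_commute)
  finally show ?thesis .
qed

lemma jb_powr_le_of_le:
  assumes "0 < L" "L \<le> N" "1 \<le> N"
  shows "jb L powr (2 * \<rho>) \<le> 8 * N powr (2 * \<rho>)"
proof -
  have "jb L powr (2 * \<rho>) \<le> 8 * max 1 \<bar>L\<bar> powr (2 * \<rho>)"
    using rho exponent_bounds by (intro jb_powr_le_max) auto
  also have "\<dots> \<le> 8 * N powr (2 * \<rho>)"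
    using assms rho by (intro mult_left_mono powr_mono2) auto
  finally show ?thesis .
qed

lemma factor_low_input_le_jb:
  assumes "0 < L"
  shows "factor_low_input N L \<le> N\<^sup>2 * jb L powr (2 * \<rho>) * \<Lambda> N L powr - \<beta>"
proof -
  have "L powr (2 * \<omega>) * jb L powr (2 * \<rho> - 2 * \<omega>) \<le> jb L powr (2 * \<omega>) * jb L powr (2 * \<rho> - 2 * \<omega>)"
    using assms jb_ge_abs[of L] exponent_bounds by (intro mult_right_mono powr_mono2) auto
  also have "\<dots> = jb L powr (2 * \<rho>)"
    by (simp add: powr_add[symmetric])
  finally show ?thesis
    unfolding factor_low_input_def by (simp add: mult.assoc mult_left_mono mult_right_mono)
qed

lemma factor_low_input_le:
  assumes "0 < L" "L \<le> N"
  shows "factor_low_input N L \<le> 8 * N powr \<alpha>"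
proof (cases "L \<le> 1")
  case True
  have "factor_low_input N L \<le> N\<^sup>2 * L powr (2 * \<omega>) * jb L powr (2 * \<rho>) * \<Lambda> N L powr - (2 * \<omega>)"
    unfolding factor_low_input_def using exponent_bounds by (intro mult_mono powr_mono order_refl) auto
  also have "\<dots> \<le> 8 * N powr \<alpha>"
    using True assms rho exponent_bounds by (intro scale_invariant_le) auto
  finally show ?thesis .
next
  case False
  have "L powr - \<beta> \<le> 1"
    using False exponent_bounds powr_mono[of "- \<beta>" 0 L] by simp
  then have resonance: "\<Lambda> N L powr - \<beta> \<le> 1 * N powr - (\<alpha> * \<beta>)"
    using assms exponent_bounds resonance_powr_neg_le[of L N \<beta>] by (auto elim!: order_trans intro!: mult_right_mono)
  have "jb L powr (2 * \<rho>) \<le> 8 * N powr (2 * \<rho>)"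
    using False assms by (intro jb_powr_le_of_le) auto
  then have "factor_low_input N L \<le> N\<^sup>2 * (8 * N powr (2 * \<rho>)) * (1 * N powr - (\<alpha> * \<beta>))"
    using resonance by (intro order_trans[OF factor_low_input_le_jb[OF assms(1)]] mult_mono order_refl) auto
  also have "\<dots> = 8 * N powr (2 + 2 * \<rho> + - (\<alpha> * \<beta>))"
    using assms unfolding powr_add by simp
  also have "\<dots> \<le> 8 * N powr \<alpha>"
  proof (intro mult_left_mono powr_mono)
    have "2 + 2 * \<rho> + - (\<alpha> * \<beta>) = 2 + 2 * \<rho> - \<alpha> + 2 * (\<alpha> * \<epsilon>)"
      by (simp add: algebra_simps)
    then show "2 + 2 * \<rho> + - (\<alpha> * \<beta>) \<le> \<alpha>"
      using eps rho alpha_eps_le alpha by argo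
  qed (use False assms in auto)
  finally show ?thesis .
qed

lemma critical_powr_le:
  assumes "1 \<le> N"
  shows "N powr (2 + 2 * \<rho> - (1 + \<alpha>) * \<beta>) \<le> N powr ((\<alpha> - 1) / 2)"
proof (intro powr_mono)
  have "2 + 2 * \<rho> - (1 + \<alpha>) * \<beta> = 1 + 2 * \<rho> - \<alpha> + 2 * \<epsilon> + 2 * (\<alpha> * \<epsilon>)"
    by (simp add: algebra_simps)
  then show "2 + 2 * \<rho> - (1 + \<alpha>) * \<beta> \<le> (\<alpha> - 1) / 2"
    using eps alpha_eps_le by argo
qed (use assms in auto)

lemma factor_low_input_le_comparable:
  assumes "0 < L" "L \<le> N" "N \<le> 4 * L"
  shows "factor_low_input N L \<le> 32 * max 1 N powr ((\<alpha> - 1) / 2)"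
proof (cases "N \<le> 1")
  case True
  have "N powr \<alpha> \<le> 1"
    using True assms alpha powr_mono2[of \<alpha> N 1] by simp
  then show ?thesis
    using factor_low_input_le[OF assms(1,2)] True by simp
next
  case False
  have "jb L powr (2 * \<rho>) \<le> 8 * N powr (2 * \<rho>)"
    using False assms by (intro jb_powr_le_of_le) auto
  then have "factor_low_input N L \<le> N\<^sup>2 * (8 * N powr (2 * \<rho>)) * (4 * N powr - ((1 + \<alpha>) * \<beta>))"
    using assms exponent_bounds
    by (intro order_trans[OF factor_low_input_le_jb[OF assms(1)]] mult_mono
        resonance_powr_neg_le_comparable order_refl) auto
  also have "\<dots> = 32 * N powr (2 + 2 * \<rho> + - ((1 + \<alpha>) * \<beta>))"
    using assms unfolding powr_add by simp
  also have "\<dots> \<le> 32 * N powr ((\<alpha> - 1) / 2)"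
    using critical_powr_le[of N] False by simp
  finally show ?thesis using False by simp
qed

lemma factor_low_modulated_input_le:
  assumes "1 \<le> L" "L \<le> N"
  shows "factor_low_modulated_input N L \<le> 8 * (N powr (\<alpha> - 1) * L)"
proof -
  have "factor_low_modulated_input N L \<le>
    N\<^sup>2 * L powr (2 * \<omega>) * (8 * L powr \<kappa>) * (L powr - (\<beta> + 2 * \<omega>) * N powr - (\<alpha> * (\<beta> + 2 * \<omega>)))"
    unfolding factor_low_modulated_input_def
    using assms exponent_bounds jb_powr_le_max[of \<kappa> L]
    by (intro mult_mono resonance_powr_neg_le order_refl) (auto simp: max_absorb2)
  also have "\<dots> = 8 * (N powr (2 + - (\<alpha> * (\<beta> + 2 * \<omega>))) * L powr (2 * \<omega> + \<kappa> + - (\<beta> + 2 * \<omega>)))"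
    using assms unfolding powr_add by simp
  also have "\<dots> \<le> 8 * (N powr (\<alpha> - 1) * L powr 1)"
  proof (intro mult_left_mono mult_mono powr_mono)
    have "2 + - (\<alpha> * (\<beta> + 2 * \<omega>)) = 2 - \<alpha> + 2 * (\<alpha> * \<epsilon>) - 2 * (\<alpha> * \<omega>)"
      by (simp add: algebra_simps)
    then show "2 + - (\<alpha> * (\<beta> + 2 * \<omega>)) \<le> \<alpha> - 1"
      using eps alpha_eps_le alpha_omega rho by argo
    show "2 * \<omega> + \<kappa> + - (\<beta> + 2 * \<omega>) \<le> 1"
      using alpha_omega alpha eps rho by argo
  qed (use assms in auto)
  finally show ?thesis using assms by simp
qed

lemma factor_low_output_le_of_small:
  assumes "0 < L" "L \<le> N" "N \<le> 1"
  shows "factor_low_output N L \<le> 8 * (N powr (\<alpha> - 1) * L)"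
proof -
  have "factor_low_output N L \<le> L powr (1 - 2 * \<omega> + 1) * 1 * 8 * 1"
    unfolding factor_low_output_def using assms rho exponent_bounds jb_powr_le_max[of "4 * \<rho>" N]
    by (intro mult_mono jb_powr_nonpos_le_1) (auto simp: max_absorb1)
  also have "\<dots> = 8 * (L powr (1 - 2 * \<omega>) * L)"
    using assms unfolding powr_add by simp
  also have "\<dots> \<le> 8 * (N powr (\<alpha> - 1) * L)"
  proof (intro mult_left_mono mult_right_mono)
    have "L powr (1 - 2 * \<omega>) \<le> N powr (1 - 2 * \<omega>)"
      using assms exponent_bounds by (intro powr_mono2) auto
    also have "\<dots> \<le> N powr (\<alpha> - 1)"
      using assms alpha_omega omega_le_alpha_omega by (intro powr_mono') linarith+
    finally show "L powr (1 - 2 * \<omega>) \<le> N powr (\<alpha> - 1)" .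
  qed (use assms in auto)
  finally show ?thesis .
qed

lemma factor_low_output_le_of_large:
  assumes "0 < L" "L \<le> N" "1 \<le> N"
  shows "factor_low_output N L \<le> 8 * (N powr (\<alpha> - 1) * L)"
proof -
  have "\<Lambda> N L powr (2 * \<omega> - \<beta>) \<le> L powr (2 * \<omega> - \<beta>) * N powr (\<alpha> * (2 * \<omega> - \<beta>))"
    using resonance_powr_neg_le[of L N "\<beta> - 2 * \<omega>"] assms exponent_bounds by (simp add: algebra_simps)
  then have "factor_low_output N L
    \<le> L powr (2 - 2 * \<omega>) * 1 * (8 * N powr (4 * \<rho>)) * (L powr (2 * \<omega> - \<beta>) * N powr (\<alpha> * (2 * \<omega> - \<beta>)))"
    unfolding factor_low_output_def using assms rho exponent_bounds jb_powr_le_max[of "4 * \<rho>" N]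
    by (intro mult_mono jb_powr_nonpos_le_1) (auto simp: max_absorb2)
  also have "\<dots> = 8 * ((L powr (2 - 2 * \<omega>) * L powr (2 * \<omega> - \<beta>)) * N powr (4 * \<rho> + \<alpha> * (2 * \<omega> - \<beta>)))"
    unfolding powr_add by simp
  also have "L powr (2 - 2 * \<omega>) * L powr (2 * \<omega> - \<beta>) = L powr (2 * \<epsilon>) * L"
    using assms powr_add[of L "2 * \<epsilon>" 1] by (simp add: powr_add[symmetric] add.commute)
  also have "L powr (2 * \<epsilon>) * L \<le> N powr (2 * \<epsilon>) * L"
    using assms eps by (intro mult_right_mono powr_mono2) auto
  finally have "factor_low_output N L \<le> 8 * (N powr (2 * \<epsilon> + (4 * \<rho> + \<alpha> * (2 * \<omega> - \<beta>))) * L)"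
    using assms unfolding powr_add by (simp add: ac_simps)
  also have "\<dots> \<le> 8 * (N powr (\<alpha> - 1) * L)"
  proof (intro mult_left_mono mult_right_mono powr_mono)
    have "2 * \<epsilon> + (4 * \<rho> + \<alpha> * (2 * \<omega> - \<beta>)) = 2 * \<epsilon> + 4 * \<rho> + 2 * (\<alpha> * \<omega>) - \<alpha> + 2 * (\<alpha> * \<epsilon>)"
      by (simp add: algebra_simps)
    then show "2 * \<epsilon> + (4 * \<rho> + \<alpha> * (2 * \<omega> - \<beta>)) \<le> \<alpha> - 1"
      using eps alpha_eps_le alpha_omega rho by argo
  qed (use assms in auto)
  finally show ?thesis .
qed

lemma factor_low_output_le:
  assumes "0 < L" "L \<le> N"
  shows "factor_low_output N L \<le> 8 * (N powr (\<alpha> - 1) * L)"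
  using factor_low_output_le_of_small[OF assms] factor_low_output_le_of_large[OF assms] by linarith

lemma factor_low_output_le_comparable:
  assumes "0 < L" "L \<le> N" "N \<le> 4 * L"
  shows "factor_low_output N L \<le> 2048 * max 1 N powr ((\<alpha> - 1) / 2)"
proof (cases "N \<le> 1")
  case True
  have "N powr (\<alpha> - 1) * L \<le> 1 * 1"
    using True assms alpha powr_mono2[of "\<alpha> - 1" N 1] by (intro mult_mono) auto
  then show ?thesis
    using factor_low_output_le[OF assms(1,2)] True by simp
next
  case False
  have resonance: "\<Lambda> N L powr (2 * \<omega> - \<beta>) \<le> 4 * N powr ((1 + \<alpha>) * (2 * \<omega> - \<beta>))"
    using resonance_powr_neg_le_comparable[of L N "\<beta> - 2 * \<omega>"] assms exponent_bounds by (simp add: algebra_simps)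
  have "jb L powr - \<kappa> \<le> (N / 4) powr - \<kappa>"
    using assms False exponent_bounds jb_ge_abs[of L] by (intro powr_mono2') auto
  also have "\<dots> = 4 powr \<kappa> * N powr - \<kappa>"
    unfolding powr_divide powr_minus[of _ \<kappa>] by (simp add: field_simps)
  also have "\<dots> \<le> 64 * N powr - \<kappa>"
    using powr_mono[of \<kappa> 3 "4 :: real"] exponent_bounds by (intro mult_right_mono) auto
  finally have "factor_low_output N L \<le>
    N powr (2 - 2 * \<omega>) * (64 * N powr - \<kappa>) * (8 * N powr (4 * \<rho>)) * (4 * N powr ((1 + \<alpha>) * (2 * \<omega> - \<beta>)))"
    unfolding factor_low_output_def using False assms rho exponent_bounds resonance jb_powr_le_max[of "4 * \<rho>" N]
    by (intro mult_mono powr_mono2) (auto simp: max_absorb2)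
  also have "\<dots> = 2048 * N powr (2 - 2 * \<omega> + - \<kappa> + 4 * \<rho> + (1 + \<alpha>) * (2 * \<omega> - \<beta>))"
    unfolding powr_add by simp
  also have "2 - 2 * \<omega> + - \<kappa> + 4 * \<rho> + (1 + \<alpha>) * (2 * \<omega> - \<beta>) = 2 + 2 * \<rho> - (1 + \<alpha>) * \<beta>"
    by (simp add: algebra_simps)
  also have "2048 * N powr (2 + 2 * \<rho> - (1 + \<alpha>) * \<beta>) \<le> 2048 * N powr ((\<alpha> - 1) / 2)"
    using critical_powr_le[of N] False by simp
  finally show ?thesis using False by simp
qed

end

section \<open>The interaction kernel\<close>

text \<open>Moves the weaker decay exponent onto the dominant modulation.\<close>

lemma powr_exchange_le:
  fixes s S :: real
  assumes "0 < s" "s \<le> S" "q \<le> p"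
  shows "s powr p * S powr q \<le> s powr q * S powr p"
proof -
  have "s powr (p - q) \<le> S powr (p - q)"
    using assms by (intro powr_mono2) auto
  then have "s powr q * S powr q * s powr (p - q) \<le> s powr q * S powr q * S powr (p - q)"
    by (intro mult_left_mono) auto
  then show ?thesis using assms by (simp add: powr_diff field_simps)
qed

lemma powr_neg_le_of_le_mult:
  fixes S T k :: real
  assumes "0 < T" "0 < k" "T \<le> k * S" "0 \<le> q"
  shows "S powr - q \<le> k powr q * T powr - q"
proof -
  have "S powr - q \<le> (T / k) powr - q"
    using assms by (intro powr_mono2') (auto simp: field_simps)
  also have "\<dots> = k powr q * T powr - q"
    unfolding powr_divide powr_minus[of _ q] by (simp add: field_simps)
  finally show ?thesis .
qed

lemma powr_le_self: "1 \<le> k \<Longrightarrow> q \<le> 1 \<Longrightarrow> k powr q \<le> (k :: real)"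
  using powr_mono[of q 1 k] by simp

context dispersion_params
begin

text \<open>Vanishes if an input frequency is \<open>0\<close>, since then a weight in the denominator is \<open>0\<close>.\<close>

definition kernel_sq :: "real \<times> real \<Rightarrow> real \<times> real \<Rightarrow> real" where
  "kernel_sq p q = (snd (p + q))\<^sup>2 * Xweight \<alpha> (- \<rho>) \<omega> b' (p + q) /
    (Xweight \<alpha> (- \<rho>) \<omega> b p * Xweight \<alpha> (- \<rho>) \<omega> b q)"

definition modulation_decay :: "real \<times> real \<Rightarrow> real" where
  "modulation_decay p = jb (fst p - phase \<alpha> (snd p)) powr - (2 * b)"

definition low_frequency_tail :: "real \<Rightarrow> real \<Rightarrow> real" where
  "low_frequency_tail x y = \<bar>x\<bar> powr \<alpha> * jb (\<bar>y\<bar> * \<bar>x\<bar> powr \<alpha>) powr - (2 * b)"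

definition output_part :: "real \<times> real \<Rightarrow> real \<times> real \<Rightarrow> real" where
  "output_part p q = modulation_decay p * modulation_decay q * padded_slope \<alpha> (snd (p + q)) (snd p)"

definition input_part :: "real \<times> real \<Rightarrow> real \<times> real \<Rightarrow> real" where
  "input_part p q = modulation_decay (p + q) * modulation_decay q * padded_slope \<alpha> (snd p) (snd (p + q))"

definition tail_part :: "real \<times> real \<Rightarrow> real \<times> real \<Rightarrow> real" where
  "tail_part p q = modulation_decay p * low_frequency_tail (snd (p + q)) (snd q)"

definition majorant :: "real \<times> real \<Rightarrow> real \<times> real \<Rightarrow> real" where
  "majorant p q = output_part p q + input_part p q + input_part q p + tail_part p q + tail_part q p"

lemma modulation_decay_nonneg [simp]: "0 \<le> modulation_decay p"
  by (simp add: modulation_decay_def)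

lemma low_frequency_tail_nonneg [simp]: "0 \<le> low_frequency_tail x y"
  by (simp add: low_frequency_tail_def)

lemma output_part_nonneg [simp]: "0 \<le> output_part p q"
  and input_part_nonneg [simp]: "0 \<le> input_part p q"
  and tail_part_nonneg [simp]: "0 \<le> tail_part p q"
  using alpha by (simp_all add: output_part_def input_part_def tail_part_def padded_slope_nonneg)

lemma output_part_commute: "output_part p q = output_part q p"
  using padded_slope_swap[of \<alpha> "snd (p + q)" "snd p"] by (simp add: output_part_def ac_simps)

lemma majorant_commute: "majorant p q = majorant q p"
  by (simp add: majorant_def output_part_commute[of p q])

lemma kernel_sq_commute: "kernel_sq p q = kernel_sq q p"
  by (simp add: kernel_sq_def ac_simps)

end

locale interaction = dispersion_params +
  fixes \<tau>\<^sub>1 \<xi>\<^sub>1 \<tau>\<^sub>2 \<xi>\<^sub>2 :: real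
  assumes nonzero: "\<xi>\<^sub>1 \<noteq> 0" "\<xi>\<^sub>2 \<noteq> 0" "\<xi>\<^sub>1 + \<xi>\<^sub>2 \<noteq> 0" and ordered: "\<bar>\<xi>\<^sub>2\<bar> \<le> \<bar>\<xi>\<^sub>1\<bar>"
begin

abbreviation z\<^sub>1 :: "real \<times> real" where "z\<^sub>1 \<equiv> (\<tau>\<^sub>1, \<xi>\<^sub>1)"
abbreviation z\<^sub>2 :: "real \<times> real" where "z\<^sub>2 \<equiv> (\<tau>\<^sub>2, \<xi>\<^sub>2)"
abbreviation \<xi> :: real where "\<xi> \<equiv> \<xi>\<^sub>1 + \<xi>\<^sub>2"
abbreviation \<sigma> :: real where "\<sigma> \<equiv> jb (\<tau>\<^sub>1 + \<tau>\<^sub>2 - phase \<alpha> \<xi>)"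
abbreviation \<sigma>\<^sub>1 :: real where "\<sigma>\<^sub>1 \<equiv> jb (\<tau>\<^sub>1 - phase \<alpha> \<xi>\<^sub>1)"
abbreviation \<sigma>\<^sub>2 :: real where "\<sigma>\<^sub>2 \<equiv> jb (\<tau>\<^sub>2 - phase \<alpha> \<xi>\<^sub>2)"
abbreviation \<nu> :: real where "\<nu> \<equiv> aniso_jb \<alpha> (\<tau>\<^sub>1 + \<tau>\<^sub>2) \<xi>"
abbreviation \<nu>\<^sub>1 :: real where "\<nu>\<^sub>1 \<equiv> aniso_jb \<alpha> \<tau>\<^sub>1 \<xi>\<^sub>1"
abbreviation \<nu>\<^sub>2 :: real where "\<nu>\<^sub>2 \<equiv> aniso_jb \<alpha> \<tau>\<^sub>2 \<xi>\<^sub>2"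
abbreviation modulations :: real where "modulations \<equiv> \<sigma> powr - \<beta> * \<sigma>\<^sub>1 powr - (2 * b) * \<sigma>\<^sub>2 powr - (2 * b)"

definition N :: real where "N = max \<bar>\<xi>\<bar> \<bar>\<xi>\<^sub>1\<bar>"
definition L :: real where "L = min \<bar>\<xi>\<bar> \<bar>\<xi>\<^sub>2\<bar>"

lemma N_pos: "0 < N" and L_pos: "0 < L" and L_le_N: "L \<le> N" and N_le: "N \<le> 2 * \<bar>\<xi>\<^sub>1\<bar>"
  and N_ge: "\<bar>\<xi>\<bar> \<le> N" "\<bar>\<xi>\<^sub>1\<bar> \<le> N"
  using nonzero ordered by (auto simp: N_def L_def)

lemma L_eq: "\<bar>\<xi>\<^sub>2\<bar> \<le> \<bar>\<xi>\<bar> \<Longrightarrow> L = \<bar>\<xi>\<^sub>2\<bar>" "\<bar>\<xi>\<bar> \<le> \<bar>\<xi>\<^sub>2\<bar> \<Longrightarrow> L = \<bar>\<xi>\<bar>"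
  by (auto simp: L_def)

lemma N_eq: "\<bar>\<xi>\<bar> \<le> \<bar>\<xi>\<^sub>2\<bar> \<Longrightarrow> N = \<bar>\<xi>\<^sub>1\<bar>"
  using ordered by (auto simp: N_def)

lemma majorant_ge:
  shows "\<sigma>\<^sub>1 powr - (2 * b) * \<sigma>\<^sub>2 powr - (2 * b) * padded_slope \<alpha> \<xi> \<xi>\<^sub>1 \<le> majorant z\<^sub>1 z\<^sub>2"
    and "\<sigma> powr - (2 * b) * \<sigma>\<^sub>2 powr - (2 * b) * padded_slope \<alpha> \<xi>\<^sub>1 \<xi> \<le> majorant z\<^sub>1 z\<^sub>2"
    and "\<sigma> powr - (2 * b) * \<sigma>\<^sub>1 powr - (2 * b) * padded_slope \<alpha> \<xi>\<^sub>2 \<xi> \<le> majorant z\<^sub>1 z\<^sub>2"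
    and "\<sigma>\<^sub>1 powr - (2 * b) * low_frequency_tail \<xi> \<xi>\<^sub>2 \<le> majorant z\<^sub>1 z\<^sub>2"
proof -
  have "output_part z\<^sub>1 z\<^sub>2 \<le> majorant z\<^sub>1 z\<^sub>2" "input_part z\<^sub>1 z\<^sub>2 \<le> majorant z\<^sub>1 z\<^sub>2"
    "input_part z\<^sub>2 z\<^sub>1 \<le> majorant z\<^sub>1 z\<^sub>2" "tail_part z\<^sub>1 z\<^sub>2 \<le> majorant z\<^sub>1 z\<^sub>2"
    by (simp_all add: majorant_def)
  then show "\<sigma>\<^sub>1 powr - (2 * b) * \<sigma>\<^sub>2 powr - (2 * b) * padded_slope \<alpha> \<xi> \<xi>\<^sub>1 \<le> majorant z\<^sub>1 z\<^sub>2"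
    and "\<sigma> powr - (2 * b) * \<sigma>\<^sub>2 powr - (2 * b) * padded_slope \<alpha> \<xi>\<^sub>1 \<xi> \<le> majorant z\<^sub>1 z\<^sub>2"
    and "\<sigma> powr - (2 * b) * \<sigma>\<^sub>1 powr - (2 * b) * padded_slope \<alpha> \<xi>\<^sub>2 \<xi> \<le> majorant z\<^sub>1 z\<^sub>2"
    and "\<sigma>\<^sub>1 powr - (2 * b) * low_frequency_tail \<xi> \<xi>\<^sub>2 \<le> majorant z\<^sub>1 z\<^sub>2"
    by (simp_all add: output_part_def input_part_def tail_part_def modulation_decay_def add.commute)
qed

lemma resonance_le_modulation:
  assumes "\<sigma> \<le> S" "\<sigma>\<^sub>1 \<le> S" "\<sigma>\<^sub>2 \<le> S" "S = jb m"
  shows "\<Lambda> N L \<le> 6 * S"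
proof -
  have "L * N powr \<alpha> / 2 \<le> \<bar>phase \<alpha> \<xi> - phase \<alpha> \<xi>\<^sub>1 - phase \<alpha> \<xi>\<^sub>2\<bar>"
    using alpha by (intro resonance[OF _ ordered refl N_def L_def]) simp
  also have "\<dots> = \<bar>(\<tau>\<^sub>1 - phase \<alpha> \<xi>\<^sub>1) + (\<tau>\<^sub>2 - phase \<alpha> \<xi>\<^sub>2) - (\<tau>\<^sub>1 + \<tau>\<^sub>2 - phase \<alpha> \<xi>)\<bar>"
    by simp
  also have "\<dots> \<le> \<bar>m\<bar> + \<bar>m\<bar> + \<bar>m\<bar>"
    using assms by (simp add: jb_le_iff)
  finally have "\<bar>L * N powr \<alpha>\<bar> \<le> 6 * \<bar>m\<bar>"
    using L_pos by simp
  then show ?thesis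
    unfolding assms(4) by (intro jb_le_mult) auto
qed

lemma dominant_modulation_cases:
  obtains (output_dominant) "\<Lambda> N L \<le> 6 * \<sigma>"
  | (first_dominant) "\<sigma> \<le> \<sigma>\<^sub>1" "\<Lambda> N L \<le> 6 * \<sigma>\<^sub>1"
  | (second_dominant) "\<sigma> \<le> \<sigma>\<^sub>2" "\<Lambda> N L \<le> 6 * \<sigma>\<^sub>2"
proof -
  consider "\<sigma>\<^sub>1 \<le> \<sigma>" "\<sigma>\<^sub>2 \<le> \<sigma>" | "\<sigma> \<le> \<sigma>\<^sub>1" "\<sigma>\<^sub>2 \<le> \<sigma>\<^sub>1" | "\<sigma> \<le> \<sigma>\<^sub>2" "\<sigma>\<^sub>1 \<le> \<sigma>\<^sub>2"
    by linarith
  then show thesis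
    by cases (blast intro: that resonance_le_modulation[OF _ _ _ refl] order_refl)+
qed

lemma kernel_sq_eq:
  "kernel_sq z\<^sub>1 z\<^sub>2 = (\<bar>\<xi>\<bar> powr (2 - 2 * \<omega>) * jb \<xi> powr - \<kappa> * \<nu> powr (2 * \<omega>) * \<sigma> powr - \<beta>)
     * (\<bar>\<xi>\<^sub>1\<bar> powr (2 * \<omega>) * jb \<xi>\<^sub>1 powr \<kappa> * \<nu>\<^sub>1 powr - (2 * \<omega>) * \<sigma>\<^sub>1 powr - (2 * b))
     * (\<bar>\<xi>\<^sub>2\<bar> powr (2 * \<omega>) * jb \<xi>\<^sub>2 powr \<kappa> * \<nu>\<^sub>2 powr - (2 * \<omega>) * \<sigma>\<^sub>2 powr - (2 * b))"
proof -
  have weight: "Xweight \<alpha> (- \<rho>) \<omega> r (\<tau>, y)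
      = \<bar>y\<bar> powr - (2 * \<omega>) * jb y powr - \<kappa> * aniso_jb \<alpha> \<tau> y powr (2 * \<omega>) * jb (\<tau> - phase \<alpha> y) powr (2 * r)"
    for r \<tau> y
    by (simp add: Xweight_def aniso_jb_def phase_def algebra_simps)
  have quotient: "(A * (B * C * D * E)) / ((B\<^sub>1 powr - p * C\<^sub>1 powr - q * D\<^sub>1 powr p * E\<^sub>1 powr r) *
    (B\<^sub>2 powr - p * C\<^sub>2 powr - q * D\<^sub>2 powr p * E\<^sub>2 powr r))
    = ((A * B) * C * D * E) * (B\<^sub>1 powr p * C\<^sub>1 powr q * D\<^sub>1 powr - p * E\<^sub>1 powr - r) *
      (B\<^sub>2 powr p * C\<^sub>2 powr q * D\<^sub>2 powr - p * E\<^sub>2 powr - r)"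
    for A B C D E B\<^sub>1 C\<^sub>1 D\<^sub>1 E\<^sub>1 B\<^sub>2 C\<^sub>2 D\<^sub>2 E\<^sub>2 p q r :: real
    by (simp add: powr_minus divide_inverse)
  have "2 * b' = - \<beta>"
    by (simp add: b'_def)
  moreover have "\<xi>\<^sup>2 * \<bar>\<xi>\<bar> powr - (2 * \<omega>) = \<bar>\<xi>\<bar> powr (2 - 2 * \<omega>)"
    using nonzero powr_add[of "\<bar>\<xi>\<bar>" 2 "- (2 * \<omega>)"] by simp
  ultimately show ?thesis
    unfolding kernel_sq_def add_Pair snd_conv weight quotient by (simp only:)
qed

lemma aniso_quotient_le:
  assumes "0 < j" "j \<le> 8 * \<nu>\<^sub>1" "j \<le> 8 * \<nu>\<^sub>2"
  shows "\<nu> powr (2 * \<omega>) * (\<nu>\<^sub>1 powr - (2 * \<omega>) * \<nu>\<^sub>2 powr - (2 * \<omega>)) \<le> 128 * j powr - (2 * \<omega>)"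
proof -
  have "\<nu> * j \<le> 8 * (\<nu>\<^sub>1 + \<nu>\<^sub>2) * j"
    using aniso_jb_add_le[of \<alpha>] alpha assms(1) by (intro mult_right_mono) auto
  also have "\<dots> = 8 * (\<nu>\<^sub>1 * j + \<nu>\<^sub>2 * j)"
    by (simp add: algebra_simps)
  also have "\<dots> \<le> 8 * (\<nu>\<^sub>1 * (8 * \<nu>\<^sub>2) + \<nu>\<^sub>2 * (8 * \<nu>\<^sub>1))"
    using assms by (intro mult_left_mono add_mono) (auto intro: less_imp_le)
  finally have "\<nu> \<le> 128 * inverse j * (\<nu>\<^sub>1 * \<nu>\<^sub>2)"
    using assms(1) by (simp add: field_simps)
  then have "\<nu> powr (2 * \<omega>) \<le> (128 * inverse j * (\<nu>\<^sub>1 * \<nu>\<^sub>2)) powr (2 * \<omega>)"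
    using exponent_bounds by (intro powr_mono2) (auto intro: less_imp_le)
  also have "\<dots> = 128 powr (2 * \<omega>) * j powr - (2 * \<omega>) * (\<nu>\<^sub>1 powr (2 * \<omega>) * \<nu>\<^sub>2 powr (2 * \<omega>))"
    unfolding powr_mult inverse_powr powr_minus ..
  also have "\<dots> \<le> 128 * j powr - (2 * \<omega>) * (\<nu>\<^sub>1 powr (2 * \<omega>) * \<nu>\<^sub>2 powr (2 * \<omega>))"
    using exponent_bounds by (intro mult_right_mono powr_le_self) auto
  finally show ?thesis
    by (simp add: powr_minus field_simps less_imp_neq[symmetric])
qed

lemma kernel_sq_le_of_aniso_ge:
  assumes low: "\<bar>\<xi>\<^sub>2\<bar> \<le> \<bar>\<xi>\<bar>" and j_bounds: "0 < j" "j \<le> 8 * \<nu>\<^sub>1" "j \<le> 8 * \<nu>\<^sub>2"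
  shows "kernel_sq z\<^sub>1 z\<^sub>2 \<le> 1024 * (N\<^sup>2 * L powr (2 * \<omega>) * jb L powr \<kappa> * j powr - (2 * \<omega>)) * modulations"
proof -
  have "jb \<xi>\<^sub>1 \<le> 2 * jb \<xi>"
    using low abs_triangle_ineq4[of \<xi> \<xi>\<^sub>2] by (intro jb_le_mult) auto
  then have "jb \<xi> powr - \<kappa> \<le> 2 powr \<kappa> * jb \<xi>\<^sub>1 powr - \<kappa>"
    using exponent_bounds by (intro powr_neg_le_of_le_mult) auto
  then have "jb \<xi> powr - \<kappa> * jb \<xi>\<^sub>1 powr \<kappa> \<le> 2 powr \<kappa> * jb \<xi>\<^sub>1 powr - \<kappa> * jb \<xi>\<^sub>1 powr \<kappa>"
    by (intro mult_right_mono) auto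
  also have "\<dots> = 2 powr \<kappa>"
    unfolding powr_minus by simp
  also have "\<dots> \<le> 8"
    using exponent_bounds by (intro two_powr_le_8)
  finally have brackets: "jb \<xi> powr - \<kappa> * jb \<xi>\<^sub>1 powr \<kappa> \<le> 8" .
  have "\<bar>\<xi>\<bar> powr (2 - 2 * \<omega>) * \<bar>\<xi>\<^sub>1\<bar> powr (2 * \<omega>) \<le> N powr (2 - 2 * \<omega>) * N powr (2 * \<omega>)"
    using exponent_bounds N_ge N_pos by (intro mult_mono powr_mono2) auto
  also have "\<dots> = N\<^sup>2"
    using N_pos by (simp add: powr_add[symmetric])
  finally have frequencies: "\<bar>\<xi>\<bar> powr (2 - 2 * \<omega>) * \<bar>\<xi>\<^sub>1\<bar> powr (2 * \<omega>) \<le> N\<^sup>2" .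
  have low_eq: "\<bar>\<xi>\<^sub>2\<bar> = L" "jb \<xi>\<^sub>2 = jb L"
    using L_eq(1)[OF low] by auto
  have "kernel_sq z\<^sub>1 z\<^sub>2 = (jb \<xi> powr - \<kappa> * jb \<xi>\<^sub>1 powr \<kappa>) * ((\<bar>\<xi>\<bar> powr (2 - 2 * \<omega>) * \<bar>\<xi>\<^sub>1\<bar> powr (2 * \<omega>)) *
      L powr (2 * \<omega>) * jb L powr \<kappa> * (\<nu> powr (2 * \<omega>) * (\<nu>\<^sub>1 powr - (2 * \<omega>) * \<nu>\<^sub>2 powr - (2 * \<omega>)))) * modulations"
    unfolding kernel_sq_eq low_eq by (simp only: mult_ac)
  also have "\<dots> \<le> 8 * (N\<^sup>2 * L powr (2 * \<omega>) * jb L powr \<kappa> * (128 * j powr - (2 * \<omega>))) * modulations"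
    by (intro mult_mono brackets frequencies aniso_quotient_le[OF j_bounds] order_refl) auto
  finally show ?thesis by (simp add: mult_ac)
qed

lemma modulation_exchange_le:
  assumes "0 < s" "s \<le> S" "\<Lambda> N L \<le> 6 * S"
  shows "s powr - \<beta> * S powr - (2 * b) \<le> 6 * (s powr - (2 * b) * \<Lambda> N L powr - \<beta>)"
proof -
  have "s powr - \<beta> * S powr - (2 * b) \<le> s powr - (2 * b) * S powr - \<beta>"
    using assms exponent_bounds by (intro powr_exchange_le) auto
  also have "\<dots> \<le> s powr - (2 * b) * (6 powr \<beta> * \<Lambda> N L powr - \<beta>)"
    using assms exponent_bounds by (intro mult_left_mono powr_neg_le_of_le_mult) auto
  also have "\<dots> \<le> s powr - (2 * b) * (6 * \<Lambda> N L powr - \<beta>)"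
    using exponent_bounds by (intro mult_left_mono mult_right_mono powr_le_self) auto
  finally show ?thesis by simp
qed

lemma modulations_le_first:
  assumes "\<sigma> \<le> \<sigma>\<^sub>1" "\<Lambda> N L \<le> 6 * \<sigma>\<^sub>1"
  shows "modulations \<le> 6 * (\<sigma> powr - (2 * b) * \<sigma>\<^sub>2 powr - (2 * b)) * \<Lambda> N L powr - \<beta>"
  using mult_right_mono[OF modulation_exchange_le[OF jb_pos assms], of "\<sigma>\<^sub>2 powr - (2 * b)"] by (simp add: mult_ac)

lemma modulations_le_second:
  assumes "\<sigma> \<le> \<sigma>\<^sub>2" "\<Lambda> N L \<le> 6 * \<sigma>\<^sub>2"
  shows "modulations \<le> 6 * (\<sigma> powr - (2 * b) * \<sigma>\<^sub>1 powr - (2 * b)) * \<Lambda> N L powr - \<beta>"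
  using mult_right_mono[OF modulation_exchange_le[OF jb_pos assms], of "\<sigma>\<^sub>1 powr - (2 * b)"] by (simp add: mult_ac)

lemma modulations_le_output:
  assumes "\<Lambda> N L \<le> 6 * \<sigma>"
  shows "modulations \<le> 6 * (\<sigma>\<^sub>1 powr - (2 * b) * \<sigma>\<^sub>2 powr - (2 * b)) * \<Lambda> N L powr - \<beta>"
proof -
  have "\<sigma> powr - \<beta> \<le> 6 * \<Lambda> N L powr - \<beta>"
    using modulation_exchange_le[OF jb_pos order_refl assms] by simp
  then show ?thesis
    using mult_right_mono[of "\<sigma> powr - \<beta>" _ "\<sigma>\<^sub>1 powr - (2 * b) * \<sigma>\<^sub>2 powr - (2 * b)"] by (simp add: mult_ac)
qed

lemma kernel_sq_le_factor_low_input: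
  assumes low: "\<bar>\<xi>\<^sub>2\<bar> \<le> \<bar>\<xi>\<bar>" and modulations: "modulations \<le> 6 * R * \<Lambda> N L powr - \<beta>"
  shows "kernel_sq z\<^sub>1 z\<^sub>2 \<le> 6144 * (R * factor_low_input N L)"
proof -
  let ?j = "jb L powr (1 + \<alpha>)"
  have "?j = jb \<xi>\<^sub>2 powr (1 + \<alpha>)" "?j \<le> jb \<xi>\<^sub>1 powr (1 + \<alpha>)"
    using L_eq(1)[OF low] ordered alpha by (auto intro!: powr_mono2 simp: jb_le_iff)
  then have j_bounds: "0 < ?j" "?j \<le> 8 * \<nu>\<^sub>1" "?j \<le> 8 * \<nu>\<^sub>2"
    using jb_powr_le_aniso_jb[of \<alpha> \<xi>\<^sub>1 \<tau>\<^sub>1] jb_powr_le_aniso_jb[of \<alpha> \<xi>\<^sub>2 \<tau>\<^sub>2] alpha by auto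
  have "jb L powr \<kappa> * ?j powr - (2 * \<omega>) = jb L powr (2 * \<rho> - 2 * \<omega>)"
    unfolding powr_powr powr_add[symmetric] by (simp add: algebra_simps)
  then have "kernel_sq z\<^sub>1 z\<^sub>2 \<le> 1024 * (N\<^sup>2 * L powr (2 * \<omega>) * jb L powr (2 * \<rho> - 2 * \<omega>)) * modulations"
    using kernel_sq_le_of_aniso_ge[OF low j_bounds] by (simp only: mult.assoc)
  also have "\<dots> \<le> 1024 * (N\<^sup>2 * L powr (2 * \<omega>) * jb L powr (2 * \<rho> - 2 * \<omega>)) * (6 * R * \<Lambda> N L powr - \<beta>)"
    using modulations by (rule mult_left_mono) simp
  also have "\<dots> = 6144 * (R * factor_low_input N L)"
    by (simp add: factor_low_input_def)
  finally show ?thesis .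
qed

lemma factor_low_input_le_padded_slope:
  assumes "\<bar>\<xi>\<^sub>2\<bar> \<le> \<bar>\<xi>\<bar>" "\<bar>y\<bar> = \<bar>\<xi>\<^sub>2\<bar>" "\<bar>\<xi>\<^sub>2\<bar> \<le> \<bar>x\<bar>" "\<bar>\<xi>\<^sub>2\<bar> \<le> \<bar>x - y\<bar>" "N = max \<bar>x\<bar> \<bar>x - y\<bar>"
  shows "factor_low_input N L \<le> 128 * padded_slope \<alpha> x y"
proof -
  have "factor_low_input N L \<le> 4 * 32 * padded_slope \<alpha> x y"
  proof (rule le_padded_slope_of_input_smallest[OF alpha _ _ _ assms(5)])
    show "factor_low_input N L \<le> 32 * N powr \<alpha>"
      by (rule order_trans[OF factor_low_input_le[OF L_pos L_le_N]]) simp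
    show "factor_low_input N L \<le> 32 * max 1 N powr ((\<alpha> - 1) / 2)" if "N \<le> 4 * \<bar>y\<bar>"
      using that assms(2) L_eq(1)[OF assms(1)] by (intro factor_low_input_le_comparable L_pos L_le_N) simp
  qed (use assms(2-4) nonzero in auto)
  then show ?thesis by simp
qed

lemma kernel_sq_le_low_input_of_padded_slope:
  assumes low: "\<bar>\<xi>\<^sub>2\<bar> \<le> \<bar>\<xi>\<bar>" and modulations: "modulations \<le> 6 * R * \<Lambda> N L powr - \<beta>" "0 \<le> R"
    and slope: "factor_low_input N L \<le> 128 * P" and majorant: "R * P \<le> majorant z\<^sub>1 z\<^sub>2"
  shows "kernel_sq z\<^sub>1 z\<^sub>2 \<le> 786432 * majorant z\<^sub>1 z\<^sub>2"
proof -
  have "kernel_sq z\<^sub>1 z\<^sub>2 \<le> 6144 * (R * (128 * P))"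
    using kernel_sq_le_factor_low_input[OF low modulations(1)] mult_left_mono[OF slope modulations(2)] by linarith
  then show ?thesis
    using majorant by simp
qed

lemma kernel_sq_le_low_input_output_dominant:
  assumes low: "\<bar>\<xi>\<^sub>2\<bar> \<le> \<bar>\<xi>\<bar>" and dominant: "\<Lambda> N L \<le> 6 * \<sigma>"
  shows "kernel_sq z\<^sub>1 z\<^sub>2 \<le> 786432 * majorant z\<^sub>1 z\<^sub>2"
proof (rule kernel_sq_le_low_input_of_padded_slope[OF low modulations_le_output[OF dominant]])
  have "factor_low_input N L \<le> 128 * padded_slope \<alpha> \<xi> \<xi>\<^sub>2"
    using low ordered by (intro factor_low_input_le_padded_slope) (auto simp: N_def)
  then show "factor_low_input N L \<le> 128 * padded_slope \<alpha> \<xi> \<xi>\<^sub>1"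
    using padded_slope_swap[of \<alpha> \<xi> \<xi>\<^sub>1] by simp
qed (auto intro: majorant_ge)

lemma kernel_sq_le_low_input_high_dominant:
  assumes low: "\<bar>\<xi>\<^sub>2\<bar> \<le> \<bar>\<xi>\<bar>" and dominant: "\<sigma> \<le> \<sigma>\<^sub>1" "\<Lambda> N L \<le> 6 * \<sigma>\<^sub>1"
  shows "kernel_sq z\<^sub>1 z\<^sub>2 \<le> 786432 * majorant z\<^sub>1 z\<^sub>2"
proof (rule kernel_sq_le_low_input_of_padded_slope[OF low modulations_le_first[OF dominant]])
  have "factor_low_input N L \<le> 128 * padded_slope \<alpha> \<xi>\<^sub>1 (- \<xi>\<^sub>2)"
    using low ordered by (intro factor_low_input_le_padded_slope) (auto simp: N_def max.commute)
  then show "factor_low_input N L \<le> 128 * padded_slope \<alpha> \<xi>\<^sub>1 \<xi>"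
    using padded_slope_swap[of \<alpha> \<xi>\<^sub>1 \<xi>] by simp
qed (auto intro: majorant_ge)

lemma kernel_sq_le_low_input_modulated:
  assumes low: "\<bar>\<xi>\<^sub>2\<bar> \<le> \<bar>\<xi>\<bar>" and dominant: "\<Lambda> N L \<le> 6 * \<sigma>\<^sub>2"
  shows "kernel_sq z\<^sub>1 z\<^sub>2 \<le> 1024 * (N\<^sup>2 * L powr (2 * \<omega>) * jb L powr \<kappa> * \<Lambda> N L powr - (2 * \<omega>)) * modulations"
proof (rule kernel_sq_le_of_aniso_ge[OF low jb_pos])
  have "L * N powr \<alpha> \<le> N powr 1 * N powr \<alpha>"
    using L_le_N N_pos by (intro mult_right_mono) auto
  also have "\<dots> \<le> (2 * \<bar>\<xi>\<^sub>1\<bar>) powr (1 + \<alpha>)"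
    unfolding powr_add[symmetric] using N_le N_pos alpha by (intro powr_mono2) auto
  also have "\<dots> \<le> 8 * \<bar>\<xi>\<^sub>1\<bar> powr (1 + \<alpha>)"
    unfolding powr_mult using alpha by (intro mult_right_mono two_powr_le_8) auto
  finally have "\<Lambda> N L \<le> 8 * jb (\<bar>\<xi>\<^sub>1\<bar> powr (1 + \<alpha>))"
    using L_pos by (intro jb_le_mult) auto
  also have "\<dots> \<le> 8 * \<nu>\<^sub>1"
    by (intro mult_left_mono aniso_jb_ge_jb_powr) simp
  finally show "\<Lambda> N L \<le> 8 * \<nu>\<^sub>1" .
  show "\<Lambda> N L \<le> 8 * \<nu>\<^sub>2"
    using dominant aniso_jb_ge_modulation[of \<tau>\<^sub>2 \<alpha> \<xi>\<^sub>2] aniso_jb_pos[of \<alpha> \<tau>\<^sub>2 \<xi>\<^sub>2] by linarith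
qed

lemma kernel_sq_le_low_input_low_dominant_large:
  assumes low: "\<bar>\<xi>\<^sub>2\<bar> \<le> \<bar>\<xi>\<bar>" and dominant: "\<sigma> \<le> \<sigma>\<^sub>2" "\<Lambda> N L \<le> 6 * \<sigma>\<^sub>2" and L_ge_1: "1 \<le> L"
  shows "kernel_sq z\<^sub>1 z\<^sub>2 \<le> 49152 * majorant z\<^sub>1 z\<^sub>2"
proof -
  let ?R = "\<sigma> powr - (2 * b) * \<sigma>\<^sub>1 powr - (2 * b)"
  have "kernel_sq z\<^sub>1 z\<^sub>2 \<le> 1024 * (N\<^sup>2 * L powr (2 * \<omega>) * jb L powr \<kappa> * \<Lambda> N L powr - (2 * \<omega>)) *
      (6 * ?R * \<Lambda> N L powr - \<beta>)"
    by (intro order_trans[OF kernel_sq_le_low_input_modulated[OF low dominant(2)]]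
        mult_left_mono modulations_le_second dominant) auto
  also have "\<dots> = 6144 * (?R * factor_low_modulated_input N L)"
    using powr_add[of "\<Lambda> N L" "- (2 * \<omega>)" "- \<beta>"] by (simp add: factor_low_modulated_input_def)
  also have "factor_low_modulated_input N L \<le> 8 * (N powr (\<alpha> - 1) * L)"
    by (rule factor_low_modulated_input_le[OF L_ge_1 L_le_N])
  also have "N powr (\<alpha> - 1) * L \<le> padded_slope \<alpha> \<xi>\<^sub>2 \<xi>"
    using padded_slope_ge_of_smallest[of \<alpha> \<xi>\<^sub>2 \<xi>] L_eq(1)[OF low] alpha low ordered by (simp add: N_def)
  also have "6144 * (?R * (8 * padded_slope \<alpha> \<xi>\<^sub>2 \<xi>)) = 49152 * (?R * padded_slope \<alpha> \<xi>\<^sub>2 \<xi>)"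
    by simp
  finally show ?thesis
    using majorant_ge(3) by (simp add: mult_left_mono)
qed

lemma modulations_le_tail:
  assumes low: "\<bar>\<xi>\<^sub>2\<bar> \<le> \<bar>\<xi>\<bar>" and dominant: "\<Lambda> N L \<le> 6 * \<sigma>\<^sub>2"
  shows "modulations \<le> \<sigma>\<^sub>1 powr - (2 * b) * (36 * jb (\<bar>\<xi>\<^sub>2\<bar> * \<bar>\<xi>\<bar> powr \<alpha>) powr - (2 * b))"
proof -
  have "\<bar>\<xi>\<^sub>2\<bar> * \<bar>\<xi>\<bar> powr \<alpha> \<le> L * N powr \<alpha>"
    using L_eq(1)[OF low] alpha N_ge by (intro mult_mono powr_mono2) auto
  then have "jb (\<bar>\<xi>\<^sub>2\<bar> * \<bar>\<xi>\<bar> powr \<alpha>) \<le> \<Lambda> N L"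
    by (simp add: jb_le_iff)
  then have "\<sigma>\<^sub>2 powr - (2 * b) \<le> 6 powr (2 * b) * jb (\<bar>\<xi>\<^sub>2\<bar> * \<bar>\<xi>\<bar> powr \<alpha>) powr - (2 * b)"
    using dominant exponent_bounds by (intro powr_neg_le_of_le_mult) auto
  also have "6 powr (2 * b) \<le> (6 powr 2 :: real)"
    using alpha eps rho by (intro powr_mono) (auto simp: b_def)
  finally have tail: "\<sigma>\<^sub>2 powr - (2 * b) \<le> 36 * jb (\<bar>\<xi>\<^sub>2\<bar> * \<bar>\<xi>\<bar> powr \<alpha>) powr - (2 * b)"
    by (simp add: mult_right_mono)
  have "modulations \<le> 1 * \<sigma>\<^sub>1 powr - (2 * b) * (36 * jb (\<bar>\<xi>\<^sub>2\<bar> * \<bar>\<xi>\<bar> powr \<alpha>) powr - (2 * b))"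
    using exponent_bounds by (intro mult_mono jb_powr_nonpos_le_1 tail order_refl) auto
  then show ?thesis by simp
qed

lemma kernel_sq_le_low_input_low_dominant_small:
  assumes low: "\<bar>\<xi>\<^sub>2\<bar> \<le> \<bar>\<xi>\<bar>" and dominant: "\<Lambda> N L \<le> 6 * \<sigma>\<^sub>2" and L_le_1: "L \<le> 1"
  shows "kernel_sq z\<^sub>1 z\<^sub>2 \<le> 1179648 * majorant z\<^sub>1 z\<^sub>2"
proof -
  have "N\<^sup>2 * L powr (2 * \<omega>) * jb L powr \<kappa> * \<Lambda> N L powr - (2 * \<omega>) \<le> 8 * N powr \<alpha>"
    using exponent_bounds by (intro scale_invariant_le L_pos L_le_1 N_pos) auto
  also have "N powr \<alpha> \<le> (2 * \<bar>\<xi>\<bar>) powr \<alpha>"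
    using low abs_triangle_ineq4[of \<xi> \<xi>\<^sub>2] alpha N_pos by (intro powr_mono2) (auto simp: N_def)
  also have "\<dots> \<le> 4 * \<bar>\<xi>\<bar> powr \<alpha>"
    unfolding powr_mult using powr_mono[of \<alpha> 2 "2 :: real"] alpha by (intro mult_right_mono) auto
  finally have factor: "N\<^sup>2 * L powr (2 * \<omega>) * jb L powr \<kappa> * \<Lambda> N L powr - (2 * \<omega>) \<le> 8 * (4 * \<bar>\<xi>\<bar> powr \<alpha>)"
    by simp
  have "1024 * (N\<^sup>2 * L powr (2 * \<omega>) * jb L powr \<kappa> * \<Lambda> N L powr - (2 * \<omega>)) * modulations
    \<le> 1024 * (8 * (4 * \<bar>\<xi>\<bar> powr \<alpha>)) * (\<sigma>\<^sub>1 powr - (2 * b) * (36 * jb (\<bar>\<xi>\<^sub>2\<bar> * \<bar>\<xi>\<bar> powr \<alpha>) powr - (2 * b)))"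
    by (rule mult_mono[OF mult_left_mono[OF factor] modulations_le_tail[OF low dominant]]) auto
  also have "\<dots> = 1179648 * (\<sigma>\<^sub>1 powr - (2 * b) * low_frequency_tail \<xi> \<xi>\<^sub>2)"
    by (simp add: low_frequency_tail_def)
  finally show ?thesis
    using kernel_sq_le_low_input_modulated[OF low dominant] majorant_ge(4) by linarith
qed

lemma kernel_sq_le_low_input:
  assumes low: "\<bar>\<xi>\<^sub>2\<bar> \<le> \<bar>\<xi>\<bar>"
  shows "kernel_sq z\<^sub>1 z\<^sub>2 \<le> 18874368 * majorant z\<^sub>1 z\<^sub>2"
proof -
  have nonneg: "0 \<le> majorant z\<^sub>1 z\<^sub>2"
    by (simp add: majorant_def)
  show ?thesis
  proof (cases rule: dominant_modulation_cases)
    case output_dominant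
    show ?thesis
      using kernel_sq_le_low_input_output_dominant[OF low output_dominant] nonneg by linarith
  next
    case first_dominant
    show ?thesis
      using kernel_sq_le_low_input_high_dominant[OF low first_dominant] nonneg by linarith
  next
    case second_dominant
    show ?thesis
      using kernel_sq_le_low_input_low_dominant_large[OF low second_dominant]
        kernel_sq_le_low_input_low_dominant_small[OF low second_dominant(2)] nonneg
      by (cases "L \<le> 1") linarith+
  qed
qed

lemma aniso_powr_le_low_output:
  assumes "\<bar>\<xi>\<bar> \<le> \<bar>\<xi>\<^sub>2\<bar>"
  shows "\<nu> powr (2 * \<omega>) \<le> 3 * (\<sigma> powr (2 * \<omega>) + \<Lambda> N L powr (2 * \<omega>))"
proof -
  have "\<bar>\<xi>\<bar> powr (1 + \<alpha>) \<le> L * N powr \<alpha>"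
    using L_eq(2)[OF assms] alpha N_ge by (auto simp: powr_add intro!: mult_left_mono powr_mono2)
  then have "jb (\<bar>\<xi>\<bar> powr (1 + \<alpha>)) \<le> \<Lambda> N L"
    by (simp add: jb_le_iff)
  then have "\<nu> \<le> 3 * max \<sigma> (\<Lambda> N L)"
    using aniso_jb_le[of \<alpha> "\<tau>\<^sub>1 + \<tau>\<^sub>2" \<xi>] by linarith
  then have "\<nu> powr (2 * \<omega>) \<le> (3 * max \<sigma> (\<Lambda> N L)) powr (2 * \<omega>)"
    using exponent_bounds by (intro powr_mono2) (auto intro: less_imp_le)
  also have "\<dots> \<le> 3 * max \<sigma> (\<Lambda> N L) powr (2 * \<omega>)"
    unfolding powr_mult using exponent_bounds by (intro mult_right_mono powr_le_self) auto
  also have "\<dots> \<le> 3 * (\<sigma> powr (2 * \<omega>) + \<Lambda> N L powr (2 * \<omega>))"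
    by (auto simp: max_def)
  finally show ?thesis .
qed

lemma low_output_modulation_exchange_le:
  assumes low: "\<bar>\<xi>\<bar> \<le> \<bar>\<xi>\<^sub>2\<bar>" and dominant: "\<sigma> \<le> S" "\<Lambda> N L \<le> 6 * S"
  shows "\<nu> powr (2 * \<omega>) * \<sigma> powr - \<beta> * S powr - (2 * b) \<le> 36 * (\<sigma> powr - (2 * b) * \<Lambda> N L powr (2 * \<omega> - \<beta>))"
proof -
  have "\<nu> powr (2 * \<omega>) * \<sigma> powr - \<beta> * S powr - (2 * b)
    \<le> 3 * (\<sigma> powr (2 * \<omega>) + \<Lambda> N L powr (2 * \<omega>)) * \<sigma> powr - \<beta> * S powr - (2 * b)"
    by (intro mult_right_mono aniso_powr_le_low_output[OF low]) auto
  also have "\<dots> = 3 * (\<sigma> powr (2 * \<omega> - \<beta>) * S powr - (2 * b) + \<Lambda> N L powr (2 * \<omega>) * (\<sigma> powr - \<beta> * S powr - (2 * b)))"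
    using powr_add[of \<sigma> "2 * \<omega>" "- \<beta>"] by (simp add: algebra_simps)
  also have "\<dots> \<le> 3 * (\<sigma> powr - (2 * b) * (6 * \<Lambda> N L powr (2 * \<omega> - \<beta>)) +
      \<Lambda> N L powr (2 * \<omega>) * (6 * (\<sigma> powr - (2 * b) * \<Lambda> N L powr - \<beta>)))"
  proof (intro mult_left_mono add_mono modulation_exchange_le jb_pos dominant)
    have "\<sigma> powr (2 * \<omega> - \<beta>) * S powr - (2 * b) \<le> \<sigma> powr - (2 * b) * S powr - (\<beta> - 2 * \<omega>)"
      using powr_exchange_le[OF jb_pos dominant(1), of "- (2 * b)" "2 * \<omega> - \<beta>"] exponent_bounds by simp
    also have "\<dots> \<le> \<sigma> powr - (2 * b) * (6 powr (\<beta> - 2 * \<omega>) * \<Lambda> N L powr - (\<beta> - 2 * \<omega>))"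
      using dominant exponent_bounds by (intro mult_left_mono powr_neg_le_of_le_mult) auto
    also have "\<dots> \<le> \<sigma> powr - (2 * b) * (6 * \<Lambda> N L powr - (\<beta> - 2 * \<omega>))"
      using exponent_bounds by (intro mult_left_mono mult_right_mono powr_le_self) auto
    finally show "\<sigma> powr (2 * \<omega> - \<beta>) * S powr - (2 * b) \<le> \<sigma> powr - (2 * b) * (6 * \<Lambda> N L powr (2 * \<omega> - \<beta>))"
      by simp
  qed auto
  also have "\<dots> = 36 * (\<sigma> powr - (2 * b) * \<Lambda> N L powr (2 * \<omega> - \<beta>))"
    using powr_add[of "\<Lambda> N L" "2 * \<omega>" "- \<beta>"] by (simp add: algebra_simps)
  finally show ?thesis .
qed

lemma input_weight_le:
  assumes "\<bar>y\<bar> \<le> N"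
  shows "\<bar>y\<bar> powr (2 * \<omega>) * jb y powr \<kappa> * aniso_jb \<alpha> \<tau> y powr - (2 * \<omega>) \<le> 8 * jb N powr (2 * \<rho>)"
proof -
  have "aniso_jb \<alpha> \<tau> y powr - (2 * \<omega>) \<le> 8 powr (2 * \<omega>) * (jb y powr (1 + \<alpha>)) powr - (2 * \<omega>)"
    using jb_powr_le_aniso_jb[of \<alpha> y \<tau>] alpha exponent_bounds by (intro powr_neg_le_of_le_mult) auto
  also have "\<dots> \<le> 8 * (jb y powr (1 + \<alpha>)) powr - (2 * \<omega>)"
    using exponent_bounds by (intro mult_right_mono powr_le_self) auto
  finally have "\<bar>y\<bar> powr (2 * \<omega>) * jb y powr \<kappa> * aniso_jb \<alpha> \<tau> y powr - (2 * \<omega>)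
    \<le> jb y powr (2 * \<omega>) * jb y powr \<kappa> * (8 * (jb y powr (1 + \<alpha>)) powr - (2 * \<omega>))"
    using exponent_bounds jb_ge_abs[of y] by (intro mult_mono powr_mono2) auto
  also have "\<dots> = 8 * jb y powr (2 * \<omega> + \<kappa> + (1 + \<alpha>) * - (2 * \<omega>))"
    by (simp only: powr_powr) (simp only: powr_add mult_ac)
  also have "2 * \<omega> + \<kappa> + (1 + \<alpha>) * - (2 * \<omega>) = 2 * \<rho>"
    by (simp add: algebra_simps)
  also have "8 * jb y powr (2 * \<rho>) \<le> 8 * jb N powr (2 * \<rho>)"
    using assms rho by (intro mult_left_mono powr_mono2) (auto simp: jb_le_iff)
  finally show ?thesis .
qed

lemma kernel_sq_le_factor_low_output:
  assumes low: "\<bar>\<xi>\<bar> \<le> \<bar>\<xi>\<^sub>2\<bar>"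
    and modulations: "\<nu> powr (2 * \<omega>) * modulations \<le> 36 * (R * \<Lambda> N L powr (2 * \<omega> - \<beta>))"
  shows "kernel_sq z\<^sub>1 z\<^sub>2 \<le> 2304 * (R * factor_low_output N L)"
proof -
  let ?F = "L powr (2 - 2 * \<omega>) * jb L powr - \<kappa>"
  have low_eq: "\<bar>\<xi>\<bar> = L" "jb \<xi> = jb L"
    using L_eq(2)[OF low] by auto
  have "kernel_sq z\<^sub>1 z\<^sub>2 = ?F * (\<bar>\<xi>\<^sub>1\<bar> powr (2 * \<omega>) * jb \<xi>\<^sub>1 powr \<kappa> * \<nu>\<^sub>1 powr - (2 * \<omega>)) *
      (\<bar>\<xi>\<^sub>2\<bar> powr (2 * \<omega>) * jb \<xi>\<^sub>2 powr \<kappa> * \<nu>\<^sub>2 powr - (2 * \<omega>)) * (\<nu> powr (2 * \<omega>) * modulations)"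
    unfolding kernel_sq_eq low_eq by (simp only: mult_ac)
  also have "\<dots> \<le> ?F * (8 * jb N powr (2 * \<rho>)) * (8 * jb N powr (2 * \<rho>)) * (36 * (R * \<Lambda> N L powr (2 * \<omega> - \<beta>)))"
    using ordered N_ge by (intro mult_mono input_weight_le modulations order_refl) auto
  also have "\<dots> = 2304 * (R * (?F * (jb N powr (2 * \<rho>) * jb N powr (2 * \<rho>)) * \<Lambda> N L powr (2 * \<omega> - \<beta>)))"
    by simp
  also have "jb N powr (2 * \<rho>) * jb N powr (2 * \<rho>) = jb N powr (4 * \<rho>)"
    by (simp add: powr_add[symmetric])
  finally show ?thesis
    by (simp add: factor_low_output_def)
qed

lemma factor_low_output_le_padded_slope:
  assumes "\<bar>\<xi>\<bar> \<le> \<bar>\<xi>\<^sub>2\<bar>" "\<bar>\<xi>\<bar> \<le> \<bar>x\<bar>" "\<bar>\<xi>\<bar> \<le> \<bar>x - \<xi>\<bar>" "N = max \<bar>x\<bar> \<bar>x - \<xi>\<bar>"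
  shows "factor_low_output N L \<le> 8192 * padded_slope \<alpha> x \<xi>"
proof -
  have "factor_low_output N L \<le> 4 * 2048 * padded_slope \<alpha> x \<xi>"
  proof (rule le_padded_slope_of_input_smallest[OF alpha assms(2,3) nonzero(3) assms(4)])
    have "factor_low_output N L \<le> 8 * (N powr (\<alpha> - 1) * N)"
      using L_le_N by (intro order_trans[OF factor_low_output_le[OF L_pos L_le_N]] mult_left_mono) auto
    also have "\<dots> \<le> 2048 * (N powr (\<alpha> - 1) * N powr 1)"
      using N_pos by simp
    also have "N powr (\<alpha> - 1) * N powr 1 = N powr \<alpha>"
      unfolding powr_add[symmetric] by simp
    finally show "factor_low_output N L \<le> 2048 * N powr \<alpha>" .
    show "factor_low_output N L \<le> 2048 * max 1 N powr ((\<alpha> - 1) / 2)" if "N \<le> 4 * \<bar>\<xi>\<bar>"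
      using that L_eq(2)[OF assms(1)] by (intro factor_low_output_le_comparable L_pos L_le_N) simp
  qed auto
  then show ?thesis by simp
qed

lemma kernel_sq_le_low_output_of_padded_slope:
  assumes low: "\<bar>\<xi>\<bar> \<le> \<bar>\<xi>\<^sub>2\<bar>"
    and modulations: "\<nu> powr (2 * \<omega>) * modulations \<le> 36 * (R * \<Lambda> N L powr (2 * \<omega> - \<beta>))" "0 \<le> R"
    and slope: "factor_low_output N L \<le> 8192 * P" and majorant: "R * P \<le> majorant z\<^sub>1 z\<^sub>2"
  shows "kernel_sq z\<^sub>1 z\<^sub>2 \<le> 18874368 * majorant z\<^sub>1 z\<^sub>2"
proof -
  have "kernel_sq z\<^sub>1 z\<^sub>2 \<le> 2304 * (R * (8192 * P))"
    using kernel_sq_le_factor_low_output[OF low modulations(1)] mult_left_mono[OF slope modulations(2)] by linarith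
  then show ?thesis
    using majorant by simp
qed

lemma kernel_sq_le_low_output:
  assumes low: "\<bar>\<xi>\<bar> \<le> \<bar>\<xi>\<^sub>2\<bar>"
  shows "kernel_sq z\<^sub>1 z\<^sub>2 \<le> 18874368 * majorant z\<^sub>1 z\<^sub>2"
proof (cases rule: dominant_modulation_cases)
  case output_dominant
  have "\<nu> powr (2 * \<omega>) * \<sigma> powr - \<beta> \<le> 36 * \<Lambda> N L powr (2 * \<omega> - \<beta>)"
    using low_output_modulation_exchange_le[OF low order_refl output_dominant] by simp
  from mult_right_mono[OF this, of "\<sigma>\<^sub>1 powr - (2 * b) * \<sigma>\<^sub>2 powr - (2 * b)"]
  have modulations: "\<nu> powr (2 * \<omega>) * modulations
    \<le> 36 * (\<sigma>\<^sub>1 powr - (2 * b) * \<sigma>\<^sub>2 powr - (2 * b) * \<Lambda> N L powr (2 * \<omega> - \<beta>))"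
    by (simp add: mult_ac)
  have "N powr (\<alpha> - 1) * L \<le> padded_slope \<alpha> \<xi> \<xi>\<^sub>1"
    using padded_slope_ge_of_smallest[of \<alpha> \<xi> \<xi>\<^sub>1] L_eq(2)[OF low] N_eq[OF low] low ordered alpha
    by (simp add: max_absorb1)
  then have slope: "factor_low_output N L \<le> 8192 * padded_slope \<alpha> \<xi> \<xi>\<^sub>1"
    using factor_low_output_le[OF L_pos L_le_N] padded_slope_nonneg[of \<alpha> \<xi> \<xi>\<^sub>1] alpha by linarith
  show ?thesis
    by (rule kernel_sq_le_low_output_of_padded_slope[OF low modulations _ slope majorant_ge(1)]) simp
next
  case first_dominant
  from mult_right_mono[OF low_output_modulation_exchange_le[OF low this], of "\<sigma>\<^sub>2 powr - (2 * b)"]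
  have modulations: "\<nu> powr (2 * \<omega>) * modulations
    \<le> 36 * (\<sigma> powr - (2 * b) * \<sigma>\<^sub>2 powr - (2 * b) * \<Lambda> N L powr (2 * \<omega> - \<beta>))"
    by (simp add: mult_ac)
  have slope: "factor_low_output N L \<le> 8192 * padded_slope \<alpha> \<xi>\<^sub>1 \<xi>"
    using low ordered N_eq[OF low] by (intro factor_low_output_le_padded_slope) auto
  show ?thesis
    by (rule kernel_sq_le_low_output_of_padded_slope[OF low modulations _ slope majorant_ge(2)]) simp
next
  case second_dominant
  from mult_right_mono[OF low_output_modulation_exchange_le[OF low this], of "\<sigma>\<^sub>1 powr - (2 * b)"]
  have modulations: "\<nu> powr (2 * \<omega>) * modulations
    \<le> 36 * (\<sigma> powr - (2 * b) * \<sigma>\<^sub>1 powr - (2 * b) * \<Lambda> N L powr (2 * \<omega> - \<beta>))"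
    by (simp add: mult_ac)
  have slope: "factor_low_output N L \<le> 8192 * padded_slope \<alpha> \<xi>\<^sub>2 \<xi>"
    using low ordered N_eq[OF low] by (intro factor_low_output_le_padded_slope) auto
  show ?thesis
    by (rule kernel_sq_le_low_output_of_padded_slope[OF low modulations _ slope majorant_ge(3)]) simp
qed

lemma kernel_sq_le_majorant_ordered: "kernel_sq z\<^sub>1 z\<^sub>2 \<le> 18874368 * majorant z\<^sub>1 z\<^sub>2"
  using kernel_sq_le_low_input kernel_sq_le_low_output by linarith

end

context dispersion_params
begin

lemma kernel_sq_le_majorant: "kernel_sq p q \<le> 18874368 * majorant p q"
proof (cases "snd p = 0 \<or> snd q = 0 \<or> snd p + snd q = 0")
  case True
  then have "kernel_sq p q = 0"
    by (auto simp: kernel_sq_def Xweight_def split: prod.split)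
  then show ?thesis
    by (simp add: majorant_def)
next
  case nonzero: False
  show ?thesis
  proof (cases "\<bar>snd q\<bar> \<le> \<bar>snd p\<bar>")
    case True
    interpret interaction \<alpha> \<omega> \<rho> \<epsilon> b b' "fst p" "snd p" "fst q" "snd q"
      using nonzero True by unfold_locales auto
    show ?thesis
      using kernel_sq_le_majorant_ordered by simp
  next
    case False
    interpret interaction \<alpha> \<omega> \<rho> \<epsilon> b b' "fst q" "snd q" "fst p" "snd p"
      using nonzero False by unfold_locales (auto simp: add.commute)
    show ?thesis
      using kernel_sq_le_majorant_ordered by (simp add: kernel_sq_commute[of p] majorant_commute[of p])
  qed
qed

end

section \<open>Bounded bilinear kernels\<close>

definition kernel_conv ::
    "('a::euclidean_space \<Rightarrow> 'a \<Rightarrow> ennreal) \<Rightarrow> ('a \<Rightarrow> ennreal) \<Rightarrow> ('a \<Rightarrow> ennreal) \<Rightarrow> 'a \<Rightarrow> ennreal" where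
  "kernel_conv k f g z = (\<integral>\<^sup>+w. k w (z - w) * (f w * g (z - w)) \<partial>lborel)"

definition L2_mass :: "('a::euclidean_space \<Rightarrow> ennreal) \<Rightarrow> ennreal" where
  "L2_mass f = (\<integral>\<^sup>+w. (f w)\<^sup>2 \<partial>lborel)"

definition kernel_bound :: "('a::euclidean_space \<Rightarrow> 'a \<Rightarrow> ennreal) \<Rightarrow> ennreal \<Rightarrow> bool" where
  "kernel_bound k C \<longleftrightarrow> (\<forall>f\<in>borel_measurable borel. \<forall>g\<in>borel_measurable borel.
    L2_mass (kernel_conv k f g) \<le> C * (L2_mass f * L2_mass g))"

definition bounded_kernel :: "('a::euclidean_space \<Rightarrow> 'a \<Rightarrow> ennreal) \<Rightarrow> bool" where
  "bounded_kernel k \<longleftrightarrow> case_prod k \<in> borel_measurable (borel \<Otimes>\<^sub>M borel) \<and> (\<exists>C<\<infinity>. kernel_bound k C)"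

lemma kernel_boundI:
  assumes "\<And>f g. f \<in> borel_measurable borel \<Longrightarrow> g \<in> borel_measurable borel \<Longrightarrow>
      L2_mass (kernel_conv k f g) \<le> C * (L2_mass f * L2_mass g)"
  shows "kernel_bound k C"
  using assms by (simp add: kernel_bound_def)

lemma kernel_boundD:
  assumes "kernel_bound k C" "f \<in> borel_measurable borel" "g \<in> borel_measurable borel"
  shows "L2_mass (kernel_conv k f g) \<le> C * (L2_mass f * L2_mass g)"
  using assms by (simp add: kernel_bound_def)

lemma bounded_kernelI:
  assumes "case_prod k \<in> borel_measurable (borel \<Otimes>\<^sub>M borel)" "C < \<infinity>" "kernel_bound k C"
  shows "bounded_kernel k"
  using assms unfolding bounded_kernel_def by blast

lemma bounded_kernelE:
  assumes "bounded_kernel k"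
  obtains C where "C < \<infinity>" "kernel_bound k C"
  using assms unfolding bounded_kernel_def by blast

lemma bounded_kernel_measurable: "bounded_kernel k \<Longrightarrow> case_prod k \<in> borel_measurable (borel \<Otimes>\<^sub>M borel)"
  by (simp add: bounded_kernel_def)

lemma measurable_kernel_compose:
  assumes "case_prod k \<in> borel_measurable (borel \<Otimes>\<^sub>M borel)" "f \<in> measurable M borel" "g \<in> measurable M borel"
  shows "(\<lambda>x. k (f x) (g x)) \<in> borel_measurable M"
  using measurable_compose[OF measurable_Pair[OF assms(2,3)] assms(1)] by simp

lemma kernel_conv_measurable:
  fixes k :: "'a::euclidean_space \<Rightarrow> 'a \<Rightarrow> ennreal"
  assumes "case_prod k \<in> borel_measurable (borel \<Otimes>\<^sub>M borel)"
    and [measurable]: "f \<in> borel_measurable borel" "g \<in> borel_measurable borel"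
  shows "kernel_conv k f g \<in> borel_measurable borel"
proof -
  note [measurable] = measurable_kernel_compose[OF assms(1)]
  show ?thesis
    unfolding kernel_conv_def[abs_def] by measurable
qed

lemma kernel_conv_commute:
  fixes k :: "'a::euclidean_space \<Rightarrow> 'a \<Rightarrow> ennreal"
  assumes "case_prod k \<in> borel_measurable (borel \<Otimes>\<^sub>M borel)"
    and [measurable]: "f \<in> borel_measurable borel" "g \<in> borel_measurable borel"
  shows "kernel_conv (\<lambda>p q. k q p) f g z = kernel_conv k g f z"
proof -
  note [measurable] = measurable_kernel_compose[OF assms(1)]
  have "(\<integral>\<^sup>+w. k (z - w) w * (f w * g (z - w)) \<partial>lborel)
    = (\<integral>\<^sup>+w. k (z - (z - w)) (z - w) * (f (z - w) * g (z - (z - w))) \<partial>lborel)"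
    by (rule nn_integral_lborel_const_minus[symmetric]) measurable
  then show ?thesis
    by (simp add: kernel_conv_def mult_ac)
qed

lemma bounded_kernel_commute:
  fixes k :: "'a::euclidean_space \<Rightarrow> 'a \<Rightarrow> ennreal"
  assumes k: "bounded_kernel k"
  shows "bounded_kernel (\<lambda>p q. k q p)"
proof -
  note k_measurable = bounded_kernel_measurable[OF k]
  note [measurable] = measurable_kernel_compose[OF k_measurable]
  obtain C where "C < \<infinity>" and bound: "kernel_bound k C"
    using k by (rule bounded_kernelE)
  show ?thesis
  proof (rule bounded_kernelI[OF _ \<open>C < \<infinity>\<close>])
    show "kernel_bound (\<lambda>p q. k q p) C"
    proof (rule kernel_boundI)
      fix f g :: "'a \<Rightarrow> ennreal"
      assume fg: "f \<in> borel_measurable borel" "g \<in> borel_measurable borel"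
      have "kernel_conv (\<lambda>p q. k q p) f g = kernel_conv k g f"
        using kernel_conv_commute[OF k_measurable fg] by blast
      then show "L2_mass (kernel_conv (\<lambda>p q. k q p) f g) \<le> C * (L2_mass f * L2_mass g)"
        using kernel_boundD[OF bound fg(2,1)] by (simp add: mult.commute)
    qed
  qed measurable
qed

lemma bounded_kernel_mono:
  fixes k l :: "'a::euclidean_space \<Rightarrow> 'a \<Rightarrow> ennreal"
  assumes "bounded_kernel l" "case_prod k \<in> borel_measurable (borel \<Otimes>\<^sub>M borel)" and k_le_l: "\<And>p q. k p q \<le> l p q"
  shows "bounded_kernel k"
proof -
  obtain C where "C < \<infinity>" and bound: "kernel_bound l C"
    using assms(1) by (rule bounded_kernelE)
  have "L2_mass (kernel_conv k f g) \<le> L2_mass (kernel_conv l f g)" for f g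
    unfolding L2_mass_def kernel_conv_def by (intro nn_integral_mono power_mono mult_right_mono k_le_l) auto
  then have "kernel_bound k C"
    using kernel_boundD[OF bound] by (blast intro: kernel_boundI order_trans)
  then show ?thesis
    by (rule bounded_kernelI[OF assms(2) \<open>C < \<infinity>\<close>])
qed

lemma kernel_bound_cmult:
  fixes k :: "'a::euclidean_space \<Rightarrow> 'a \<Rightarrow> ennreal"
  assumes k: "case_prod k \<in> borel_measurable (borel \<Otimes>\<^sub>M borel)" and bound: "kernel_bound k C"
  shows "kernel_bound (\<lambda>p q. c * k p q) (c\<^sup>2 * C)"
proof (rule kernel_boundI)
  note [measurable] = measurable_kernel_compose[OF k]
  fix f g :: "'a \<Rightarrow> ennreal"
  assume fg [measurable]: "f \<in> borel_measurable borel" "g \<in> borel_measurable borel"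
  have [measurable]: "kernel_conv k f g \<in> borel_measurable borel"
    by (rule kernel_conv_measurable[OF k fg])
  have "kernel_conv (\<lambda>p q. c * k p q) f g z = c * kernel_conv k f g z" for z
    unfolding kernel_conv_def mult.assoc by (rule nn_integral_cmult) measurable
  then have "L2_mass (kernel_conv (\<lambda>p q. c * k p q) f g) = c\<^sup>2 * L2_mass (kernel_conv k f g)"
    unfolding L2_mass_def by (simp add: power_mult_distrib nn_integral_cmult)
  then show "L2_mass (kernel_conv (\<lambda>p q. c * k p q) f g) \<le> c\<^sup>2 * C * (L2_mass f * L2_mass g)"
    using kernel_boundD[OF bound fg] by (simp add: mult.assoc mult_left_mono)
qed

lemma bounded_kernel_cmult:
  fixes k :: "'a::euclidean_space \<Rightarrow> 'a \<Rightarrow> ennreal"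
  assumes k: "bounded_kernel k" and "c < \<infinity>"
  shows "bounded_kernel (\<lambda>p q. c * k p q)"
proof -
  note [measurable] = measurable_kernel_compose[OF bounded_kernel_measurable[OF k]]
  obtain C where "C < \<infinity>" and bound: "kernel_bound k C"
    using k by (rule bounded_kernelE)
  show ?thesis
  proof (rule bounded_kernelI)
    show "c\<^sup>2 * C < \<infinity>"
      using \<open>C < \<infinity>\<close> \<open>c < \<infinity>\<close> by (simp add: ennreal_mult_less_top power2_eq_square)
    show "kernel_bound (\<lambda>p q. c * k p q) (c\<^sup>2 * C)"
      by (rule kernel_bound_cmult[OF bounded_kernel_measurable[OF k] bound])
  qed measurable
qed

lemma ennreal_add_power2_le: "(a + c)\<^sup>2 \<le> 4 * (a\<^sup>2 + c\<^sup>2 :: ennreal)"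
proof -
  have "(a + c)\<^sup>2 \<le> (2 * max a c)\<^sup>2"
    unfolding mult_2 by (intro power_mono add_mono) auto
  also have "\<dots> = 4 * (max a c)\<^sup>2"
    by (simp add: power_mult_distrib)
  also have "\<dots> \<le> 4 * (a\<^sup>2 + c\<^sup>2)"
    by (intro mult_left_mono) (auto simp: max_def)
  finally show ?thesis .
qed

lemma L2_mass_add_le:
  assumes [measurable]: "f \<in> borel_measurable borel" "g \<in> borel_measurable borel"
  shows "L2_mass (\<lambda>z. f z + g z) \<le> 4 * (L2_mass f + L2_mass g)"
proof -
  have "L2_mass (\<lambda>z. f z + g z) \<le> (\<integral>\<^sup>+z. 4 * ((f z)\<^sup>2 + (g z)\<^sup>2) \<partial>lborel)"
    unfolding L2_mass_def by (intro nn_integral_mono ennreal_add_power2_le)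
  also have "\<dots> = 4 * (L2_mass f + L2_mass g)"
    by (simp add: L2_mass_def nn_integral_cmult nn_integral_add)
  finally show ?thesis .
qed

lemma kernel_bound_add:
  fixes k l :: "'a::euclidean_space \<Rightarrow> 'a \<Rightarrow> ennreal"
  assumes k: "case_prod k \<in> borel_measurable (borel \<Otimes>\<^sub>M borel)" "kernel_bound k C"
    and l: "case_prod l \<in> borel_measurable (borel \<Otimes>\<^sub>M borel)" "kernel_bound l D"
  shows "kernel_bound (\<lambda>p q. k p q + l p q) (4 * (C + D))"
proof (rule kernel_boundI)
  note [measurable] = measurable_kernel_compose[OF k(1)] measurable_kernel_compose[OF l(1)]
  fix f g :: "'a \<Rightarrow> ennreal"
  assume fg [measurable]: "f \<in> borel_measurable borel" "g \<in> borel_measurable borel"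
  have "kernel_conv (\<lambda>p q. k p q + l p q) f g z = kernel_conv k f g z + kernel_conv l f g z" for z
    unfolding kernel_conv_def distrib_right by (rule nn_integral_add) measurable
  then have "L2_mass (kernel_conv (\<lambda>p q. k p q + l p q) f g)
    = L2_mass (\<lambda>z. kernel_conv k f g z + kernel_conv l f g z)"
    by (simp add: L2_mass_def)
  also have "\<dots> \<le> 4 * (L2_mass (kernel_conv k f g) + L2_mass (kernel_conv l f g))"
    by (intro L2_mass_add_le kernel_conv_measurable k(1) l(1) fg)
  also have "\<dots> \<le> 4 * (C * (L2_mass f * L2_mass g) + D * (L2_mass f * L2_mass g))"
    by (intro mult_left_mono add_mono kernel_boundD k(2) l(2) fg) simp
  finally show "L2_mass (kernel_conv (\<lambda>p q. k p q + l p q) f g) \<le> 4 * (C + D) * (L2_mass f * L2_mass g)"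
    by (simp only: distrib_right mult.assoc)
qed

lemma bounded_kernel_add:
  fixes k l :: "'a::euclidean_space \<Rightarrow> 'a \<Rightarrow> ennreal"
  assumes k: "bounded_kernel k" and l: "bounded_kernel l"
  shows "bounded_kernel (\<lambda>p q. k p q + l p q)"
proof -
  note measurables = bounded_kernel_measurable[OF k] bounded_kernel_measurable[OF l]
  note [measurable] = measurables[THEN measurable_kernel_compose]
  obtain C where "C < \<infinity>" and k_bound: "kernel_bound k C"
    using k by (rule bounded_kernelE)
  obtain D where "D < \<infinity>" and l_bound: "kernel_bound l D"
    using l by (rule bounded_kernelE)
  show ?thesis
  proof (rule bounded_kernelI)
    show "4 * (C + D) < \<infinity>"
      using \<open>C < \<infinity>\<close> \<open>D < \<infinity>\<close> by (simp add: ennreal_mult_less_top)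
    show "kernel_bound (\<lambda>p q. k p q + l p q) (4 * (C + D))"
      by (intro kernel_bound_add measurables k_bound l_bound)
  qed measurable
qed

lemma bounded_kernel_of_output_bound:
  fixes k :: "'a::euclidean_space \<Rightarrow> 'a \<Rightarrow> ennreal"
  assumes k: "case_prod k \<in> borel_measurable (borel \<Otimes>\<^sub>M borel)" and "C < \<infinity>"
    and mass: "\<And>z. (\<integral>\<^sup>+w. (k w (z - w))\<^sup>2 \<partial>lborel) \<le> C"
  shows "bounded_kernel k"
proof (rule bounded_kernelI[OF k \<open>C < \<infinity>\<close> kernel_boundI])
  note [measurable] = measurable_kernel_compose[OF k]
  fix f g :: "'a \<Rightarrow> ennreal"
  assume [measurable]: "f \<in> borel_measurable borel" "g \<in> borel_measurable borel"
  have "(kernel_conv k f g z)\<^sup>2 \<le> C * (\<integral>\<^sup>+w. (f w)\<^sup>2 * (g (z - w))\<^sup>2 \<partial>lborel)" for z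
  proof -
    have "(kernel_conv k f g z)\<^sup>2 \<le> (\<integral>\<^sup>+w. (k w (z - w))\<^sup>2 \<partial>lborel) * (\<integral>\<^sup>+w. (f w * g (z - w))\<^sup>2 \<partial>lborel)"
      unfolding kernel_conv_def by (intro Cauchy_Schwarz_nn_integral) measurable
    also have "\<dots> \<le> C * (\<integral>\<^sup>+w. (f w * g (z - w))\<^sup>2 \<partial>lborel)"
      by (intro mult_right_mono mass) simp
    finally show ?thesis by (simp add: power_mult_distrib)
  qed
  then have "L2_mass (kernel_conv k f g) \<le> (\<integral>\<^sup>+z. C * (\<integral>\<^sup>+w. (f w)\<^sup>2 * (g (z - w))\<^sup>2 \<partial>lborel) \<partial>lborel)"
    unfolding L2_mass_def by (rule nn_integral_mono)
  also have "\<dots> = C * (\<integral>\<^sup>+z. \<integral>\<^sup>+w. (f w)\<^sup>2 * (g (z - w))\<^sup>2 \<partial>lborel \<partial>lborel)"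
    by (rule nn_integral_cmult) measurable
  also have "(\<integral>\<^sup>+z. \<integral>\<^sup>+w. (f w)\<^sup>2 * (g (z - w))\<^sup>2 \<partial>lborel \<partial>lborel) = (\<integral>\<^sup>+w. \<integral>\<^sup>+z. (f w)\<^sup>2 * (g (z - w))\<^sup>2 \<partial>lborel \<partial>lborel)"
    by (rule lborel_pair.Fubini') measurable
  also have "\<dots> = (\<integral>\<^sup>+w. (f w)\<^sup>2 * L2_mass g \<partial>lborel)"
    using nn_integral_lborel_minus_const[of "\<lambda>z. (g z)\<^sup>2"] by (simp add: nn_integral_cmult L2_mass_def)
  also have "\<dots> = L2_mass f * L2_mass g"
    unfolding L2_mass_def by (rule nn_integral_multc) measurable
  finally show "L2_mass (kernel_conv k f g) \<le> C * (L2_mass f * L2_mass g)" .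
qed

lemma bounded_kernel_of_input_bound:
  fixes k :: "'a::euclidean_space \<Rightarrow> 'a \<Rightarrow> ennreal"
  assumes k: "case_prod k \<in> borel_measurable (borel \<Otimes>\<^sub>M borel)" and "C < \<infinity>"
    and mass: "\<And>p. (\<integral>\<^sup>+q. (k p q)\<^sup>2 \<partial>lborel) \<le> C"
  shows "bounded_kernel k"
proof (rule bounded_kernelI[OF k \<open>C < \<infinity>\<close> kernel_boundI])
  note [measurable] = measurable_kernel_compose[OF k]
  fix f g :: "'a \<Rightarrow> ennreal"
  assume [measurable]: "f \<in> borel_measurable borel" "g \<in> borel_measurable borel"
  have "(kernel_conv k f g z)\<^sup>2 \<le> (\<integral>\<^sup>+w. (f w)\<^sup>2 * (k w (z - w))\<^sup>2 \<partial>lborel) * L2_mass g" for z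
  proof -
    have "(\<integral>\<^sup>+w. (f w * k w (z - w)) * g (z - w) \<partial>lborel)\<^sup>2
      \<le> (\<integral>\<^sup>+w. (f w * k w (z - w))\<^sup>2 \<partial>lborel) * (\<integral>\<^sup>+w. (g (z - w))\<^sup>2 \<partial>lborel)"
      by (intro Cauchy_Schwarz_nn_integral) measurable
    also have "(\<integral>\<^sup>+w. (g (z - w))\<^sup>2 \<partial>lborel) = L2_mass g"
      unfolding L2_mass_def by (rule nn_integral_lborel_const_minus) measurable
    finally show ?thesis
      by (simp add: kernel_conv_def power_mult_distrib mult_ac)
  qed
  then have "L2_mass (kernel_conv k f g) \<le> (\<integral>\<^sup>+z. (\<integral>\<^sup>+w. (f w)\<^sup>2 * (k w (z - w))\<^sup>2 \<partial>lborel) * L2_mass g \<partial>lborel)"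
    unfolding L2_mass_def[of "kernel_conv k f g"] by (rule nn_integral_mono)
  also have "\<dots> = (\<integral>\<^sup>+z. \<integral>\<^sup>+w. (f w)\<^sup>2 * (k w (z - w))\<^sup>2 \<partial>lborel \<partial>lborel) * L2_mass g"
    by (rule nn_integral_multc) measurable
  also have "\<dots> \<le> C * L2_mass f * L2_mass g"
  proof (rule mult_right_mono)
    have "(\<integral>\<^sup>+z. \<integral>\<^sup>+w. (f w)\<^sup>2 * (k w (z - w))\<^sup>2 \<partial>lborel \<partial>lborel) = (\<integral>\<^sup>+w. \<integral>\<^sup>+z. (f w)\<^sup>2 * (k w (z - w))\<^sup>2 \<partial>lborel \<partial>lborel)"
      by (rule lborel_pair.Fubini') measurable
    also have "\<dots> = (\<integral>\<^sup>+w. (f w)\<^sup>2 * (\<integral>\<^sup>+q. (k w q)\<^sup>2 \<partial>lborel) \<partial>lborel)"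
      using nn_integral_lborel_minus_const[of "\<lambda>q. (k w q)\<^sup>2" for w] by (simp add: nn_integral_cmult)
    also have "\<dots> \<le> (\<integral>\<^sup>+w. (f w)\<^sup>2 * C \<partial>lborel)"
      by (intro nn_integral_mono mult_left_mono mass) simp
    also have "\<dots> = C * L2_mass f"
      by (simp add: L2_mass_def nn_integral_cmult mult.commute)
    finally show "(\<integral>\<^sup>+z. \<integral>\<^sup>+w. (f w)\<^sup>2 * (k w (z - w))\<^sup>2 \<partial>lborel \<partial>lborel) \<le> C * L2_mass f" .
  qed simp
  finally show "L2_mass (kernel_conv k f g) \<le> C * (L2_mass f * L2_mass g)"
    by (simp add: mult.assoc)
qed

section \<open>Boundedness of the interaction kernel\<close>

lemma borel_measurable_fst [measurable]:
  "fst \<in> borel_measurable (borel :: ('a::second_countable_topology \<times> 'b::second_countable_topology) measure)"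
  by (intro borel_measurable_continuous_onI continuous_intros)

lemma borel_measurable_snd [measurable]:
  "snd \<in> borel_measurable (borel :: ('a::second_countable_topology \<times> 'b::second_countable_topology) measure)"
  by (intro borel_measurable_continuous_onI continuous_intros)

lemma nn_integral_lborel_plane:
  fixes f :: "real \<times> real \<Rightarrow> ennreal"
  assumes "f \<in> borel_measurable borel"
  shows "(\<integral>\<^sup>+w. f w \<partial>lborel) = (\<integral>\<^sup>+y. \<integral>\<^sup>+r. f (r, y) \<partial>lborel \<partial>lborel)"
  using assms by (simp add: lborel_pair.nn_integral_snd lborel_prod)

lemma ennreal_sqrt_power2: "0 \<le> a \<Longrightarrow> (ennreal (sqrt a))\<^sup>2 = ennreal a"
  by (simp add: ennreal_power)

lemma Xweight_measurable [measurable]: "Xweight \<alpha> s \<omega> b \<in> borel_measurable borel"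
proof -
  have "Xweight \<alpha> s \<omega> b = (\<lambda>p. \<bar>snd p\<bar> powr (-2 * \<omega>) * jb (snd p) powr (2 * s - 2 * \<alpha> * \<omega>)
      * jb (\<bar>fst p\<bar> + \<bar>snd p\<bar> powr (1 + \<alpha>)) powr (2 * \<omega>)
      * jb (fst p - snd p * \<bar>snd p\<bar> powr \<alpha>) powr (2 * b))"
    by (auto simp: Xweight_def)
  then show ?thesis by simp
qed

lemma Xweight_nonneg [simp]: "0 \<le> Xweight \<alpha> s \<omega> b p"
  by (simp add: Xweight_def split: prod.split)

context dispersion_params
begin

definition decay_mass :: ennreal where
  "decay_mass = (\<integral>\<^sup>+v. ennreal (jb v powr - (2 * b)) \<partial>lborel)"

lemma decay_mass_finite: "decay_mass < \<infinity>"
  unfolding decay_mass_def using eps by (intro nn_integral_jb_powr_neg_finite) (simp add: b_def)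

lemma modulation_decay_measurable [measurable]: "modulation_decay \<in> borel_measurable borel"
  unfolding modulation_decay_def[abs_def] by measurable

lemma low_frequency_tail_measurable [measurable (raw)]:
  assumes [measurable]: "f \<in> borel_measurable M" "g \<in> borel_measurable M"
  shows "(\<lambda>p. low_frequency_tail (f p) (g p)) \<in> borel_measurable M"
  unfolding low_frequency_tail_def by measurable

lemma modulation_decay_minus: "modulation_decay (- p) = modulation_decay p"
  using jb_minus[of "fst p - phase \<alpha> (snd p)"] by (simp add: modulation_decay_def)

lemma nn_integral_modulation_decay_padded_slope_le:
  "(\<integral>\<^sup>+w. ennreal (modulation_decay w * modulation_decay (z - w) * padded_slope \<alpha> (snd z) (snd w)) \<partial>lborel)
    \<le> ennreal (2 powr (2 * b)) * (2 * decay_mass) * (2 * decay_mass + 1)"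
proof -
  obtain t x where z_eq: "z = (t, x)" by (cases z)
  let ?C = "ennreal (2 powr (2 * b)) * (2 * decay_mass)"
  let ?f = "\<lambda>v. jb (t - v) powr - (2 * b)"
  have inner: "(\<integral>\<^sup>+r. ennreal (modulation_decay (r, y) * modulation_decay (z - (r, y)) * padded_slope \<alpha> x y) \<partial>lborel)
    \<le> ?C * ennreal (?f (phase \<alpha> y + phase \<alpha> (x - y)) * padded_slope \<alpha> x y)" for y
  proof -
    have "modulation_decay (r, y) * modulation_decay (z - (r, y))
      = jb (r - phase \<alpha> y) powr - (2 * b) * jb ((t - phase \<alpha> (x - y)) - r) powr - (2 * b)" for r
      by (simp add: z_eq modulation_decay_def algebra_simps)
    then have "(\<integral>\<^sup>+r. ennreal (modulation_decay (r, y) * modulation_decay (z - (r, y)) * padded_slope \<alpha> x y) \<partial>lborel)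
      = (\<integral>\<^sup>+r. ennreal (jb (r - phase \<alpha> y) powr - (2 * b) * jb ((t - phase \<alpha> (x - y)) - r) powr - (2 * b)) \<partial>lborel) *
        ennreal (padded_slope \<alpha> x y)"
      using padded_slope_nonneg[of \<alpha> x y] alpha by (simp add: ennreal_mult nn_integral_multc[symmetric])
    also have "\<dots> \<le> ?C * ennreal (jb ((t - phase \<alpha> (x - y)) - phase \<alpha> y) powr - (2 * b)) *
        ennreal (padded_slope \<alpha> x y)"
      unfolding decay_mass_def using exponent_bounds by (intro mult_right_mono nn_integral_jb_convolution_le) auto
    also have "\<dots> = ?C * ennreal (?f (phase \<alpha> y + phase \<alpha> (x - y)) * padded_slope \<alpha> x y)"
      using padded_slope_nonneg[of \<alpha> x y] alpha by (simp add: ennreal_mult mult.assoc algebra_simps)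
    finally show ?thesis .
  qed
  have "(\<integral>\<^sup>+w. ennreal (modulation_decay w * modulation_decay (z - w) * padded_slope \<alpha> (snd z) (snd w)) \<partial>lborel)
    = (\<integral>\<^sup>+y. \<integral>\<^sup>+r. ennreal (modulation_decay (r, y) * modulation_decay (z - (r, y)) *
        padded_slope \<alpha> x y) \<partial>lborel \<partial>lborel)"
    by (subst nn_integral_lborel_plane) (simp_all add: z_eq)
  also have "\<dots> \<le> (\<integral>\<^sup>+y. ?C * ennreal (?f (phase \<alpha> y + phase \<alpha> (x - y)) * padded_slope \<alpha> x y) \<partial>lborel)"
    by (intro nn_integral_mono inner)
  also have "\<dots> = ?C * (\<integral>\<^sup>+y. ennreal (?f (phase \<alpha> y + phase \<alpha> (x - y)) * padded_slope \<alpha> x y) \<partial>lborel)"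
    by (rule nn_integral_cmult) measurable
  also have "\<dots> \<le> ?C * (2 * (\<integral>\<^sup>+v. ennreal (?f v) \<partial>lborel) + 1)"
    using alpha exponent_bounds by (intro mult_left_mono nn_integral_padded_slope_le jb_powr_nonpos_le_1) auto
  also have "(\<integral>\<^sup>+v. ennreal (?f v) \<partial>lborel) = decay_mass"
    unfolding decay_mass_def by (rule nn_integral_lborel_const_minus) measurable
  finally show ?thesis .
qed

lemma nn_integral_low_frequency_tail_le: "(\<integral>\<^sup>+y. ennreal (low_frequency_tail x y) \<partial>lborel) \<le> decay_mass"
proof (cases "x = 0")
  case True
  then show ?thesis by (simp add: low_frequency_tail_def)
next
  case False
  let ?c = "\<bar>x\<bar> powr \<alpha>"
  have "0 < ?c" using False by simp
  have tail: "low_frequency_tail x y = ?c * jb (0 + ?c * y) powr - (2 * b)" for y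
    using jb_abs[of "?c * y"] by (simp add: low_frequency_tail_def abs_mult mult.commute)
  have "decay_mass = ennreal \<bar>?c\<bar> * (\<integral>\<^sup>+y. ennreal (jb (0 + ?c * y) powr - (2 * b)) \<partial>lborel)"
    unfolding decay_mass_def using \<open>0 < ?c\<close> by (intro nn_integral_real_affine) auto
  also have "\<dots> = (\<integral>\<^sup>+y. ennreal (low_frequency_tail x y) \<partial>lborel)"
    unfolding tail by (simp add: ennreal_mult nn_integral_cmult)
  finally show ?thesis by simp
qed

lemma nn_integral_tail_part_le: "(\<integral>\<^sup>+w. ennreal (tail_part w (z - w)) \<partial>lborel) \<le> decay_mass * decay_mass"
proof -
  have [measurable]: "(\<lambda>w. ennreal (tail_part w (z - w))) \<in> borel_measurable borel"
    unfolding tail_part_def by measurable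
  have "(\<integral>\<^sup>+r. ennreal (jb (r - phase \<alpha> y) powr - (2 * b)) \<partial>lborel) = decay_mass" for y
    unfolding decay_mass_def by (rule nn_integral_lborel_minus_const) measurable
  then have "(\<integral>\<^sup>+w. ennreal (tail_part w (z - w)) \<partial>lborel)
    = (\<integral>\<^sup>+y. decay_mass * ennreal (low_frequency_tail (snd z) (snd z - y)) \<partial>lborel)"
    by (subst nn_integral_lborel_plane)
      (simp_all add: tail_part_def modulation_decay_def ennreal_mult nn_integral_multc)
  also have "\<dots> = decay_mass * (\<integral>\<^sup>+y. ennreal (low_frequency_tail (snd z) (snd z - y)) \<partial>lborel)"
    by (rule nn_integral_cmult) measurable
  also have "(\<integral>\<^sup>+y. ennreal (low_frequency_tail (snd z) (snd z - y)) \<partial>lborel)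
    = (\<integral>\<^sup>+y. ennreal (low_frequency_tail (snd z) y) \<partial>lborel)"
    by (rule nn_integral_lborel_const_minus) measurable
  finally show ?thesis
    using nn_integral_low_frequency_tail_le by (simp add: mult_left_mono)
qed

lemma bounded_kernel_output_part: "bounded_kernel (\<lambda>p q. ennreal (sqrt (output_part p q)))"
proof (rule bounded_kernel_of_output_bound)
  show "(\<lambda>(p, q). ennreal (sqrt (output_part p q))) \<in> borel_measurable (borel \<Otimes>\<^sub>M borel)"
    unfolding output_part_def by measurable
  show "(\<integral>\<^sup>+w. (ennreal (sqrt (output_part w (z - w))))\<^sup>2 \<partial>lborel)
    \<le> ennreal (2 powr (2 * b)) * (2 * decay_mass) * (2 * decay_mass + 1)" for z
    unfolding ennreal_sqrt_power2[OF output_part_nonneg]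
    using nn_integral_modulation_decay_padded_slope_le[of z] by (simp add: output_part_def)
qed (use decay_mass_finite in \<open>simp add: ennreal_mult_less_top\<close>)

lemma bounded_kernel_input_part: "bounded_kernel (\<lambda>p q. ennreal (sqrt (input_part p q)))"
proof (rule bounded_kernel_of_input_bound)
  show "(\<lambda>(p, q). ennreal (sqrt (input_part p q))) \<in> borel_measurable (borel \<Otimes>\<^sub>M borel)"
    unfolding input_part_def by measurable
  show "(\<integral>\<^sup>+q. (ennreal (sqrt (input_part p q)))\<^sup>2 \<partial>lborel)
    \<le> ennreal (2 powr (2 * b)) * (2 * decay_mass) * (2 * decay_mass + 1)" for p
  proof -
    have [measurable]: "(\<lambda>q. ennreal (input_part p q)) \<in> borel_measurable borel"
      unfolding input_part_def by measurable
    have "(\<integral>\<^sup>+q. ennreal (input_part p q) \<partial>lborel) = (\<integral>\<^sup>+z. ennreal (input_part p (z - p)) \<partial>lborel)"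
      by (rule nn_integral_lborel_minus_const[symmetric]) measurable
    also have "\<dots> = (\<integral>\<^sup>+z. ennreal (modulation_decay z * modulation_decay (p - z) *
        padded_slope \<alpha> (snd p) (snd z)) \<partial>lborel)"
      using modulation_decay_minus[of "p - z" for z] by (simp add: input_part_def)
    finally show ?thesis
      using nn_integral_modulation_decay_padded_slope_le[of p] by (simp add: ennreal_sqrt_power2)
  qed
qed (use decay_mass_finite in \<open>simp add: ennreal_mult_less_top\<close>)

lemma bounded_kernel_tail_part: "bounded_kernel (\<lambda>p q. ennreal (sqrt (tail_part p q)))"
proof (rule bounded_kernel_of_output_bound)
  show "(\<lambda>(p, q). ennreal (sqrt (tail_part p q))) \<in> borel_measurable (borel \<Otimes>\<^sub>M borel)"
    unfolding tail_part_def by measurable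
  show "(\<integral>\<^sup>+w. (ennreal (sqrt (tail_part w (z - w))))\<^sup>2 \<partial>lborel) \<le> decay_mass * decay_mass" for z
    using nn_integral_tail_part_le by (simp add: ennreal_sqrt_power2)
qed (use decay_mass_finite in \<open>simp add: ennreal_mult_less_top\<close>)

definition kernel :: "real \<times> real \<Rightarrow> real \<times> real \<Rightarrow> real" where
  "kernel p q = sqrt (kernel_sq p q)"

lemma kernel_nonneg [simp]: "0 \<le> kernel p q"
  by (simp add: kernel_def kernel_sq_def)

lemma kernel_le_sqrt_parts:
  "kernel p q \<le> sqrt 18874368 * (sqrt (output_part p q) + sqrt (input_part p q) + sqrt (input_part q p)
    + sqrt (tail_part p q) + sqrt (tail_part q p))"
proof -
  have subadd: "sqrt (a + c) \<le> d + sqrt c" if "sqrt a \<le> d" "0 \<le> a" "0 \<le> c" for a c d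
    using sqrt_add_le_add_sqrt[OF that(2,3)] that(1) by linarith
  have "kernel p q \<le> sqrt 18874368 * sqrt (majorant p q)"
    unfolding kernel_def real_sqrt_mult[symmetric] using kernel_sq_le_majorant by (rule real_sqrt_le_mono)
  also have "sqrt (majorant p q) \<le> sqrt (output_part p q) + sqrt (input_part p q) + sqrt (input_part q p)
    + sqrt (tail_part p q) + sqrt (tail_part q p)"
    unfolding majorant_def by (intro subadd) auto
  finally show ?thesis by simp
qed

lemma bounded_kernel_kernel: "bounded_kernel (\<lambda>p q. ennreal (kernel p q))"
proof (rule bounded_kernel_mono)
  let ?parts = "\<lambda>p q. ennreal (sqrt (output_part p q)) + ennreal (sqrt (input_part p q)) +
    ennreal (sqrt (input_part q p)) + ennreal (sqrt (tail_part p q)) + ennreal (sqrt (tail_part q p))"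
  show "bounded_kernel (\<lambda>p q. ennreal (sqrt 18874368) * ?parts p q)"
    by (intro bounded_kernel_cmult bounded_kernel_add bounded_kernel_output_part bounded_kernel_input_part
        bounded_kernel_tail_part bounded_kernel_commute[OF bounded_kernel_input_part]
        bounded_kernel_commute[OF bounded_kernel_tail_part]) simp
  show "(\<lambda>(p, q). ennreal (kernel p q)) \<in> borel_measurable (borel \<Otimes>\<^sub>M borel)"
    unfolding kernel_def kernel_sq_def by measurable
  show "ennreal (kernel p q) \<le> ennreal (sqrt 18874368) * ?parts p q" for p q
    using kernel_le_sqrt_parts[of p q]
    by (simp add: ennreal_plus[symmetric] ennreal_mult[symmetric] ennreal_leI del: ennreal_plus)
qed

end

section \<open>Fourier transform of a product\<close>

lemma cis_measurable [measurable]: "cis \<in> borel_measurable borel"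
  by (intro borel_measurable_continuous_onI continuous_intros)

lemma (in pair_sigma_finite) integrable_mult_tensor:
  fixes F :: "'a \<Rightarrow> complex" and G :: "'b \<Rightarrow> complex"
  assumes F: "integrable M1 F" and G: "integrable M2 G"
    and [measurable]: "case_prod h \<in> borel_measurable (M1 \<Otimes>\<^sub>M M2)" and h_le: "\<And>p q. cmod (h p q) \<le> 1"
  shows "integrable (M1 \<Otimes>\<^sub>M M2) (\<lambda>(p, q). h p q * (F p * G q))"
proof (rule Bochner_Integration.integrable_bound)
  have [measurable]: "F \<in> borel_measurable M1" "G \<in> borel_measurable M2"
    using F G by auto
  show "integrable (M1 \<Otimes>\<^sub>M M2) (\<lambda>(p, q). F p * G q)"
    using F G by (intro Fubini_integrable) (simp_all add: norm_mult)
  show "(\<lambda>(p, q). h p q * (F p * G q)) \<in> borel_measurable (M1 \<Otimes>\<^sub>M M2)"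
    by measurable
  show "AE x in M1 \<Otimes>\<^sub>M M2. cmod (case x of (p, q) \<Rightarrow> h p q * (F p * G q)) \<le> cmod (case x of (p, q) \<Rightarrow> F p * G q)"
    by (rule AE_I2) (simp add: norm_mult h_le mult_left_le_one_le split: prod.split)
qed

lemma integral_cis_exchange:
  fixes F G :: "'a::euclidean_space \<Rightarrow> complex"
  assumes F: "integrable lborel F" and G: "integrable lborel G"
  shows "(LINT w|lborel. F w * (LINT p|lborel. cis (r * (p \<bullet> w)) * G p))
    = (LINT p|lborel. (LINT w|lborel. cis (r * (p \<bullet> w)) * F w) * G p)"
proof -
  have kernel: "integrable (lborel \<Otimes>\<^sub>M lborel) (\<lambda>(w, p). cis (r * (p \<bullet> w)) * (F w * G p))"
    by (rule lborel_pair.integrable_mult_tensor[OF F G]) auto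
  have "(LINT w|lborel. F w * (LINT p|lborel. cis (r * (p \<bullet> w)) * G p))
    = (LINT w|lborel. LINT p|lborel. cis (r * (p \<bullet> w)) * (F w * G p))"
    unfolding integral_mult_right_zero[symmetric] by (simp only: mult_ac)
  also have "\<dots> = (LINT p|lborel. LINT w|lborel. cis (r * (p \<bullet> w)) * (F w * G p))"
    by (rule lborel_pair.Fubini_integral[OF kernel, symmetric])
  also have "\<dots> = (LINT p|lborel. (LINT w|lborel. cis (r * (p \<bullet> w)) * F w) * G p)"
    unfolding integral_mult_left_zero[symmetric] by (simp only: mult_ac)
  finally show ?thesis .
qed

lemma integral_lborel_scale:
  fixes f :: "'a::euclidean_space \<Rightarrow> complex"
  assumes [measurable]: "f \<in> borel_measurable borel" and c: "0 < c"
  shows "(LINT p|lborel. f p) = complex_of_real (c ^ DIM('a)) * (LINT y|lborel. f (q - c *\<^sub>R y))"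
proof -
  have affine: "(lborel :: 'a measure)
    = density (distr lborel borel (\<lambda>y. q + (- c) *\<^sub>R y)) (\<lambda>_. ennreal (c ^ DIM('a)))"
    using lborel_affine[of "- c" q] c by simp
  have "(LINT p|lborel. f p)
    = (LINT p|density (distr lborel borel (\<lambda>y. q + (- c) *\<^sub>R y)) (\<lambda>_. ennreal (c ^ DIM('a))). f p)"
    using affine by (rule arg_cong)
  also have "\<dots> = (LINT p|distr lborel borel (\<lambda>y. q + (- c) *\<^sub>R y). c ^ DIM('a) *\<^sub>R f p)"
    using c by (intro integral_density) auto
  also have "\<dots> = (LINT y|lborel. c ^ DIM('a) *\<^sub>R f (q + (- c) *\<^sub>R y))"
    by (intro integral_distr) auto
  finally show ?thesis by (simp add: scaleR_conv_of_real)
qed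

definition gauss :: "real \<Rightarrow> 'a::real_inner \<Rightarrow> complex" where
  "gauss c w = complex_of_real (exp (- (c\<^sup>2 * (w \<bullet> w)) / 2))"

lemma gauss_measurable [measurable]:
  "gauss c \<in> borel_measurable (borel :: 'a::{real_inner, second_countable_topology} measure)"
  unfolding gauss_def[abs_def] by measurable

lemma cmod_gauss_le_1: "cmod (gauss c w) \<le> 1"
  by (simp add: gauss_def)

lemma of_real_cmod_gauss: "complex_of_real (cmod (gauss c w)) = gauss c w"
  by (simp add: gauss_def)

lemma gauss_scaleR: "gauss c (d *\<^sub>R w) = gauss (c * d) w"
  by (simp add: gauss_def power_mult_distrib power2_eq_square mult_ac)

lemma gauss_Pair: "gauss c (a, d) = gauss c a * gauss c d"
  by (simp add: gauss_def inner_prod_def distrib_left add_divide_distrib diff_divide_distrib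
      of_real_mult[symmetric] exp_add[symmetric] del: of_real_mult)

lemma gauss_1_eq_density: "gauss 1 y = complex_of_real (sqrt (2 * pi)) * complex_of_real (std_normal_density y)"
  by (simp add: gauss_def std_normal_density_def power2_eq_square)

lemma fourier_gauss_1_real:
  "(LINT y|lborel. cis (v * y) * gauss 1 y) = complex_of_real (sqrt (2 * pi)) * gauss 1 v"
proof -
  have "(LINT y|lborel. cis (v * y) * gauss 1 y)
    = (LINT y|lborel. complex_of_real (sqrt (2 * pi)) * (std_normal_density y *\<^sub>R cis (v * y)))"
    unfolding gauss_1_eq_density by (simp only: scaleR_conv_of_real mult_ac)
  also have "\<dots> = complex_of_real (sqrt (2 * pi)) * (LINT y|lborel. std_normal_density y *\<^sub>R cis (v * y))"
    by (rule integral_mult_right_zero)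
  also have "(LINT y|lborel. std_normal_density y *\<^sub>R cis (v * y)) = char std_normal_distribution v"
    unfolding char_def by (subst integral_density) (auto simp: cis_conv_exp)
  also have "\<dots> = gauss 1 v"
    by (simp add: char_std_normal_distribution gauss_def power2_eq_square)
  finally show ?thesis .
qed

lemma integrable_gauss_real:
  assumes "0 < c"
  shows "integrable lborel (gauss c :: real \<Rightarrow> complex)"
proof -
  have "integrable lborel (\<lambda>y. complex_of_real (sqrt (2 * pi)) * complex_of_real (std_normal_density y))"
    by (intro integrable_mult_right integrable_of_real) simp
  then have "integrable lborel (gauss 1 :: real \<Rightarrow> complex)"
    unfolding gauss_1_eq_density[symmetric] .
  then have "integrable lborel (\<lambda>u::real. gauss 1 (0 + c * u))"
    using assms by (intro lborel_integrable_real_affine) auto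
  then show ?thesis
    using gauss_scaleR[of 1 c "u :: real" for u] by simp
qed

lemma fourier_gauss_real:
  assumes "0 < c"
  shows "(LINT u|lborel. cis (v * u) * gauss c u) = complex_of_real (sqrt (2 * pi) / c) * gauss (1 / c) v"
proof -
  have "complex_of_real (sqrt (2 * pi)) * gauss 1 (v / c) = (LINT y|lborel. cis ((v / c) * y) * gauss 1 y)"
    by (rule fourier_gauss_1_real[symmetric])
  also have "\<dots> = \<bar>c\<bar> *\<^sub>R (LINT u|lborel. cis ((v / c) * (0 + c * u)) * gauss 1 (0 + c * u))"
    using assms by (intro lborel_integral_real_affine) auto
  also have "\<dots> = complex_of_real c * (LINT u|lborel. cis (v * u) * gauss c u)"
    using assms gauss_scaleR[of 1 c "u :: real" for u] by (simp add: scaleR_conv_of_real)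
  finally show ?thesis
    using assms gauss_scaleR[of 1 "1 / c" v] by (simp add: field_simps)
qed

lemma integrable_gauss_plane:
  assumes "0 < c"
  shows "integrable lborel (gauss c :: real \<times> real \<Rightarrow> complex)"
proof -
  have "integrable (lborel \<Otimes>\<^sub>M lborel) (\<lambda>(a::real, d::real). 1 * (gauss c a * gauss c d))"
    using assms by (intro lborel_pair.integrable_mult_tensor integrable_gauss_real) auto
  then show ?thesis
    unfolding lborel_prod
    by (rule Bochner_Integration.integrable_cong[THEN iffD1, rotated 2]) (auto simp: gauss_Pair)
qed

lemma fourier_gauss_plane:
  fixes v :: "real \<times> real"
  assumes "0 < c"
  shows "(LINT w|lborel. cis (v \<bullet> w) * gauss c w) = complex_of_real (2 * pi / c\<^sup>2) * gauss (1 / c) v"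
proof -
  have "integrable lborel (\<lambda>w. cis (v \<bullet> w) * gauss c w)"
    by (rule Bochner_Integration.integrable_bound[OF integrable_gauss_plane[OF assms]]) (auto simp: norm_mult)
  then have "integrable (lborel \<Otimes>\<^sub>M lborel) (\<lambda>w. cis (v \<bullet> w) * gauss c w)"
    unfolding lborel_prod .
  from lborel_pair.integral_fst'[OF this]
  have "(LINT w|lborel. cis (v \<bullet> w) * gauss c w)
    = (LINT a|lborel. LINT d|lborel. cis (v \<bullet> (a, d)) * gauss c (a, d))"
    by (simp add: lborel_prod)
  also have "\<dots> = (LINT a|lborel. LINT d|lborel. (cis (fst v * a) * gauss c a) * (cis (snd v * d) * gauss c d))"
    by (simp add: gauss_Pair inner_prod_def cis_mult[symmetric] mult_ac)
  also have "\<dots> = (LINT a|lborel. cis (fst v * a) * gauss c a) * (LINT d|lborel. cis (snd v * d) * gauss c d)"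
    by simp
  also have "\<dots> = complex_of_real (sqrt (2 * pi) / c * (sqrt (2 * pi) / c)) *
      (gauss (1 / c) (fst v) * gauss (1 / c) (snd v))"
    unfolding fourier_gauss_real[OF assms] by (simp only: of_real_mult mult_ac)
  also have "gauss (1 / c) (fst v) * gauss (1 / c) (snd v) = gauss (1 / c) v"
    by (simp add: gauss_Pair[symmetric])
  also have "sqrt (2 * pi) / c * (sqrt (2 * pi) / c) = 2 * pi / c\<^sup>2"
    by (simp add: power2_eq_square)
  finally show ?thesis .
qed

lemma fourier2_eq: "fourier2 f w = complex_of_real (1 / (2 * pi)) * (LINT p|lborel. cis (- 1 * (p \<bullet> w)) * f p)"
  by (simp add: fourier2_def inner_prod_def case_prod_beta)

lemma fourier2_measurable [measurable]:
  assumes [measurable]: "f \<in> borel_measurable borel"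
  shows "fourier2 f \<in> borel_measurable borel"
  unfolding fourier2_eq[abs_def] by measurable

lemma cmod_fourier2_le: "cmod (fourier2 f w) \<le> (1 / (2 * pi)) * (LINT p|lborel. cmod (f p))"
proof -
  have "cmod (LINT p|lborel. cis (- 1 * (p \<bullet> w)) * f p) \<le> (LINT p|lborel. cmod (cis (- 1 * (p \<bullet> w)) * f p))"
    by (rule integral_norm_bound)
  moreover have "cmod (complex_of_real (1 / (2 * pi))) = 1 / (2 * pi)"
    unfolding norm_of_real by simp
  ultimately show ?thesis
    unfolding fourier2_eq norm_mult by (auto simp: norm_mult intro!: divide_right_mono)
qed

lemma integrable_gauss_fourier2:
  assumes "0 < c" and [measurable]: "f \<in> borel_measurable borel"
  shows "integrable lborel (\<lambda>w. gauss c w * fourier2 f w)"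
proof (rule Bochner_Integration.integrable_bound)
  let ?B = "(1 / (2 * pi)) * (LINT p|lborel. cmod (f p))"
  show "integrable lborel (\<lambda>w. complex_of_real ?B * gauss c (w :: real \<times> real))"
    by (intro integrable_mult_right integrable_gauss_plane assms(1))
  have "cmod (fourier2 f w) \<le> \<bar>?B\<bar>" for w
    using cmod_fourier2_le[of f w] by linarith
  then show "AE w in lborel. cmod (gauss c w * fourier2 f w) \<le> cmod (complex_of_real ?B * gauss c w)"
    by (intro AE_I2) (simp only: norm_mult norm_of_real
      mult.commute[of _ "cmod (gauss c _)"] mult_left_mono norm_ge_zero)
qed measurable

text \<open>Only these means of \<open>f\<close> are recovered from its transform, so Fourier inversion is not needed.\<close>

definition gauss_mean :: "real \<Rightarrow> (real \<times> real \<Rightarrow> complex) \<Rightarrow> real \<times> real \<Rightarrow> complex" where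
  "gauss_mean c f q = (LINT y|lborel. complex_of_real (1 / (2 * pi)) * gauss 1 y * f (q - c *\<^sub>R y))"

lemma gauss_mean_measurable [measurable]:
  assumes [measurable]: "f \<in> borel_measurable borel"
  shows "gauss_mean c f \<in> borel_measurable borel"
  unfolding gauss_mean_def[abs_def] by measurable

lemma inverse_fourier_gauss_fourier2:
  assumes f: "integrable lborel f" and c: "0 < c"
  shows "complex_of_real (1 / (2 * pi)) * (LINT w|lborel. cis (q \<bullet> w) * (gauss c w * fourier2 f w))
    = gauss_mean c f q"
proof -
  have [measurable]: "f \<in> borel_measurable borel"
    using f by auto
  let ?k = "complex_of_real (1 / (2 * pi))" and ?F = "\<lambda>w. cis (q \<bullet> w) * gauss c w"
  have F: "integrable lborel ?F"
    by (rule Bochner_Integration.integrable_bound[OF integrable_gauss_plane[OF c]]) (auto simp: norm_mult)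
  have transform: "(LINT w|lborel. cis (- 1 * (p \<bullet> w)) * ?F w)
    = complex_of_real (2 * pi / c\<^sup>2) * gauss (1 / c) (q - p)" for p
    unfolding fourier_gauss_plane[OF c, symmetric] mult.assoc[symmetric] cis_mult by (simp add: inner_diff_left)
  have "(LINT w|lborel. cis (q \<bullet> w) * (gauss c w * fourier2 f w))
    = (LINT w|lborel. ?k * (?F w * (LINT p|lborel. cis (- 1 * (p \<bullet> w)) * f p)))"
    unfolding fourier2_eq by (simp only: mult_ac)
  also have "\<dots> = ?k * (LINT w|lborel. ?F w * (LINT p|lborel. cis (- 1 * (p \<bullet> w)) * f p))"
    by (rule integral_mult_right_zero)
  also have "\<dots> = ?k * (LINT p|lborel. complex_of_real (2 * pi / c\<^sup>2) * gauss (1 / c) (q - p) * f p)"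
    unfolding integral_cis_exchange[OF F f] transform ..
  also have "\<dots> = ?k * (complex_of_real (c ^ DIM(real \<times> real)) *
      (LINT y|lborel. complex_of_real (2 * pi / c\<^sup>2) * gauss (1 / c) (q - (q - c *\<^sub>R y)) * f (q - c *\<^sub>R y)))"
    by (subst integral_lborel_scale[OF _ c, where q = q]) auto
  also have "\<dots> = (LINT y|lborel. gauss 1 y * f (q - c *\<^sub>R y))"
    using c by (simp add: gauss_scaleR mult.assoc power2_eq_square)
  finally show ?thesis
    unfolding gauss_mean_def mult.assoc by (simp only: integral_mult_right_zero)
qed

lemma fourier2_gauss_mean_mult:
  assumes f: "integrable lborel f" and g: "integrable lborel g" and c: "0 < c"
  shows "fourier2 (\<lambda>q. gauss_mean c f q * g q) z
    = complex_of_real (1 / (2 * pi)) * (LINT w|lborel. gauss c w * fourier2 f w * fourier2 g (z - w))"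
proof -
  let ?k = "complex_of_real (1 / (2 * pi))" and ?F = "\<lambda>w. gauss c w * fourier2 f w"
    and ?G = "\<lambda>q. cis (- 1 * (q \<bullet> z)) * g q"
  have [measurable]: "f \<in> borel_measurable borel" "g \<in> borel_measurable borel"
    using f g by auto
  have F: "integrable lborel ?F"
    by (rule integrable_gauss_fourier2[OF c]) measurable
  have G: "integrable lborel ?G"
    by (rule Bochner_Integration.integrable_bound[OF g]) (auto simp: norm_mult)
  have translate: "fourier2 g (z - w) = ?k * (LINT q|lborel. cis (1 * (q \<bullet> w)) * ?G q)" for w
    unfolding fourier2_eq mult.assoc[symmetric] cis_mult by (simp add: inner_diff_right)
  have "(LINT w|lborel. ?F w * fourier2 g (z - w))
    = (LINT w|lborel. ?k * (?F w * (LINT q|lborel. cis (1 * (q \<bullet> w)) * ?G q)))"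
    unfolding translate by (simp only: mult_ac)
  also have "\<dots> = ?k * (LINT w|lborel. ?F w * (LINT q|lborel. cis (1 * (q \<bullet> w)) * ?G q))"
    by (rule integral_mult_right_zero)
  also have "\<dots> = ?k * (LINT q|lborel. (LINT w|lborel. cis (1 * (q \<bullet> w)) * ?F w) * ?G q)"
    unfolding integral_cis_exchange[OF F G] ..
  also have "\<dots> = (LINT q|lborel. ?k * (LINT w|lborel. cis (q \<bullet> w) * ?F w) * ?G q)"
    by (simp only: integral_mult_right_zero mult.assoc mult_1)
  also have "\<dots> = (LINT q|lborel. cis (- 1 * (q \<bullet> z)) * (gauss_mean c f q * g q))"
    unfolding inverse_fourier_gauss_fourier2[OF f c] by (simp only: mult_ac)
  finally show ?thesis
    unfolding fourier2_eq[of "\<lambda>q. gauss_mean c f q * g q"] by simp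
qed

lemma cmod_fourier2_gauss_mean_mult_le:
  assumes "integrable lborel f" and "integrable lborel g" and "0 < c"
  shows "ennreal (cmod (fourier2 (\<lambda>q. gauss_mean c f q * g q) z))
    \<le> (\<integral>\<^sup>+w. ennreal (cmod (fourier2 f w)) * ennreal (cmod (fourier2 g (z - w))) \<partial>lborel)"
proof -
  let ?h = "\<lambda>w. gauss c w * fourier2 f w * fourier2 g (z - w)"
  have "cmod (complex_of_real (1 / (2 * pi))) \<le> 1"
    unfolding norm_of_real using pi_gt3 by (simp add: field_simps)
  then have "ennreal (cmod (fourier2 (\<lambda>q. gauss_mean c f q * g q) z)) \<le> ennreal (cmod (LINT w|lborel. ?h w))"
    unfolding fourier2_gauss_mean_mult[OF assms] norm_mult by (intro ennreal_leI mult_left_le_one_le) auto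
  also have "\<dots> \<le> (\<integral>\<^sup>+w. ennreal (cmod (?h w)) \<partial>lborel)"
    by (cases "integrable lborel ?h") (simp_all add: integral_norm_bound_ennreal not_integrable_integral_eq)
  also have "\<dots> \<le> (\<integral>\<^sup>+w. ennreal (cmod (fourier2 f w)) * ennreal (cmod (fourier2 g (z - w))) \<partial>lborel)"
    unfolding norm_mult mult.assoc ennreal_mult[symmetric, OF norm_ge_zero norm_ge_zero]
    by (intro nn_integral_mono ennreal_leI mult_left_le_one_le cmod_gauss_le_1) auto
  finally show ?thesis .
qed

lemma integral_cmod_gauss_1: "(LINT y|lborel. cmod (gauss 1 (y :: real \<times> real))) = 2 * pi"
proof -
  have "complex_of_real (LINT y|lborel. cmod (gauss 1 (y :: real \<times> real)))
    = (LINT y|lborel. complex_of_real (cmod (gauss 1 (y :: real \<times> real))))"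
    by (intro integral_of_real[symmetric] integrable_norm integrable_gauss_plane) simp
  also have "\<dots> = (LINT y|lborel. gauss 1 (y :: real \<times> real))"
    by (simp only: of_real_cmod_gauss)
  also have "\<dots> = complex_of_real (2 * pi)"
    using fourier_gauss_plane[of 1 0] by (simp add: gauss_def)
  finally show ?thesis
    by (simp only: of_real_eq_iff)
qed

lemma cmod_gauss_mean_le:
  assumes f: "\<And>p. cmod (f p) \<le> B"
  shows "cmod (gauss_mean c f q) \<le> B"
proof -
  let ?k = "complex_of_real (1 / (2 * pi))"
  have "cmod (gauss_mean c f q) \<le> (LINT y|lborel. cmod (?k * gauss 1 y * f (q - c *\<^sub>R y)))"
    unfolding gauss_mean_def by (rule integral_norm_bound)
  also have "\<dots> \<le> (LINT y|lborel. B * (1 / (2 * pi)) * cmod (gauss 1 (y :: real \<times> real)))"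
  proof (rule integral_mono')
    show "integrable lborel (\<lambda>y. B * (1 / (2 * pi)) * cmod (gauss 1 (y :: real \<times> real)))"
      by (intro integrable_mult_right integrable_norm integrable_gauss_plane) simp
    fix y :: "real \<times> real"
    have "0 \<le> B"
      by (rule order_trans[OF norm_ge_zero f])
    have "cmod ?k = 1 / (2 * pi)"
      unfolding norm_of_real by simp
    then show "cmod (?k * gauss 1 y * f (q - c *\<^sub>R y)) \<le> B * (1 / (2 * pi)) * cmod (gauss 1 y)"
      unfolding norm_mult
      using mult_left_mono[OF f[of "q - c *\<^sub>R y"], of "1 / (2 * pi) * cmod (gauss 1 y)"] by (simp add: mult_ac)
    show "0 \<le> B * (1 / (2 * pi)) * cmod (gauss 1 y)"
      using \<open>0 \<le> B\<close> by simp
  qed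
  also have "\<dots> = B"
    unfolding integral_mult_right_zero integral_cmod_gauss_1 by simp
  finally show ?thesis .
qed

lemma tendsto_gauss_mean:
  assumes f: "continuous_on UNIV f" "\<And>p. cmod (f p) \<le> B" and c: "c \<longlonglongrightarrow> 0"
  shows "(\<lambda>n. gauss_mean (c n) f q) \<longlonglongrightarrow> f q"
proof -
  have [measurable]: "f \<in> borel_measurable borel"
    using f(1) by (rule borel_measurable_continuous_onI)
  let ?k = "complex_of_real (1 / (2 * pi))"
  have "cmod ?k \<le> 1"
    unfolding norm_of_real using pi_gt3 by (simp add: field_simps)
  have "(\<lambda>n. gauss_mean (c n) f q) \<longlonglongrightarrow> (LINT y|lborel. ?k * gauss 1 (y :: real \<times> real) * f q)"
    unfolding gauss_mean_def
  proof (rule integral_dominated_convergence[where w = "\<lambda>y::real \<times> real. cmod (gauss 1 y) * B"])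
    show "integrable lborel (\<lambda>y. cmod (gauss 1 (y :: real \<times> real)) * B)"
      by (intro integrable_mult_left integrable_norm integrable_gauss_plane) simp
    have "(\<lambda>n. q - c n *\<^sub>R y) \<longlonglongrightarrow> q - 0 *\<^sub>R y" for y
      by (intro tendsto_intros c)
    then have "(\<lambda>n. f (q - c n *\<^sub>R y)) \<longlonglongrightarrow> f q" for y
      by (intro continuous_on_tendsto_compose[OF f(1)]) auto
    then show "AE y in lborel. (\<lambda>n. ?k * gauss 1 y * f (q - c n *\<^sub>R y)) \<longlonglongrightarrow> ?k * gauss 1 y * f q"
      by (intro AE_I2 tendsto_intros)
    have "cmod ?k * cmod (gauss 1 y) * cmod (f (q - c n *\<^sub>R y)) \<le> 1 * cmod (gauss 1 y) * B" for n y
      using \<open>cmod ?k \<le> 1\<close> f(2) by (intro mult_mono) auto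
    then show "AE y in lborel. cmod (?k * gauss 1 y * f (q - c n *\<^sub>R y)) \<le> cmod (gauss 1 y) * B" for n
      by (intro AE_I2) (simp only: norm_mult mult_1)
  qed measurable
  also have "(LINT y|lborel. ?k * gauss 1 (y :: real \<times> real) * f q) = f q"
    using fourier_gauss_plane[of 1 0] by (simp add: gauss_def)
  finally show ?thesis .
qed

lemma tendsto_fourier2_gauss_mean_mult:
  assumes f: "continuous_on UNIV f" "\<And>p. cmod (f p) \<le> B" and g: "integrable lborel g" and c: "c \<longlonglongrightarrow> 0"
  shows "(\<lambda>n. fourier2 (\<lambda>q. gauss_mean (c n) f q * g q) z) \<longlonglongrightarrow> fourier2 (\<lambda>q. f q * g q) z"
  unfolding fourier2_eq
proof (intro tendsto_mult tendsto_const)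
  have [measurable]: "f \<in> borel_measurable borel" "g \<in> borel_measurable borel"
    using f(1) g by (auto intro: borel_measurable_continuous_onI)
  show "(\<lambda>n. LINT q|lborel. cis (- 1 * (q \<bullet> z)) * (gauss_mean (c n) f q * g q))
    \<longlonglongrightarrow> (LINT q|lborel. cis (- 1 * (q \<bullet> z)) * (f q * g q))"
  proof (rule integral_dominated_convergence[where w = "\<lambda>q. B * cmod (g q)"])
    show "integrable lborel (\<lambda>q. B * cmod (g q))"
      using g by (intro integrable_mult_right integrable_norm)
    show "AE q in lborel. (\<lambda>n. cis (- 1 * (q \<bullet> z)) * (gauss_mean (c n) f q * g q))
      \<longlonglongrightarrow> cis (- 1 * (q \<bullet> z)) * (f q * g q)"
      by (intro AE_I2 tendsto_intros tendsto_gauss_mean[OF f c])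
    show "AE q in lborel. cmod (cis (- 1 * (q \<bullet> z)) * (gauss_mean (c n) f q * g q)) \<le> B * cmod (g q)" for n
      using cmod_gauss_mean_le[OF f(2)] by (intro AE_I2) (simp add: norm_mult mult_right_mono)
  qed measurable
qed

lemma fourier2_mult_le:
  assumes f: "integrable lborel f" "continuous_on UNIV f" "\<And>p. cmod (f p) \<le> B" and g: "integrable lborel g"
  shows "ennreal (cmod (fourier2 (\<lambda>p. f p * g p) z))
    \<le> (\<integral>\<^sup>+w. ennreal (cmod (fourier2 f w)) * ennreal (cmod (fourier2 g (z - w))) \<partial>lborel)"
proof (rule Lim_bounded)
  let ?c = "\<lambda>n. 1 / real (Suc n)"
  have "?c \<longlonglongrightarrow> 0"
    by (rule LIMSEQ_Suc[OF lim_1_over_n])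
  then show "(\<lambda>n. ennreal (cmod (fourier2 (\<lambda>q. gauss_mean (?c n) f q * g q) z)))
    \<longlonglongrightarrow> ennreal (cmod (fourier2 (\<lambda>p. f p * g p) z))"
    using f g by (intro tendsto_ennrealI tendsto_norm tendsto_fourier2_gauss_mean_mult)
  show "\<forall>n\<ge>0. ennreal (cmod (fourier2 (\<lambda>q. gauss_mean (?c n) f q * g q) z))
      \<le> (\<integral>\<^sup>+w. ennreal (cmod (fourier2 f w)) * ennreal (cmod (fourier2 g (z - w))) \<partial>lborel)"
    using cmod_fourier2_gauss_mean_mult_le[OF f(1) g] by simp
qed

section \<open>Fourier transform of a derivative\<close>

definition quadratic_decay :: "(real \<Rightarrow> complex) \<Rightarrow> bool" where
  "quadratic_decay f \<longleftrightarrow> (\<exists>C. \<forall>x. cmod (f x) * (1 + x\<^sup>2) \<le> C)"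

lemma one_plus_square_pos [simp]: "0 < 1 + (x :: real)\<^sup>2"
  by (simp add: add_pos_nonneg)

lemma integrable_inverse_one_plus_square: "integrable lborel (\<lambda>x::real. complex_of_real (1 / (1 + x\<^sup>2)))"
  using integrable_inverse_1_plus_square
  by (intro integrable_of_real) (simp add: set_integrable_def inverse_eq_divide)

lemma integrable_of_quadratic_decay:
  assumes "continuous_on UNIV f" "quadratic_decay f"
  shows "integrable lborel f"
proof -
  obtain C where decay: "\<And>x. cmod (f x) * (1 + x\<^sup>2) \<le> C"
    using assms(2) by (auto simp: quadratic_decay_def)
  show ?thesis
  proof (rule Bochner_Integration.integrable_bound)
    show "integrable lborel (\<lambda>x. complex_of_real C * complex_of_real (1 / (1 + x\<^sup>2)))"
      by (intro integrable_mult_right integrable_inverse_one_plus_square)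
    show "f \<in> borel_measurable lborel"
      using borel_measurable_continuous_onI[OF assms(1)] by simp
    have "cmod (f x) \<le> \<bar>C\<bar> * \<bar>1 / (1 + x\<^sup>2)\<bar>" for x
      using order_trans[OF decay abs_ge_self] by (simp add: pos_le_divide_eq)
    then show "AE x in lborel. cmod (f x) \<le> cmod (complex_of_real C * complex_of_real (1 / (1 + x\<^sup>2)))"
      unfolding norm_mult norm_of_real by (rule AE_I2)
  qed
qed

lemma tendsto_0_of_quadratic_decay:
  assumes "quadratic_decay f" and F: "F = at_top \<or> F = at_bot"
  shows "(f \<longlongrightarrow> 0) F"
proof -
  obtain C where decay: "\<And>x. cmod (f x) * (1 + x\<^sup>2) \<le> C"
    using assms(1) by (auto simp: quadratic_decay_def)
  show ?thesis
  proof (rule Lim_null_comparison)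
    show "\<forall>\<^sub>F x in F. cmod (f x) \<le> C / (1 + x\<^sup>2)"
      using decay by (intro always_eventually allI) (simp add: pos_le_divide_eq)
    have "filterlim (\<lambda>x::real. x\<^sup>2) at_top F"
      using F filterlim_pow_at_top[OF _ filterlim_ident, of 2]
        filterlim_pow_at_bot_even[OF _ filterlim_ident, of 2] by auto
    then have "filterlim (\<lambda>x::real. 1 + x\<^sup>2) at_top F"
      by (intro filterlim_tendsto_add_at_top[OF tendsto_const])
    then show "((\<lambda>x. C / (1 + x\<^sup>2)) \<longlongrightarrow> 0) F"
      by (intro tendsto_divide_0[OF tendsto_const] filterlim_at_top_imp_at_infinity)
  qed
qed

lemma quadratic_decay_unimodular_mult:
  assumes "quadratic_decay f" and "\<And>x. cmod (u x) = 1"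
  shows "quadratic_decay (\<lambda>x. u x * f x)"
  using assms by (simp add: quadratic_decay_def norm_mult)

lemma integral_derivative_eq_0:
  fixes F f :: "real \<Rightarrow> complex"
  assumes F: "\<And>x. (F has_vector_derivative f x) (at x)" and f: "continuous_on UNIV f" "integrable lborel f"
    and lim: "(F \<longlongrightarrow> 0) at_top" "(F \<longlongrightarrow> 0) at_bot"
  shows "(LINT x|lborel. f x) = 0"
proof -
  have "(LBINT x=-\<infinity>..\<infinity>. f x) = 0 - 0"
  proof (rule interval_integral_FTC_integrable)
    show "isCont f x" for x
      using f(1) by (simp add: continuous_on_eq_continuous_at)
    show "set_integrable lborel (einterval (- \<infinity>) \<infinity>) f"
      using f(2) by (simp add: set_integrable_def)
  qed (use F lim in \<open>auto simp: ereal_tendsto_simps\<close>)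
  then show ?thesis
    by (simp add: interval_lebesgue_integral_def set_lebesgue_integral_def)
qed

lemma has_vector_derivative_cis_affine:
  "((\<lambda>x. cis (- (a + x * \<xi>))) has_vector_derivative - (\<i> * complex_of_real \<xi>) * cis (- (a + x * \<xi>))) (at x)"
proof -
  let ?E = "\<lambda>z. exp (- (\<i> * (complex_of_real a + z * complex_of_real \<xi>)))"
  have "(?E has_field_derivative - (\<i> * complex_of_real \<xi>) * ?E (complex_of_real x)) (at (complex_of_real x))"
    by (auto intro!: derivative_eq_intros)
  from has_vector_derivative_real_field[OF this]
  have "((\<lambda>x. ?E (complex_of_real x)) has_vector_derivative
      - (\<i> * complex_of_real \<xi>) * ?E (complex_of_real x)) (at x)" .
  moreover have "cis (- (a + x * \<xi>)) = ?E (complex_of_real x)" for x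
    by (simp add: cis_conv_exp algebra_simps)
  ultimately show ?thesis by (simp only:)
qed

lemma integral_cis_derivative:
  fixes g h :: "real \<Rightarrow> complex"
  assumes deriv: "\<And>x. (g has_vector_derivative h x) (at x)" and h: "continuous_on UNIV h" "quadratic_decay h"
    and g: "quadratic_decay g"
  shows "(LINT x|lborel. cis (- (a + x * \<xi>)) * h x)
    = \<i> * complex_of_real \<xi> * (LINT x|lborel. cis (- (a + x * \<xi>)) * g x)"
proof -
  let ?E = "\<lambda>x. cis (- (a + x * \<xi>))" and ?c = "\<i> * complex_of_real \<xi>"
  have "continuous_on UNIV g"
    using deriv by (auto intro!: continuous_at_imp_continuous_on has_vector_derivative_continuous)
  then have g_integrable: "integrable lborel (\<lambda>x. ?E x * g x)"
    and h_integrable: "integrable lborel (\<lambda>x. ?E x * h x)"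
    using g h by (auto intro!: integrable_of_quadratic_decay quadratic_decay_unimodular_mult continuous_intros)
  have "(LINT x|lborel. ?E x * h x - ?c * (?E x * g x)) = 0"
  proof (rule integral_derivative_eq_0)
    show "((\<lambda>x. ?E x * g x) has_vector_derivative ?E x * h x - ?c * (?E x * g x)) (at x)" for x
      using has_vector_derivative_mult[OF has_vector_derivative_cis_affine deriv, of a \<xi> x]
      by (simp add: algebra_simps)
    show "continuous_on UNIV (\<lambda>x. ?E x * h x - ?c * (?E x * g x))"
      using \<open>continuous_on UNIV g\<close> h(1) by (intro continuous_intros)
    show "integrable lborel (\<lambda>x. ?E x * h x - ?c * (?E x * g x))"
      by (intro Bochner_Integration.integrable_diff integrable_mult_right g_integrable h_integrable)
    show "((\<lambda>x. ?E x * g x) \<longlongrightarrow> 0) at_top" "((\<lambda>x. ?E x * g x) \<longlongrightarrow> 0) at_bot"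
      using g by (auto intro!: tendsto_0_of_quadratic_decay quadratic_decay_unimodular_mult)
  qed
  then show ?thesis
    using g_integrable h_integrable by simp
qed

definition plane_decay :: "(real \<times> real \<Rightarrow> complex) \<Rightarrow> bool" where
  "plane_decay f \<longleftrightarrow> continuous_on UNIV f \<and> (\<exists>C. \<forall>t x. cmod (f (t, x)) * ((1 + t\<^sup>2) * (1 + x\<^sup>2)) \<le> C)"

lemma plane_decayE:
  assumes "plane_decay f"
  obtains C where "continuous_on UNIV f" "0 \<le> C" "\<And>t x. cmod (f (t, x)) * ((1 + t\<^sup>2) * (1 + x\<^sup>2)) \<le> C"
proof -
  obtain C where "continuous_on UNIV f" and decay: "\<And>t x. cmod (f (t, x)) * ((1 + t\<^sup>2) * (1 + x\<^sup>2)) \<le> C"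
    using assms by (auto simp: plane_decay_def)
  moreover have "0 \<le> C"
    using order_trans[OF _ decay[of 0 0]] by simp
  ultimately show thesis
    by (blast intro: that)
qed

lemma plane_decay_slice:
  assumes "plane_decay f"
  shows "continuous_on UNIV (\<lambda>x. f (t, x))" "quadratic_decay (\<lambda>x. f (t, x))"
proof -
  obtain C where f_continuous: "continuous_on UNIV f" and decay: "\<And>t x. cmod (f (t, x)) * ((1 + t\<^sup>2) * (1 + x\<^sup>2)) \<le> C"
    using assms by (rule plane_decayE) blast
  show "continuous_on UNIV (\<lambda>x. f (t, x))"
    by (rule continuous_on_compose2[OF f_continuous]) (auto intro!: continuous_intros)
  have "cmod (f (t, x)) * (1 * (1 + x\<^sup>2)) \<le> cmod (f (t, x)) * ((1 + t\<^sup>2) * (1 + x\<^sup>2))" for x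
    by (intro mult_left_mono mult_right_mono) auto
  then show "quadratic_decay (\<lambda>x. f (t, x))"
    unfolding quadratic_decay_def using order_trans[OF _ decay] by (metis mult_1)
qed

lemma plane_decay_bounded:
  assumes "plane_decay f"
  obtains B where "\<And>p. cmod (f p) \<le> B"
proof -
  obtain C where decay: "\<And>t x. cmod (f (t, x)) * ((1 + t\<^sup>2) * (1 + x\<^sup>2)) \<le> C"
    using assms by (rule plane_decayE) blast
  have "cmod (f (t, x)) * (1 * 1) \<le> cmod (f (t, x)) * ((1 + t\<^sup>2) * (1 + x\<^sup>2))" for t x
    by (intro mult_left_mono mult_mono) auto
  then have "cmod (f (t, x)) \<le> C" for t x
    using order_trans[OF _ decay] by (metis mult_1_right)
  then show thesis
    using that by (metis prod.collapse)
qed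

lemma plane_decay_integrable:
  assumes "plane_decay f"
  shows "integrable lborel f"
proof -
  obtain C where f_continuous: "continuous_on UNIV f" and "0 \<le> C"
    and decay: "\<And>t x. cmod (f (t, x)) * ((1 + t\<^sup>2) * (1 + x\<^sup>2)) \<le> C"
    using assms by (rule plane_decayE) blast
  let ?e = "\<lambda>x::real. complex_of_real (1 / (1 + x\<^sup>2))"
  show ?thesis
  proof (rule Bochner_Integration.integrable_bound)
    have "integrable (lborel \<Otimes>\<^sub>M lborel) (\<lambda>(t, x). 1 * (?e t * ?e x))"
      by (intro lborel_pair.integrable_mult_tensor integrable_inverse_one_plus_square) auto
    then show "integrable lborel (\<lambda>p. complex_of_real C * (\<lambda>(t, x). 1 * (?e t * ?e x)) p)"
      unfolding lborel_prod by (rule integrable_mult_right)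
    show "f \<in> borel_measurable lborel"
      using borel_measurable_continuous_onI[OF f_continuous] by simp
    have "cmod (f (t, x)) \<le> C / ((1 + t\<^sup>2) * (1 + x\<^sup>2))" for t x
      using decay by (simp add: pos_le_divide_eq)
    then show "AE p in lborel. cmod (f p) \<le> cmod (complex_of_real C * (\<lambda>(t, x). 1 * (?e t * ?e x)) p)"
      using \<open>0 \<le> C\<close> by (intro AE_I2) (auto simp: norm_mult norm_divide abs_mult simp del: of_real_add of_real_power)
  qed
qed

lemma plane_decay_mult:
  assumes "plane_decay f" "plane_decay g"
  shows "plane_decay (\<lambda>p. f p * g p)"
proof -
  obtain B where f_le: "\<And>p. cmod (f p) \<le> B"
    using assms(1) by (rule plane_decay_bounded) blast
  obtain D where "0 \<le> D" and g_decay: "\<And>t x. cmod (g (t, x)) * ((1 + t\<^sup>2) * (1 + x\<^sup>2)) \<le> D"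
    using assms(2) by (rule plane_decayE) blast
  have "cmod (f (t, x)) * (cmod (g (t, x)) * ((1 + t\<^sup>2) * (1 + x\<^sup>2))) \<le> B * D" for t x
    using f_le[of "(t, x)"] g_decay[of t x] by (intro mult_mono) (auto intro: order_trans[OF norm_ge_zero])
  then have "\<exists>C. \<forall>t x. cmod (f (t, x) * g (t, x)) * ((1 + t\<^sup>2) * (1 + x\<^sup>2)) \<le> C"
    by (auto simp: norm_mult mult.assoc)
  moreover have "continuous_on UNIV (\<lambda>p. f p * g p)"
    using assms by (intro continuous_intros) (auto simp: plane_decay_def)
  ultimately show ?thesis
    by (simp add: plane_decay_def)
qed

lemma plane_decay_add:
  assumes "plane_decay f" "plane_decay g"
  shows "plane_decay (\<lambda>p. f p + g p)"
proof -
  obtain C where f_decay: "\<And>t x. cmod (f (t, x)) * ((1 + t\<^sup>2) * (1 + x\<^sup>2)) \<le> C"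
    using assms(1) by (rule plane_decayE) blast
  obtain D where g_decay: "\<And>t x. cmod (g (t, x)) * ((1 + t\<^sup>2) * (1 + x\<^sup>2)) \<le> D"
    using assms(2) by (rule plane_decayE) blast
  have "cmod (f (t, x) + g (t, x)) * ((1 + t\<^sup>2) * (1 + x\<^sup>2)) \<le> C + D" for t x
  proof -
    have "cmod (f (t, x) + g (t, x)) * ((1 + t\<^sup>2) * (1 + x\<^sup>2))
      \<le> (cmod (f (t, x)) + cmod (g (t, x))) * ((1 + t\<^sup>2) * (1 + x\<^sup>2))"
      by (intro mult_right_mono norm_triangle_ineq) auto
    then show ?thesis
      using f_decay[of t x] g_decay[of t x] by (simp only: distrib_right)
  qed
  moreover have "continuous_on UNIV (\<lambda>p. f p + g p)"
    using assms by (intro continuous_intros) (auto simp: plane_decay_def)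
  ultimately show ?thesis
    unfolding plane_decay_def by blast
qed

lemma fourier2_derivative:
  assumes g: "plane_decay g" and h: "plane_decay h"
    and deriv: "\<And>t x. ((\<lambda>y. g (t, y)) has_vector_derivative h (t, x)) (at x)"
  shows "fourier2 h w = \<i> * complex_of_real (snd w) * fourier2 g w"
proof -
  let ?E = "\<lambda>p. cis (- 1 * (p \<bullet> w))"
  have iterate: "(LINT p|lborel. ?E p * f p)
    = (LINT t|lborel. LINT x|lborel. ?E (t, x) * f (t, x))" if "plane_decay f" for f
  proof -
    have "f \<in> borel_measurable borel"
      using that by (auto simp: plane_decay_def intro: borel_measurable_continuous_onI)
    then have "integrable lborel (\<lambda>p. ?E p * f p)"
      by (intro Bochner_Integration.integrable_bound[OF plane_decay_integrable[OF that]]) (auto simp: norm_mult)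
    then show ?thesis
      using lborel_pair.integral_fst'[of "\<lambda>p. ?E p * f p"] by (simp only: lborel_prod)
  qed
  have E_slice: "?E (t, x) = cis (- (t * fst w + x * snd w))" for t x
    by (simp add: inner_prod_def)
  have "(LINT x|lborel. ?E (t, x) * h (t, x))
    = \<i> * complex_of_real (snd w) * (LINT x|lborel. ?E (t, x) * g (t, x))" for t
    unfolding E_slice by (rule integral_cis_derivative[OF deriv plane_decay_slice[OF h] plane_decay_slice(2)[OF g]])
  then have "(LINT t|lborel. LINT x|lborel. ?E (t, x) * h (t, x))
    = \<i> * complex_of_real (snd w) * (LINT t|lborel. LINT x|lborel. ?E (t, x) * g (t, x))"
    by (simp only: integral_mult_right_zero)
  then show ?thesis
    unfolding fourier2_eq iterate[OF g] iterate[OF h] by simp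
qed

lemma schwartz_plane_decay:
  assumes "schwartz u"
  shows "plane_decay (iterpd ds u)"
proof -
  let ?f = "iterpd ds u"
  have "\<exists>B. \<forall>t x. \<bar>t ^ a * x ^ c\<bar> * cmod (?f (t, x)) \<le> B" for a c :: nat
  proof -
    have "bounded (range (\<lambda>(t, x). complex_of_real (t ^ a * x ^ c) * ?f (t, x)))"
      using assms unfolding schwartz_def by blast
    then obtain B where "\<forall>y\<in>range (\<lambda>(t, x). complex_of_real (t ^ a * x ^ c) * ?f (t, x)). cmod y \<le> B"
      unfolding bounded_iff by blast
    then have "cmod (complex_of_real (t ^ a * x ^ c) * ?f (t, x)) \<le> B" for t x
      by auto
    then show ?thesis
      unfolding norm_mult norm_of_real by blast
  qed
  then obtain B where moment_le: "\<And>a c t x. \<bar>t ^ a * x ^ c\<bar> * cmod (?f (t, x)) \<le> B a c"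
    by metis
  have "cmod (?f (t, x)) * ((1 + t\<^sup>2) * (1 + x\<^sup>2)) \<le> B 0 0 + B 2 0 + B 0 2 + B 2 2" for t x
  proof -
    have "cmod (?f (t, x)) * ((1 + t\<^sup>2) * (1 + x\<^sup>2))
      = \<bar>t ^ 0 * x ^ 0\<bar> * cmod (?f (t, x)) + \<bar>t ^ 2 * x ^ 0\<bar> * cmod (?f (t, x))
       + \<bar>t ^ 0 * x ^ 2\<bar> * cmod (?f (t, x)) + \<bar>t ^ 2 * x ^ 2\<bar> * cmod (?f (t, x))"
      by (simp add: algebra_simps abs_mult)
    then show ?thesis
      using moment_le[of t 0 x 0] moment_le[of t 2 x 0] moment_le[of t 0 x 2] moment_le[of t 2 x 2] by linarith
  qed
  moreover have "continuous_on UNIV ?f"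
    using assms unfolding schwartz_def by blast
  ultimately show ?thesis
    unfolding plane_decay_def by blast
qed

lemma schwartz_has_dx:
  assumes "schwartz u"
  shows "((\<lambda>y. u (t, y)) has_vector_derivative dx u (t, x)) (at x)"
proof -
  have "(\<lambda>y. iterpd [] u (t, y)) differentiable (at x)"
    using assms unfolding schwartz_def by blast
  then show ?thesis
    by (simp add: dx_def pd_def vector_derivative_works)
qed

lemma schwartz_plane_decay_dx:
  assumes "schwartz u"
  shows "plane_decay u" "plane_decay (dx u)"
  using schwartz_plane_decay[OF assms, of "[]"] schwartz_plane_decay[OF assms, of "[False]"]
  by (simp_all add: dx_def)

lemma schwartz_continuous: "schwartz u \<Longrightarrow> continuous_on UNIV u"
  using schwartz_plane_decay_dx(1) by (simp add: plane_decay_def)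

lemma schwartz_measurable: "schwartz u \<Longrightarrow> u \<in> borel_measurable borel"
  by (intro borel_measurable_continuous_onI schwartz_continuous)

lemma cmod_fourier2_dx_mult:
  assumes u: "schwartz u" and v: "schwartz v"
  shows "cmod (fourier2 (dx (\<lambda>p. u p * v p)) w) = \<bar>snd w\<bar> * cmod (fourier2 (\<lambda>p. u p * v p) w)"
proof -
  let ?h = "\<lambda>p. u p * dx v p + dx u p * v p"
  have deriv: "((\<lambda>y. u (t, y) * v (t, y)) has_vector_derivative ?h (t, x)) (at x)" for t x
    by (rule has_vector_derivative_mult[OF schwartz_has_dx[OF u] schwartz_has_dx[OF v]])
  have "dx (\<lambda>p. u p * v p) = ?h"
    using vector_derivative_at[OF deriv] by (auto simp: dx_def pd_def)
  moreover have "fourier2 ?h w = \<i> * complex_of_real (snd w) * fourier2 (\<lambda>p. u p * v p) w"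
    by (intro fourier2_derivative plane_decay_add plane_decay_mult schwartz_plane_decay_dx u v deriv)
  ultimately show ?thesis
    by (simp add: norm_mult)
qed

definition dx_convolution_dominated ::
    "(real \<times> real \<Rightarrow> complex) \<Rightarrow> (real \<times> real \<Rightarrow> complex) \<Rightarrow> (real \<times> real \<Rightarrow> complex) \<Rightarrow> bool" where
  "dx_convolution_dominated U F G \<longleftrightarrow> (\<forall>z. ennreal (cmod (U z)) \<le>
    ennreal \<bar>snd z\<bar> * (\<integral>\<^sup>+w. ennreal (cmod (F w)) * ennreal (cmod (G (z - w))) \<partial>lborel))"

lemma dx_convolution_dominated_fourier2:
  assumes u: "schwartz u" and v: "schwartz v"
  shows "dx_convolution_dominated (fourier2 (dx (\<lambda>p. u p * v p))) (fourier2 u) (fourier2 v)"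
  unfolding dx_convolution_dominated_def
proof
  fix z
  obtain B where "\<And>p. cmod (u p) \<le> B"
    using schwartz_plane_decay_dx(1)[OF u] by (rule plane_decay_bounded) blast
  then have "ennreal (cmod (fourier2 (\<lambda>p. u p * v p) z))
    \<le> (\<integral>\<^sup>+w. ennreal (cmod (fourier2 u w)) * ennreal (cmod (fourier2 v (z - w))) \<partial>lborel)"
    by (intro fourier2_mult_le plane_decay_integrable schwartz_continuous schwartz_plane_decay_dx(1) u v)
  then show "ennreal (cmod (fourier2 (dx (\<lambda>p. u p * v p)) z))
    \<le> ennreal \<bar>snd z\<bar> * (\<integral>\<^sup>+w. ennreal (cmod (fourier2 u w)) * ennreal (cmod (fourier2 v (z - w))) \<partial>lborel)"
    unfolding cmod_fourier2_dx_mult[OF u v] ennreal_mult'[OF abs_ge_zero] by (rule mult_left_mono) simp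
qed

section \<open>The bilinear estimate\<close>

lemma ennreal_power2_le_imp_le:
  fixes a c :: ennreal
  assumes "a\<^sup>2 \<le> c\<^sup>2"
  shows "a \<le> c"
proof (cases a; cases c)
  fix r q
  assume "a = ennreal r" "0 \<le> r" "c = ennreal q" "0 \<le> q"
  then show ?thesis
    using assms by (simp add: ennreal_power power_mono_iff)
next
  fix q
  assume "a = top" "c = ennreal q" "0 \<le> q"
  then show ?thesis
    using assms by (simp add: ennreal_power top_unique)
qed simp_all

lemma ennreal_finite_le_power2:
  assumes "M < \<infinity>"
  obtains c where "0 < c" "M \<le> (ennreal c)\<^sup>2"
proof -
  obtain m where m_eq: "0 \<le> m" "M = ennreal m"
    using assms by (cases M) auto
  have "m = (sqrt m)\<^sup>2"
    using m_eq(1) by simp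
  also have "\<dots> \<le> (sqrt m + 1)\<^sup>2"
    using m_eq(1) by (intro power_mono) auto
  finally have "M \<le> (ennreal (sqrt m + 1))\<^sup>2"
    using m_eq by (simp add: ennreal_power ennreal_leI del: ennreal_plus)
  moreover have "0 < sqrt m + 1"
    using m_eq(1) by (simp add: add_nonneg_pos)
  ultimately show thesis
    by (rule that[rotated])
qed

lemma AE_lborel_snd_neq: "AE w in (lborel :: (real \<times> real) measure). snd w \<noteq> r"
proof -
  have "emeasure (lborel \<Otimes>\<^sub>M lborel) ((UNIV :: real set) \<times> {r})
    = emeasure lborel (UNIV :: real set) * emeasure lborel {r}"
    by (intro lborel.emeasure_pair_measure_Times) auto
  then have "(UNIV :: real set) \<times> {r} \<in> null_sets (lborel :: (real \<times> real) measure)"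
    by (auto simp: null_sets_def lborel_prod intro: borel_closed closed_Times)
  then show ?thesis
    by (rule AE_I') auto
qed

lemma Xweight_pos: "snd p \<noteq> 0 \<Longrightarrow> 0 < Xweight \<alpha> s \<omega> b p"
  by (auto simp: Xweight_def split: prod.split)

lemma sqrt_Xweight_shift:
  "sqrt (Xweight \<alpha> (r + q) \<omega> b p) = jb (snd p) powr q * sqrt (Xweight \<alpha> r \<omega> b p)"
proof (cases p)
  case (Pair t x)
  have "jb x powr (2 * (r + q) - 2 * \<alpha> * \<omega>) = (jb x powr q)\<^sup>2 * jb x powr (2 * r - 2 * \<alpha> * \<omega>)"
    unfolding power2_eq_square powr_add[symmetric] by (simp add: algebra_simps)
  then have "Xweight \<alpha> (r + q) \<omega> b p = (jb x powr q)\<^sup>2 * Xweight \<alpha> r \<omega> b p"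
    unfolding Pair Xweight_def prod.case by (simp only: mult_ac)
  then show ?thesis
    by (simp add: Pair real_sqrt_mult)
qed

definition Xdensity :: "real \<Rightarrow> real \<Rightarrow> real \<Rightarrow> real \<Rightarrow> (real \<times> real \<Rightarrow> complex) \<Rightarrow> real \<times> real \<Rightarrow> ennreal" where
  "Xdensity \<alpha> s \<omega> b F p = ennreal (sqrt (Xweight \<alpha> s \<omega> b p) * cmod (F p))"

lemma Xdensity_measurable [measurable]:
  assumes [measurable]: "F \<in> borel_measurable borel"
  shows "Xdensity \<alpha> s \<omega> b F \<in> borel_measurable borel"
  unfolding Xdensity_def[abs_def] by measurable

lemma Xnorm_power2: "(Xnorm \<alpha> s \<omega> b u)\<^sup>2 = L2_mass (Xdensity \<alpha> s \<omega> b (fourier2 u))"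
proof -
  let ?I = "\<integral>\<^sup>+p. ennreal (Xweight \<alpha> s \<omega> b p * (cmod (fourier2 u p))\<^sup>2) \<partial>lborel"
  have "L2_mass (Xdensity \<alpha> s \<omega> b (fourier2 u)) = ?I"
    by (simp add: L2_mass_def Xdensity_def ennreal_power power_mult_distrib)
  also have "?I = (Xnorm \<alpha> s \<omega> b u)\<^sup>2"
    by (cases ?I) (simp_all add: Xnorm_def Let_def ennreal_power)
  finally show ?thesis ..
qed

lemma L2_mass_Xdensity_mono:
  assumes "r \<le> s"
  shows "L2_mass (Xdensity \<alpha> r \<omega> b F) \<le> L2_mass (Xdensity \<alpha> s \<omega> b F)"
  unfolding L2_mass_def Xdensity_def
proof (intro nn_integral_mono power_mono ennreal_leI mult_right_mono)
  fix p :: "real \<times> real"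
  have "1 * sqrt (Xweight \<alpha> r \<omega> b p) \<le> jb (snd p) powr (s - r) * sqrt (Xweight \<alpha> r \<omega> b p)"
    using assms by (intro mult_right_mono ge_one_powr_ge_zero) auto
  then show "sqrt (Xweight \<alpha> r \<omega> b p) \<le> sqrt (Xweight \<alpha> s \<omega> b p)"
    using sqrt_Xweight_shift[of \<alpha> r "s - r" \<omega> b p] by simp
qed auto

context dispersion_params
begin

lemma kernel_factorization:
  assumes "snd p \<noteq> 0" "snd q \<noteq> 0"
  shows "\<bar>snd (p + q)\<bar> * sqrt (Xweight \<alpha> (- \<rho>) \<omega> b' (p + q))
    = kernel p q * (sqrt (Xweight \<alpha> (- \<rho>) \<omega> b p) * sqrt (Xweight \<alpha> (- \<rho>) \<omega> b q))"
proof -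
  have "(snd (p + q))\<^sup>2 * Xweight \<alpha> (- \<rho>) \<omega> b' (p + q)
    = kernel_sq p q * (Xweight \<alpha> (- \<rho>) \<omega> b p * Xweight \<alpha> (- \<rho>) \<omega> b q)"
    using Xweight_pos[OF assms(1)] Xweight_pos[OF assms(2)] by (simp add: kernel_sq_def less_imp_neq[symmetric])
  from arg_cong[OF this, of sqrt] show ?thesis
    by (simp add: real_sqrt_mult kernel_def)
qed

lemma kernel_distributes_regularity:
  assumes "- \<rho> \<le> s" "snd p \<noteq> 0" "snd q \<noteq> 0"
  shows "\<bar>snd (p + q)\<bar> * sqrt (Xweight \<alpha> s \<omega> b' (p + q)) \<le> 2 powr (s + \<rho>) * kernel p q *
    (sqrt (Xweight \<alpha> s \<omega> b p) * sqrt (Xweight \<alpha> (- \<rho>) \<omega> b q) +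
     sqrt (Xweight \<alpha> (- \<rho>) \<omega> b p) * sqrt (Xweight \<alpha> s \<omega> b q))"
proof -
  let ?q = "s + \<rho>" and ?W = "\<lambda>p. sqrt (Xweight \<alpha> (- \<rho>) \<omega> b p)"
  have shift: "sqrt (Xweight \<alpha> s \<omega> r w) = jb (snd w) powr ?q * sqrt (Xweight \<alpha> (- \<rho>) \<omega> r w)" for r w
    using sqrt_Xweight_shift[of \<alpha> "- \<rho>" ?q \<omega> r w] by simp
  have "\<bar>snd (p + q)\<bar> * sqrt (Xweight \<alpha> s \<omega> b' (p + q)) = jb (snd p + snd q) powr ?q * (kernel p q * (?W p * ?W q))"
    unfolding shift kernel_factorization[OF assms(2,3), symmetric] by simp
  also have "\<dots> \<le> 2 powr ?q * (jb (snd p) powr ?q + jb (snd q) powr ?q) * (kernel p q * (?W p * ?W q))"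
    using assms(1) by (intro mult_right_mono jb_powr_add_le) auto
  finally show ?thesis
    unfolding shift by (simp add: algebra_simps)
qed

lemma Xdensity_pointwise_le:
  assumes "- \<rho> \<le> s" "snd p \<noteq> 0" "snd q \<noteq> 0"
  shows "ennreal (\<bar>snd (p + q)\<bar> * sqrt (Xweight \<alpha> s \<omega> b' (p + q))) * (ennreal (cmod (F p)) * ennreal (cmod (G q)))
    \<le> ennreal (2 powr (s + \<rho>)) * (ennreal (kernel p q) * (Xdensity \<alpha> s \<omega> b F p * Xdensity \<alpha> (- \<rho>) \<omega> b G q) +
      ennreal (kernel p q) * (Xdensity \<alpha> (- \<rho>) \<omega> b F p * Xdensity \<alpha> s \<omega> b G q))"
proof -
  let ?W = "\<lambda>r p. sqrt (Xweight \<alpha> r \<omega> b p)"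
  have "\<bar>snd (p + q)\<bar> * sqrt (Xweight \<alpha> s \<omega> b' (p + q)) * (cmod (F p) * cmod (G q)) \<le> 2 powr (s + \<rho>) * kernel p q *
      (?W s p * ?W (- \<rho>) q + ?W (- \<rho>) p * ?W s q) * (cmod (F p) * cmod (G q))"
    by (intro mult_right_mono kernel_distributes_regularity assms) auto
  also have "\<dots> = 2 powr (s + \<rho>) * (kernel p q * ((?W s p * cmod (F p)) * (?W (- \<rho>) q * cmod (G q))) +
      kernel p q * ((?W (- \<rho>) p * cmod (F p)) * (?W s q * cmod (G q))))"
    by (simp only: distrib_left distrib_right mult_ac)
  finally show ?thesis
    unfolding Xdensity_def
    by (simp add: ennreal_mult[symmetric] ennreal_plus[symmetric] ennreal_leI del: ennreal_plus)
qed

lemma Xdensity_le_kernel_conv: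
  assumes s: "- \<rho> \<le> s" and [measurable]: "F \<in> borel_measurable borel" "G \<in> borel_measurable borel"
    and U: "dx_convolution_dominated U F G"
  shows "Xdensity \<alpha> s \<omega> b' U z \<le> ennreal (2 powr (s + \<rho>)) *
    (kernel_conv (\<lambda>p q. ennreal (kernel p q)) (Xdensity \<alpha> s \<omega> b F) (Xdensity \<alpha> (- \<rho>) \<omega> b G) z +
     kernel_conv (\<lambda>p q. ennreal (kernel p q)) (Xdensity \<alpha> (- \<rho>) \<omega> b F) (Xdensity \<alpha> s \<omega> b G) z)"
proof -
  let ?D = "\<lambda>r. Xdensity \<alpha> r \<omega> b" and ?c = "ennreal (2 powr (s + \<rho>))"
    and ?w = "ennreal (\<bar>snd z\<bar> * sqrt (Xweight \<alpha> s \<omega> b' z))"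
  let ?J = "\<lambda>w. ennreal (kernel w (z - w)) * (?D s F w * ?D (- \<rho>) G (z - w)) +
    ennreal (kernel w (z - w)) * (?D (- \<rho>) F w * ?D s G (z - w))"
  note [measurable] = measurable_kernel_compose[OF bounded_kernel_measurable[OF bounded_kernel_kernel]]
  have "Xdensity \<alpha> s \<omega> b' U z = ennreal (sqrt (Xweight \<alpha> s \<omega> b' z)) * ennreal (cmod (U z))"
    by (simp add: Xdensity_def ennreal_mult)
  also have "\<dots> \<le> ennreal (sqrt (Xweight \<alpha> s \<omega> b' z)) *
      (ennreal \<bar>snd z\<bar> * (\<integral>\<^sup>+w. ennreal (cmod (F w)) * ennreal (cmod (G (z - w))) \<partial>lborel))"
    by (intro mult_left_mono U[unfolded dx_convolution_dominated_def, rule_format]) simp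
  also have "\<dots> = ?w * (\<integral>\<^sup>+w. ennreal (cmod (F w)) * ennreal (cmod (G (z - w))) \<partial>lborel)"
    by (simp add: ennreal_mult mult_ac)
  also have "\<dots> = (\<integral>\<^sup>+w. ?w * (ennreal (cmod (F w)) * ennreal (cmod (G (z - w)))) \<partial>lborel)"
    by (rule nn_integral_cmult[symmetric]) measurable
  also have "\<dots> \<le> (\<integral>\<^sup>+w. ?c * ?J w \<partial>lborel)"
  proof (rule nn_integral_mono_AE)
    show "AE w in lborel. ?w * (ennreal (cmod (F w)) * ennreal (cmod (G (z - w)))) \<le> ?c * ?J w"
      using AE_lborel_snd_neq[of 0] AE_lborel_snd_neq[of "snd z"]
    proof eventually_elim
      case (elim w)
      then show ?case
        using Xdensity_pointwise_le[OF s, of w "z - w" F G] by simp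
    qed
  qed
  also have "\<dots> = ?c * (kernel_conv (\<lambda>p q. ennreal (kernel p q)) (?D s F) (?D (- \<rho>) G) z +
     kernel_conv (\<lambda>p q. ennreal (kernel p q)) (?D (- \<rho>) F) (?D s G) z)"
    unfolding kernel_conv_def by (subst nn_integral_cmult, measurable, subst nn_integral_add, measurable)
  finally show ?thesis .
qed

lemma L2_mass_Xdensity_le:
  assumes "- \<rho> \<le> s" and bound: "kernel_bound (\<lambda>p q. ennreal (kernel p q)) C"
    and [measurable]: "F \<in> borel_measurable borel" "G \<in> borel_measurable borel"
    and "dx_convolution_dominated U F G"
  shows "L2_mass (Xdensity \<alpha> s \<omega> b' U) \<le> (ennreal (2 powr (s + \<rho>)))\<^sup>2 * 4 * C *
    (L2_mass (Xdensity \<alpha> s \<omega> b F) * L2_mass (Xdensity \<alpha> (- \<rho>) \<omega> b G) +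
     L2_mass (Xdensity \<alpha> (- \<rho>) \<omega> b F) * L2_mass (Xdensity \<alpha> s \<omega> b G))"
proof -
  let ?k = "\<lambda>p q. ennreal (kernel p q)" and ?c = "ennreal (2 powr (s + \<rho>))" and ?D = "\<lambda>r. Xdensity \<alpha> r \<omega> b"
  let ?I = "kernel_conv ?k (?D s F) (?D (- \<rho>) G)" and ?J = "kernel_conv ?k (?D (- \<rho>) F) (?D s G)"
  have [measurable]: "?I \<in> borel_measurable borel" "?J \<in> borel_measurable borel"
    by (intro kernel_conv_measurable bounded_kernel_measurable bounded_kernel_kernel; measurable)+
  have "L2_mass (Xdensity \<alpha> s \<omega> b' U) \<le> L2_mass (\<lambda>z. ?c * (?I z + ?J z))"
    unfolding L2_mass_def using assms by (intro nn_integral_mono power_mono Xdensity_le_kernel_conv) auto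
  also have "\<dots> = ?c\<^sup>2 * L2_mass (\<lambda>z. ?I z + ?J z)"
    by (simp add: L2_mass_def power_mult_distrib nn_integral_cmult)
  also have "\<dots> \<le> ?c\<^sup>2 * (4 * (L2_mass ?I + L2_mass ?J))"
    by (intro mult_left_mono L2_mass_add_le) auto
  also have "\<dots> \<le> ?c\<^sup>2 * (4 * (C * (L2_mass (?D s F) * L2_mass (?D (- \<rho>) G)) +
      C * (L2_mass (?D (- \<rho>) F) * L2_mass (?D s G))))"
    by (intro mult_left_mono add_mono kernel_boundD[OF bound]) auto
  finally show ?thesis
    by (simp only: distrib_left mult.assoc)
qed

lemma bilinear_estimate:
  assumes "- \<rho> \<le> s\<^sub>0" "s\<^sub>0 \<le> s"
  obtains c where "0 < c" "\<And>u v. schwartz u \<Longrightarrow> schwartz v \<Longrightarrow> Xnorm \<alpha> s \<omega> b' (dx (\<lambda>p. u p * v p))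
    \<le> ennreal c * (Xnorm \<alpha> s \<omega> b u * Xnorm \<alpha> s\<^sub>0 \<omega> b v + Xnorm \<alpha> s\<^sub>0 \<omega> b u * Xnorm \<alpha> s \<omega> b v)"
proof -
  let ?M = "\<lambda>r u. L2_mass (Xdensity \<alpha> r \<omega> b (fourier2 u))"
  obtain C where "C < \<infinity>" and bound: "kernel_bound (\<lambda>p q. ennreal (kernel p q)) C"
    using bounded_kernel_kernel by (rule bounded_kernelE)
  let ?C = "(ennreal (2 powr (s + \<rho>)))\<^sup>2 * 4 * C"
  have "?C < \<infinity>"
    using \<open>C < \<infinity>\<close> by (simp add: ennreal_mult_less_top power2_eq_square)
  then obtain c where "0 < c" and c_ge: "?C \<le> (ennreal c)\<^sup>2"
    by (rule ennreal_finite_le_power2)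
  show thesis
  proof (rule that[OF \<open>0 < c\<close>], rule ennreal_power2_le_imp_le)
    fix u v assume uv: "schwartz u" "schwartz v"
    let ?A = "Xnorm \<alpha> s \<omega> b u * Xnorm \<alpha> s\<^sub>0 \<omega> b v" and ?B = "Xnorm \<alpha> s\<^sub>0 \<omega> b u * Xnorm \<alpha> s \<omega> b v"
    have "(Xnorm \<alpha> s \<omega> b' (dx (\<lambda>p. u p * v p)))\<^sup>2 \<le> ?C * (?M s u * ?M (- \<rho>) v + ?M (- \<rho>) u * ?M s v)"
      unfolding Xnorm_power2 using assms uv
      by (intro L2_mass_Xdensity_le bound fourier2_measurable schwartz_measurable
        dx_convolution_dominated_fourier2) auto
    also have "\<dots> \<le> ?C * (?M s u * ?M s\<^sub>0 v + ?M s\<^sub>0 u * ?M s v)"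
      using assms(1) by (intro mult_left_mono add_mono mult_right_mono L2_mass_Xdensity_mono) auto
    also have "\<dots> = ?C * (?A\<^sup>2 + ?B\<^sup>2)"
      by (simp add: Xnorm_power2 power_mult_distrib)
    also have "\<dots> \<le> (ennreal c)\<^sup>2 * (?A + ?B)\<^sup>2"
      by (intro mult_mono c_ge) (auto simp: power2_sum)
    finally show "(Xnorm \<alpha> s \<omega> b' (dx (\<lambda>p. u p * v p)))\<^sup>2 \<le> (ennreal c * (?A + ?B))\<^sup>2"
      by (simp only: power_mult_distrib)
  qed
qed

end

theorem theorem3p1:
  fixes \<alpha> s s\<^sub>0 \<omega> :: real
  assumes "1 < \<alpha>" and "\<alpha> < 2"
    and "s\<^sub>0 \<le> s" and "s\<^sub>0 > - (3 / 4) * (\<alpha> - 1)"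
    and "\<omega> = 1 / \<alpha> - 1 / 2"
  shows "\<exists>b' b c. b' > - 1 / 2 \<and> 1 / 2 < b \<and> b < b' + 1 \<and> c > 0 \<and>
    (\<forall>u\<^sub>1 u\<^sub>2. schwartz u\<^sub>1 \<longrightarrow> schwartz u\<^sub>2 \<longrightarrow>
       Xnorm \<alpha> s \<omega> b' (dx (\<lambda>p. u\<^sub>1 p * u\<^sub>2 p))
         \<le> ennreal c * (Xnorm \<alpha> s \<omega> b u\<^sub>1 * Xnorm \<alpha> s\<^sub>0 \<omega> b u\<^sub>2
                        + Xnorm \<alpha> s\<^sub>0 \<omega> b u\<^sub>1 * Xnorm \<alpha> s \<omega> b u\<^sub>2))"
proof -
  define \<rho> where "\<rho> = max 0 (- s\<^sub>0)"
  define \<epsilon> where "\<epsilon> = (3 * (\<alpha> - 1) - 4 * \<rho>) / 12"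
  define b where "b = 1 / 2 + \<epsilon> / 2"
  define b' where "b' = - 1 / 2 + \<epsilon>"
  have rho_bounds: "0 \<le> \<rho>" "- \<rho> \<le> s\<^sub>0" "4 * \<rho> < 3 * (\<alpha> - 1)"
    unfolding \<rho>_def max_def using assms(1,4) by argo+
  then have eps_bounds: "0 < \<epsilon>" "4 * \<rho> + 12 * \<epsilon> = 3 * (\<alpha> - 1)"
    by (auto simp: \<epsilon>_def field_simps)
  interpret dispersion_params \<alpha> \<omega> \<rho> \<epsilon> b b'
    by unfold_locales (use assms rho_bounds eps_bounds in \<open>auto simp: b_def b'_def\<close>)
  obtain c where "0 < c" "\<And>u v. schwartz u \<Longrightarrow> schwartz v \<Longrightarrow> Xnorm \<alpha> s \<omega> b' (dx (\<lambda>p. u p * v p))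
    \<le> ennreal c * (Xnorm \<alpha> s \<omega> b u * Xnorm \<alpha> s\<^sub>0 \<omega> b v + Xnorm \<alpha> s\<^sub>0 \<omega> b u * Xnorm \<alpha> s \<omega> b v)"
    using bilinear_estimate[OF rho_bounds(2) assms(3)] by blast
  moreover have "- 1 / 2 < b'" "1 / 2 < b" "b < b' + 1"
    using eps_bounds(1) by (auto simp: b_def b'_def)
  ultimately show ?thesis
    by blast
qed

end
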